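(* For any $r\in(0,1)$, let $$v_m=\max\Big\{\Big\lfloor\frac m2+\frac{\sqrt m}{2}Q^{-1}(1-r)\Big\rfloor,0\Big\}.$$ Then the rate $r_m$ of $\mathrm{RM}(v_m,m)$ satisfies $r_m\to r$, and the sequence $\{\mathrm{RM}(v_m,m)\}_m$ is capacity achieving on the BEC under block-MAP decoding.
   Context: $Q(t)=\frac1{\sqrt{2\pi}}\int_t^\infty e^{-\tau^2/2}d\tau$. $\mathrm{RM}(v,m)$ is the binary code of length $N=2^m$ consisting of the evaluation vectors $(f(\underline{x}))_{\underline{x}\in\{0,1\}^m}$ of all polynomials over $\mathbb{F}_2$ in the span of multilinear monomials in $x_1,\dots,x_m$ of degree at most $v$; its rate is $2^{-m}\sum_{k=0}^v\binom mk$. A uniform codeword $\underline{X}$ is sent over $\mathrm{BEC}(p)$ (each bit erased independently with probability $p$), giving $\underline{Y}$; $P_B(p)$ is the probability that $\underline{X}$ is not uniquely determined by $\underline{Y}$. A code sequence with rates $r_n\to r\in(0,1)$ is capacity achieving under block-MAP decoding if $P_B^{(n)}(p)\to0$ for every $p\in[0,1-r)$. *)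

theory Defs
  imports "HOL-Analysis.Analysis"
begin

definition Qfun :: "real \<Rightarrow> real" where
  "Qfun t = (1 / sqrt (2 * pi)) * (LBINT \<tau>:{t<..}. exp (- (\<tau>^2) / 2))"

text \<open>Inverse of Q (Q is a strictly decreasing bijection from the reals onto (0,1)).\<close>
definition Qinv :: "real \<Rightarrow> real" where
  "Qinv y = (THE t. Qfun t = y)"

text \<open>Points of {0,1}^m are encoded as subsets A of {..<m} (the coordinates equal to 1).
  A polynomial in the span of multilinear monomials of degree at most v is given by
  coefficients a S (S a subset of {..<m}, card S <= v); the monomial prod_{i in S} x_i
  evaluates to 1 at A iff S is a subset of A. Arithmetic is over F_2 = bool (parity).\<close>
definition rm_eval :: "nat \<Rightarrow> nat \<Rightarrow> (nat set \<Rightarrow> bool) \<Rightarrow> nat set \<Rightarrow> bool" where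
  "rm_eval m v a A =
     (if A \<subseteq> {..<m} then odd (card {S. S \<subseteq> A \<and> card S \<le> v \<and> a S}) else False)"

definition RM :: "nat \<Rightarrow> nat \<Rightarrow> (nat set \<Rightarrow> bool) set" where
  "RM v m = {c. \<exists>a. c = rm_eval m v a}"

definition rm_rate :: "nat \<Rightarrow> nat \<Rightarrow> real" where
  "rm_rate v m = (\<Sum>k\<le>v. real (m choose k)) / 2 ^ m"

text \<open>Block erasure probability of RM(v,m) under block-MAP decoding on BEC(p):
  a uniformly random codeword X is sent, the set E of erased positions has each position
  independently with probability p; failure iff some other codeword agrees with X on all
  non-erased positions (i.e. X is not uniquely determined by the output Y).\<close>
definition PB :: "nat \<Rightarrow> nat \<Rightarrow> real \<Rightarrow> real" where
  "PB v m p =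
     (\<Sum>X\<in>RM v m. (1 / real (card (RM v m))) *
        (\<Sum>E\<in>Pow (Pow {..<m}).
           p ^ card E * (1 - p) ^ (2 ^ m - card E) *
           (if \<exists>X'\<in>RM v m. X' \<noteq> X \<and> (\<forall>i\<in>Pow {..<m} - E. X' i = X i) then 1 else 0)))"

definition capacity_achieving :: "(nat \<Rightarrow> nat) \<Rightarrow> real \<Rightarrow> bool" where
  "capacity_achieving vs r \<longleftrightarrow>
     (\<forall>p. 0 \<le> p \<and> p < 1 - r \<longrightarrow> (\<lambda>m. PB (vs m) m p) \<longlonglongrightarrow> 0)"

end

theory Submission
  imports Defs "HOL-Probability.Probability" "HOL-Real_Asymp.Real_Asymp"
begin

text \<open>
  Let \<open>h n\<close> be the EXIT function of \<open>RM v n\<close>: the probability that a fixed bit cannot be recovered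
  from the other received bits. A codeword of \<open>RM v (n + 1)\<close> restricts to a codeword of \<open>RM v n\<close> on
  every hyperplane, so non-recovery in length \<open>2 ^ (n + 1)\<close> forces non-recovery inside two
  hyperplanes \<open>A\<close>, \<open>B\<close> at once. In terms of the \<open>p\<close>-biased Fourier coefficients \<open>a S\<close> of the
  non-recovery event on \<open>A\<close>, the joint probability is \<open>\<Sum> (a S)\<^sup>2\<close> over the \<open>S \<subseteq> A \<inter> B\<close>, and averaging over
  \<open>B\<close> gives \<open>h (n + 1) \<le> \<Sum>S. (a S)\<^sup>2 / (card S + 1)\<close>.

  Hence \<open>h n * (1 - h n) \<le> 2 * (h n - h (n + 1))\<close>. The integral of \<open>h n\<close> over \<open>p\<close> is the rate of
  \<open>RM v n\<close> (area theorem), and the rates for \<open>n\<close> and \<open>n + 1\<close> differ by \<open>O(1 / sqrt n)\<close>, so \<open>h n\<close> has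
  a sharp threshold at one minus the rate. Below the threshold, starting from \<open>n = m - \<Theta>(sqrt m)\<close>
  with \<open>v = v m\<close> fixed, the recursion first gives a factor \<open>3 / 4\<close> per step; once \<open>h n\<close> is
  exponentially small in \<open>sqrt m\<close>, Bonami's lemma shows that the Fourier weight on sets of size
  \<open>o(sqrt m)\<close> is negligible, so that each further step gains a factor of order \<open>sqrt m\<close>. Thus \<open>h m\<close> is
  at most \<open>2\<close> to the power \<open>- \<Omega>(sqrt m * ln m)\<close>.

  If block decoding fails, some nonzero codeword is contained in the erasure pattern. If its
  weight is at least \<open>2 ^ (m - l)\<close>, that many bits are unrecoverable, which has probability at most
  \<open>2 ^ l * h m\<close>. Codewords of smaller weight are handled by a union bound: such a codeword is the
  pointwise majority of \<open>m + 1\<close> of its \<open>(l - 4)\<close>-fold derivatives, and these are codewords of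
  \<open>RM (v - l + 4) (m - l + 4)\<close>, which is a very small code as soon as \<open>l\<close> is large compared with
  \<open>sqrt (m * ln m)\<close>.
\<close>

section \<open>Reed-Muller codes and derivatives\<close>

text \<open>Points of the cube are subsets of \<open>{..<n}\<close>, so this is vector addition over
  F_2.\<close>

definition sd :: "'a set \<Rightarrow> 'a set \<Rightarrow> 'a set" (infixl "\<oplus>" 65) where
  "x \<oplus> y = (x - y) \<union> (y - x)"

abbreviation cube :: "nat \<Rightarrow> nat set set" where
  "cube n \<equiv> Pow {..<n}"

lemma sd_iff: "i \<in> x \<oplus> y \<longleftrightarrow> (i \<in> x) \<noteq> (i \<in> y)"
  by (auto simp: sd_def)

lemma sd_assoc: "(x \<oplus> y) \<oplus> z = x \<oplus> (y \<oplus> z)"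
  and sd_commute: "x \<oplus> y = y \<oplus> x"
  and sd_left_commute: "x \<oplus> (y \<oplus> z) = y \<oplus> (x \<oplus> z)"
  by (auto simp: sd_def)

lemmas sd_ac = sd_assoc sd_commute sd_left_commute

lemma sd_empty [simp]: "x \<oplus> {} = x" "{} \<oplus> x = x"
  and sd_self [simp]: "x \<oplus> x = {}"
  and sd_cancel [simp]: "x \<oplus> (x \<oplus> y) = y" "(x \<oplus> y) \<oplus> y = x"
  by (auto simp: sd_def)

lemma sd_in_Pow [simp, intro]: "x \<in> Pow A \<Longrightarrow> y \<in> Pow A \<Longrightarrow> x \<oplus> y \<in> Pow A"
  by (auto simp: sd_def)

lemma sd_in_cube [simp, intro]: "x \<subseteq> A \<Longrightarrow> y \<subseteq> A \<Longrightarrow> x \<oplus> y \<subseteq> A"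
  by (auto simp: sd_def)

lemma sd_disjoint: "x \<inter> y = {} \<Longrightarrow> x \<oplus> y = x \<union> y"
  by (auto simp: sd_def)

lemma sd_left_cancel [simp]: "x \<oplus> y = x \<oplus> z \<longleftrightarrow> y = z"
  by (metis sd_cancel(1))

lemma card_cube [simp]: "card (cube n) = 2 ^ n"
  by (simp add: card_Pow)

text \<open>Degree less than \<open>k\<close>, phrased without coordinates, so that invariance under affine maps is
  immediate.\<close>

primrec vanishing :: "nat \<Rightarrow> nat \<Rightarrow> (nat set \<Rightarrow> bool) \<Rightarrow> bool" where
  "vanishing n 0 f \<longleftrightarrow> (\<forall>x\<in>cube n. \<not> f x)"
| "vanishing n (Suc k) f \<longleftrightarrow> (\<forall>y\<in>cube n. vanishing n k (\<lambda>x. f x \<longleftrightarrow> \<not> f (x \<oplus> y)))"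

lemma vanishing_cong:
  "(\<And>x. x \<in> cube n \<Longrightarrow> f x = g x) \<Longrightarrow> vanishing n k f \<longleftrightarrow> vanishing n k g"
proof (induction k arbitrary: f g)
  case 0
  then show ?case by (simp add: Ball_def)
next
  case (Suc k)
  have "vanishing n k (\<lambda>x. f x \<longleftrightarrow> \<not> f (x \<oplus> y)) = vanishing n k (\<lambda>x. g x \<longleftrightarrow> \<not> g (x \<oplus> y))"
    if "y \<in> cube n" for y
    by (rule Suc.IH) (use Suc.prems that in \<open>simp del: Pow_iff add: sd_in_Pow\<close>)
  then show ?case by simp
qed

lemma vanishing_zero: "(\<And>x. x \<in> cube n \<Longrightarrow> \<not> f x) \<Longrightarrow> vanishing n k f"
proof (induction k arbitrary: f)
  case (Suc k)
  then show ?case by (auto intro!: Suc.IH)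
qed auto

lemma vanishing_xor:
  "vanishing n k f \<Longrightarrow> vanishing n k g \<Longrightarrow> vanishing n k (\<lambda>x. f x \<longleftrightarrow> \<not> g x)"
proof (induction k arbitrary: f g)
  case (Suc k)
  have "vanishing n k (\<lambda>x. (f x \<longleftrightarrow> \<not> g x) \<longleftrightarrow> \<not> (f (x \<oplus> y) \<longleftrightarrow> \<not> g (x \<oplus> y)))" if "y \<in> cube n" for y
  proof -
    have "vanishing n k (\<lambda>x. (f x \<longleftrightarrow> \<not> f (x \<oplus> y)) \<longleftrightarrow> \<not> (g x \<longleftrightarrow> \<not> g (x \<oplus> y)))"
      using Suc.prems that
      by (intro Suc.IH[of "\<lambda>x. f x \<longleftrightarrow> \<not> f (x \<oplus> y)" "\<lambda>x. g x \<longleftrightarrow> \<not> g (x \<oplus> y)"]) auto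
    moreover have "(\<lambda>x. (f x \<longleftrightarrow> \<not> f (x \<oplus> y)) \<longleftrightarrow> \<not> (g x \<longleftrightarrow> \<not> g (x \<oplus> y))) =
        (\<lambda>x. (f x \<longleftrightarrow> \<not> g x) \<longleftrightarrow> \<not> (f (x \<oplus> y) \<longleftrightarrow> \<not> g (x \<oplus> y)))" by auto
    ultimately show ?thesis by simp
  qed
  then show ?case by simp
qed auto

text \<open>Here \<open>\<phi>\<close> is affine with linear part \<open>\<psi>\<close>. The
  derivative of the composite in direction \<open>y\<close> is the derivative of \<open>f\<close> in
  direction \<open>\<psi> y\<close> composed with \<open>\<phi>\<close>, so induction on the order
  applies.\<close>

lemma vanishing_compose:
  assumes "\<And>x. x \<in> cube n \<Longrightarrow> \<phi> x \<in> cube n'"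
    and "\<And>x y. x \<in> cube n \<Longrightarrow> y \<in> cube n \<Longrightarrow> \<phi> (x \<oplus> y) = \<phi> x \<oplus> \<psi> y"
    and "\<And>y. y \<in> cube n \<Longrightarrow> \<psi> y \<in> cube n'"
  shows "vanishing n' k f \<Longrightarrow> vanishing n k (\<lambda>x. f (\<phi> x))"
proof (induction k arbitrary: f)
  case 0
  then show ?case using assms(1) by auto
next
  case (Suc k)
  have "vanishing n k (\<lambda>x. f (\<phi> x) \<longleftrightarrow> \<not> f (\<phi> (x \<oplus> y)))" if y: "y \<in> cube n" for y
  proof -
    have "vanishing n k (\<lambda>x. f (\<phi> x) \<longleftrightarrow> \<not> f (\<phi> x \<oplus> \<psi> y))"
      using Suc.IH[of "\<lambda>x. f x \<longleftrightarrow> \<not> f (x \<oplus> \<psi> y)"] Suc.prems assms(3)[OF y] by simp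
    then show ?thesis
      by (subst vanishing_cong[of n _ "\<lambda>x. f (\<phi> x) \<longleftrightarrow> \<not> f (\<phi> x \<oplus> \<psi> y)"])
        (use assms(2) y in auto)
  qed
  then show ?case by simp
qed

lemma vanishing_translate:
  "a \<in> cube n \<Longrightarrow> vanishing n k f \<Longrightarrow> vanishing n k (\<lambda>x. f (x \<oplus> a))"
  by (rule vanishing_compose[where \<psi> = "\<lambda>y. y"]) (auto simp: sd_ac)

lemma vanishing_Suc: "vanishing n k f \<Longrightarrow> vanishing n (Suc k) f"
proof -
  assume f: "vanishing n k f"
  show ?thesis
    using f vanishing_translate[OF _ f] by (auto intro!: vanishing_xor)
qed

declare vanishing.simps(2) [simp del]

lemma vanishing_mono: "k \<le> k' \<Longrightarrow> vanishing n k f \<Longrightarrow> vanishing n k' f"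
  by (induction k' rule: dec_induct) (auto intro: vanishing_Suc)

text \<open>Discrete product rule: the derivative of \<open>f x \<and> i \<in> x\<close> in
  direction \<open>y\<close> is the derivative of \<open>f\<close> times coordinate
  \<open>i\<close>, plus \<open>f (x \<oplus> y)\<close> if \<open>i \<in> y\<close>. In the
  induction step both terms vanish at order \<open>Suc k\<close>.\<close>

lemma vanishing_mult_coordinate:
  "vanishing n k f \<Longrightarrow> vanishing n (Suc k) (\<lambda>x. f x \<and> i \<in> x)"
proof (induction k arbitrary: f)
  case 0
  then show ?case by (intro vanishing_zero) auto
next
  case (Suc k)
  have "vanishing n (Suc k) (\<lambda>x. (f x \<and> i \<in> x) \<longleftrightarrow> \<not> (f (x \<oplus> y) \<and> i \<in> x \<oplus> y))"
    if y: "y \<in> cube n" for y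
  proof -
    have 1: "vanishing n (Suc k) (\<lambda>x. (f x \<longleftrightarrow> \<not> f (x \<oplus> y)) \<and> i \<in> x)"
      using Suc.prems y by (intro Suc.IH) (auto simp: vanishing.simps(2))
    have 2: "vanishing n (Suc k) (\<lambda>x. i \<in> y \<and> f (x \<oplus> y))"
      using vanishing_translate[OF y Suc.prems]
      by (cases "i \<in> y") (simp_all add: vanishing_zero)
    have eq: "(\<lambda>x. (f x \<and> i \<in> x) \<longleftrightarrow> \<not> (f (x \<oplus> y) \<and> i \<in> x \<oplus> y)) =
        (\<lambda>x. ((f x \<longleftrightarrow> \<not> f (x \<oplus> y)) \<and> i \<in> x) \<longleftrightarrow> \<not> (i \<in> y \<and> f (x \<oplus> y)))"
      by (auto simp: sd_iff)
    show ?thesis unfolding eq by (rule vanishing_xor[OF 1 2])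
  qed
  then show ?case unfolding vanishing.simps(2)[of n "Suc k"] by blast
qed

lemma vanishing_monomial:
  "finite S \<Longrightarrow> vanishing n (Suc (card S)) (\<lambda>x. S \<subseteq> x)"
proof (induction S rule: finite_induct)
  case empty
  show ?case by (simp add: vanishing.simps(2))
next
  case (insert i S)
  have "vanishing n (Suc (Suc (card S))) (\<lambda>x. S \<subseteq> x \<and> i \<in> x)"
    by (rule vanishing_mult_coordinate[OF insert.IH])
  then show ?case using insert by (simp add: conj_commute)
qed

lemma card_filter_insert:
  assumes "finite A" "i \<notin> A"
  shows "card {x. (x = i \<or> x \<in> A) \<and> P x} = of_bool (P i) + card {x \<in> A. P x}"
proof -
  have "{x. (x = i \<or> x \<in> A) \<and> P x} = (if P i then insert i {x \<in> A. P x} else {x \<in> A. P x})" by auto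
  then show ?thesis using assms by simp
qed

lemma vanishing_parity:
  assumes "finite F" "\<And>S. S \<in> F \<Longrightarrow> vanishing n k (g S)"
  shows "vanishing n k (\<lambda>x. odd (card {S \<in> F. g S x}))"
  using assms
proof (induction F rule: finite_induct)
  case empty
  then show ?case by (auto intro: vanishing_zero)
next
  case (insert S F)
  have "vanishing n k (\<lambda>x. g S x \<longleftrightarrow> \<not> odd (card {S \<in> F. g S x}))"
    using insert by (intro vanishing_xor) auto
  moreover have "odd (card {T \<in> insert S F. g T x}) \<longleftrightarrow> (g S x \<longleftrightarrow> \<not> odd (card {S \<in> F. g S x}))" for x
    by (simp add: card_filter_insert[OF insert.hyps]) 
  ultimately show ?case by simp
qed

section \<open>Subset sums modulo 2 and derivatives along several directions\<close>

definition psum :: "(nat \<Rightarrow> nat set) \<Rightarrow> nat set \<Rightarrow> nat set" where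
  "psum y T = {j. odd (card {i \<in> T. j \<in> y i})}"

text \<open>Closed form of the successive derivatives in the directions \<open>y i\<close>,
  \<open>i \<in> U\<close>. Counting index sets \<open>T\<close> rather than their sums keeps
  coinciding sums apart.\<close>

definition deriv_along ::
  "(nat \<Rightarrow> nat set) \<Rightarrow> nat set \<Rightarrow> (nat set \<Rightarrow> bool) \<Rightarrow> nat set \<Rightarrow> bool" where
  "deriv_along y U f x \<longleftrightarrow> odd (card {T \<in> Pow U. f (x \<oplus> psum y T)})"

lemma psum_empty [simp]: "psum y {} = {}"
  by (simp add: psum_def)

lemma psum_insert: "finite T \<Longrightarrow> i \<notin> T \<Longrightarrow> psum y (insert i T) = y i \<oplus> psum y T"
  by (rule set_eqI) (auto simp add: psum_def sd_iff card_filter_insert)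

lemma psum_in_cube: "(\<And>i. i \<in> T \<Longrightarrow> y i \<in> cube n) \<Longrightarrow> psum y T \<in> cube n"
proof
  assume *: "\<And>i. i \<in> T \<Longrightarrow> y i \<in> cube n"
  show "psum y T \<subseteq> {..<n}"
  proof
    fix j assume "j \<in> psum y T"
    then have "{i \<in> T. j \<in> y i} \<noteq> {}" by (auto simp: psum_def simp del: Collect_empty_eq intro!: Nat.gr0I)
    then show "j \<in> {..<n}" using * by auto
  qed
qed

lemma odd_card_xor:
  assumes "finite A"
  shows "odd (card {x \<in> A. P x \<longleftrightarrow> \<not> Q x}) \<longleftrightarrow> (odd (card {x \<in> A. P x}) \<noteq> odd (card {x \<in> A. Q x}))"
  using assms by (induction A rule: finite_induct) (simp_all add: card_filter_insert, blast)

lemma deriv_along_empty [simp]: "deriv_along y {} f x = f x"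
proof -
  have "{T \<in> Pow {}. f (x \<oplus> psum y T)} = (if f x then {{}} else {})" by auto
  then show ?thesis by (simp add: deriv_along_def)
qed

text \<open>The subsets of \<open>insert i U\<close> split by whether they contain \<open>i\<close>;
  the parity of the total is that of the exclusive or of the two predicates.\<close>

lemma deriv_along_insert:
  assumes "finite U" "i \<notin> U"
  shows "deriv_along y (insert i U) f x = deriv_along y U (\<lambda>x. f x \<longleftrightarrow> \<not> f (x \<oplus> y i)) x"
proof -
  let ?A = "{T \<in> Pow U. f (x \<oplus> psum y T)}"
  let ?B = "{T \<in> Pow U. f (x \<oplus> psum y T \<oplus> y i)}"
  have "{T \<in> Pow (insert i U). f (x \<oplus> psum y T)} = ?A \<union> insert i ` ?B"
  proof (intro set_eqI iffI)
    fix T assume T: "T \<in> {T \<in> Pow (insert i U). f (x \<oplus> psum y T)}"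
    show "T \<in> ?A \<union> insert i ` ?B"
    proof (cases "i \<in> T")
      case True
      then have e: "T = insert i (T - {i})" by auto
      have "finite (T - {i})" using T assms(1) finite_subset[of T "insert i U"] by auto
      then have "psum y T = y i \<oplus> psum y (T - {i})"
        using psum_insert[of "T - {i}" i y] e by simp
      then have "T - {i} \<in> ?B" using T by (auto simp: sd_ac)
      then show ?thesis using e by blast
    qed (use T in auto)
  next
    fix T assume "T \<in> ?A \<union> insert i ` ?B"
    then show "T \<in> {T \<in> Pow (insert i U). f (x \<oplus> psum y T)}"
    proof
      assume "T \<in> insert i ` ?B"
      then obtain T' where T': "T' \<in> ?B" "T = insert i T'" by auto
      then have "finite T'" "i \<notin> T'" using assms finite_subset by auto
      then have "psum y T = y i \<oplus> psum y T'" using psum_insert T' by auto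
      then show ?thesis using T' by (auto simp: sd_ac)
    qed auto
  qed
  moreover have "?A \<inter> insert i ` ?B = {}" using assms by auto
  moreover have "inj_on (insert i) ?B" using assms by (auto simp: inj_on_def)
  moreover have "finite ?A" "finite ?B" using assms by auto
  ultimately have "card {T \<in> Pow (insert i U). f (x \<oplus> psum y T)} = card ?A + card ?B"
    by (simp add: card_Un_disjoint card_image)
  moreover have "odd (card {T \<in> Pow U. f (x \<oplus> psum y T) \<longleftrightarrow> \<not> f (x \<oplus> psum y T \<oplus> y i)}) \<longleftrightarrow>
      (odd (card ?A) \<noteq> odd (card ?B))"
    using assms by (intro odd_card_xor) auto
  ultimately show ?thesis by (simp add: deriv_along_def)
qed

lemma vanishing_deriv_along:
  assumes "finite U" "\<And>i. i \<in> U \<Longrightarrow> y i \<in> cube n" "vanishing n (card U + k) f"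
  shows "vanishing n k (deriv_along y U f)"
  using assms
proof (induction U arbitrary: f rule: finite_induct)
  case empty
  then show ?case by (simp add: deriv_along_empty[abs_def])
next
  case (insert i U)
  have "vanishing n k (deriv_along y U (\<lambda>x. f x \<longleftrightarrow> \<not> f (x \<oplus> y i)))"
    using insert by (intro insert.IH) (auto simp: vanishing.simps(2))
  then show ?case using insert.hyps by (subst vanishing_cong[OF deriv_along_insert]) auto
qed

lemma psum_singletons: "finite T \<Longrightarrow> psum (\<lambda>i. {i}) T = T"
proof -
  assume "finite T"
  have "{i \<in> T. j = i} = (if j \<in> T then {j} else {})" for j by auto
  then show ?thesis by (simp add: psum_def)
qed

text \<open>Moebius inversion modulo 2: after exchanging the sums, each \<open>T\<close> with
  \<open>a T\<close> is counted once for every set between \<open>T\<close> and \<open>S\<close>,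
  that is \<open>2 ^ card (S - T)\<close> times, which is odd only for \<open>T = S\<close>.\<close>

lemma moebius_parity:
  assumes "finite S"
  shows "odd (card {A \<in> Pow S. odd (card {T \<in> Pow A. a T})}) \<longleftrightarrow> a S"
proof -
  have "odd (card {A \<in> Pow S. odd (card {T \<in> Pow A. a T})}) \<longleftrightarrow>
      odd (\<Sum>A\<in>Pow S. card {T \<in> Pow A. a T})"
    using assms by (simp add: even_sum_iff)
  also have "(\<Sum>A\<in>Pow S. card {T \<in> Pow A. a T}) = (\<Sum>A\<in>Pow S. \<Sum>T\<in>Pow S. of_bool (T \<subseteq> A \<and> a T))"
  proof (intro sum.cong refl)
    fix A assume A: "A \<in> Pow S"
    have "{T \<in> Pow A. a T} = Pow S \<inter> {T. T \<subseteq> A \<and> a T}" using A by auto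
    then show "card {T \<in> Pow A. a T} = (\<Sum>T\<in>Pow S. of_bool (T \<subseteq> A \<and> a T))"
      using assms by simp
  qed
  also have "\<dots> = (\<Sum>T\<in>Pow S. \<Sum>A\<in>Pow S. of_bool (T \<subseteq> A \<and> a T))"
    by (rule sum.swap)
  also have "\<dots> = (\<Sum>T\<in>Pow S. of_bool (a T) * 2 ^ card (S - T))"
  proof (intro sum.cong refl)
    fix T assume T: "T \<in> Pow S"
    have "(\<Sum>A\<in>Pow S. of_bool (T \<subseteq> A \<and> a T)) = (of_bool (a T) * card (Pow S \<inter> {A. T \<subseteq> A}) :: nat)"
      using assms by (cases "a T") (auto simp: Int_def)
    moreover have "card (Pow S \<inter> {A. T \<subseteq> A}) = card (Pow (S - T))"
      by (rule bij_betw_same_card[of "\<lambda>A. A - T"], rule bij_betwI[where g = "\<lambda>B. B \<union> T"])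
        (use T in auto)
    ultimately show "(\<Sum>A\<in>Pow S. of_bool (T \<subseteq> A \<and> a T)) = (of_bool (a T) * 2 ^ card (S - T) :: nat)"
      using assms by (simp add: card_Pow)
  qed
  also have "odd \<dots> \<longleftrightarrow> odd (card {T \<in> Pow S. a T \<and> T = S})"
  proof -
    have "odd (of_bool (a T) * 2 ^ card (S - T) :: nat) \<longleftrightarrow> a T \<and> T = S" if "T \<in> Pow S" for T
      using that assms by (auto simp: card_eq_0_iff)
    then have "{T \<in> Pow S. odd (of_bool (a T) * 2 ^ card (S - T) :: nat)} = {T \<in> Pow S. a T \<and> T = S}"
      by blast
    then show ?thesis using assms by (subst even_sum_iff) auto
  qed
  also have "{T \<in> Pow S. a T \<and> T = S} = (if a S then {S} else {})" by auto
  finally show ?thesis by simp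
qed

section \<open>Codewords as functions of bounded degree\<close>

lemma rm_eval_alt:
  "rm_eval m v a A \<longleftrightarrow> A \<subseteq> {..<m} \<and> odd (card {S \<in> Pow A. card S \<le> v \<and> a S})"
  by (simp add: rm_eval_def Pow_def)

text \<open>Forward, a monomial of degree at most \<open>v\<close> has no derivative of order
  \<open>v + 1\<close>. Backward, Moebius inversion supplies the coefficients, and the coefficient
  of \<open>S\<close> is the derivative along the unit vectors in \<open>S\<close> at the origin,
  which is zero once \<open>card S > v\<close>.\<close>

theorem RM_iff_vanishing:
  "c \<in> RM v m \<longleftrightarrow> (\<forall>x. x \<notin> cube m \<longrightarrow> \<not> c x) \<and> vanishing m (Suc v) c"
proof
  assume "c \<in> RM v m"
  then obtain a where c: "c = rm_eval m v a" by (auto simp: RM_def)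
  define F where "F = {S \<in> cube m. card S \<le> v \<and> a S}"
  have "vanishing m (Suc v) (\<lambda>x. odd (card {S \<in> F. S \<subseteq> x}))"
  proof (rule vanishing_parity)
    fix S assume "S \<in> F"
    then have "finite S" "card S \<le> v" by (auto simp: F_def intro: finite_subset)
    then show "vanishing m (Suc v) (\<lambda>x. S \<subseteq> x)"
      by (intro vanishing_mono[OF _ vanishing_monomial]) auto
  qed (simp add: F_def)
  moreover have "c x = odd (card {S \<in> F. S \<subseteq> x})" if "x \<in> cube m" for x
  proof -
    have "{S \<in> Pow x. card S \<le> v \<and> a S} = {S \<in> F. S \<subseteq> x}" using that by (auto simp: F_def)
    then show ?thesis using that by (simp add: c rm_eval_alt)
  qed
  ultimately have "vanishing m (Suc v) c" by (subst vanishing_cong) auto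
  moreover have "\<forall>x. x \<notin> cube m \<longrightarrow> \<not> c x" by (simp add: c rm_eval_def)
  ultimately show "(\<forall>x. x \<notin> cube m \<longrightarrow> \<not> c x) \<and> vanishing m (Suc v) c" by blast
next
  assume c: "(\<forall>x. x \<notin> cube m \<longrightarrow> \<not> c x) \<and> vanishing m (Suc v) c"
  define a where "a S = odd (card {A \<in> Pow S. c A})" for S
  have small: "card S \<le> v" if S: "S \<subseteq> {..<m}" "a S" for S
  proof (rule ccontr)
    assume "\<not> card S \<le> v"
    have fin: "finite S" using S finite_subset by blast
    have "vanishing m (card S + 0) c"
      using vanishing_mono[of "Suc v" "card S" m c] c \<open>\<not> card S \<le> v\<close>
      by (auto)
    then have "vanishing m 0 (deriv_along (\<lambda>i. {i}) S c)"
      by (intro vanishing_deriv_along) (use S fin in auto)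
    then have "\<not> deriv_along (\<lambda>i. {i}) S c {}" by auto
    moreover have "{T \<in> Pow S. c ({} \<oplus> psum (\<lambda>i. {i}) T)} = {A \<in> Pow S. c A}"
      using fin by (auto simp: psum_singletons finite_subset)
    ultimately show False using S(2) by (simp add: deriv_along_def a_def)
  qed
  have "c A = rm_eval m v a A" for A
  proof (cases "A \<subseteq> {..<m}")
    case True
    then have "finite A" using finite_subset by blast
    moreover have "{S \<in> Pow A. card S \<le> v \<and> a S} = {S \<in> Pow A. a S}" using small True by auto
    ultimately show ?thesis using True moebius_parity[of A c] by (simp add: rm_eval_alt a_def)
  next
    case False
    then show ?thesis using conjunct1[OF c] by (simp add: rm_eval_def)
  qed
  then have "c = rm_eval m v a" by blast
  then show "c \<in> RM v m" unfolding RM_def by blast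
qed

section \<open>Dimension and closure properties of the codes\<close>

lemma card_bounded_subsets:
  "card {S \<in> cube m. card S \<le> v} = (\<Sum>k\<le>v. m choose k)"
proof -
  have "{S \<in> cube m. card S \<le> v} = (\<Union>k\<le>v. {S. S \<subseteq> {..<m} \<and> card S = k})" by auto
  also have "card \<dots> = (\<Sum>k\<le>v. card {S. S \<subseteq> {..<m} \<and> card S = k})"
    by (intro card_UN_disjoint) auto
  finally show ?thesis by (simp add: n_subsets)
qed

lemma card_RM: "card (RM v m) = 2 ^ (\<Sum>k\<le>v. m choose k)"
proof -
  define B where "B = {S \<in> cube m. card S \<le> v}"
  have "bij_betw (\<lambda>F. rm_eval m v (\<lambda>S. S \<in> F)) (Pow B) (RM v m)"
    unfolding bij_betw_def
  proof
    show "inj_on (\<lambda>F. rm_eval m v (\<lambda>S. S \<in> F)) (Pow B)"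
    \<comment> \<open>The left inverse reads the coefficients off the values, by
      \<open>moebius_parity\<close>.\<close>
    proof (rule inj_on_inverseI[where g = "\<lambda>c. {S \<in> B. odd (card {A \<in> Pow S. c A})}"])
      fix F assume F: "F \<in> Pow B"
      have "odd (card {A \<in> Pow S. rm_eval m v (\<lambda>S. S \<in> F) A}) \<longleftrightarrow> S \<in> F" if S: "S \<in> B" for S
      proof -
        have "{A \<in> Pow S. rm_eval m v (\<lambda>S. S \<in> F) A} = {A \<in> Pow S. odd (card {T \<in> Pow A. T \<in> F})}"
        proof -
          have "{T \<in> Pow A. card T \<le> v \<and> T \<in> F} = {T \<in> Pow A. T \<in> F}" for A
            using F by (auto simp: B_def)
          then show ?thesis using S by (auto simp: rm_eval_alt B_def)
        qed
        moreover have "finite S" using S finite_subset by (auto simp: B_def)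
        ultimately show ?thesis using moebius_parity[of S "\<lambda>S. S \<in> F"] by simp
      qed
      then show "{S \<in> B. odd (card {A \<in> Pow S. rm_eval m v (\<lambda>S. S \<in> F) A})} = F"
        using F by auto
    qed
    show "(\<lambda>F. rm_eval m v (\<lambda>S. S \<in> F)) ` Pow B = RM v m"
    proof (intro equalityI subsetI)
      fix c assume "c \<in> RM v m"
      then obtain a where c: "c = rm_eval m v a" by (auto simp: RM_def)
      have "c A = rm_eval m v (\<lambda>S. S \<in> {S \<in> B. a S}) A" for A
      proof (cases "A \<subseteq> {..<m}")
        case True
        then have "{S \<in> Pow A. card S \<le> v \<and> a S} = {S \<in> Pow A. card S \<le> v \<and> S \<in> {S \<in> B. a S}}"
          by (auto simp: B_def)
        then show ?thesis using True by (simp add: c rm_eval_alt)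
      qed (simp add: c rm_eval_def)
      then show "c \<in> (\<lambda>F. rm_eval m v (\<lambda>S. S \<in> F)) ` Pow B" by blast
    qed (auto simp: RM_def)
  qed
  then have "card (RM v m) = card (Pow B)" by (simp add: bij_betw_same_card)
  also have "\<dots> = 2 ^ (\<Sum>k\<le>v. m choose k)"
    using card_bounded_subsets[of m v] by (simp add: card_Pow B_def)
  finally show ?thesis .
qed

lemma finite_RM [simp]: "finite (RM v m)"
  using card_RM[of v m] by (intro card_ge_0_finite) simp

lemma RM_outside: "c \<in> RM v m \<Longrightarrow> c x \<Longrightarrow> x \<in> cube m"
  using RM_iff_vanishing by blast

lemma RM_xor: "c \<in> RM v m \<Longrightarrow> d \<in> RM v m \<Longrightarrow> (\<lambda>x. c x \<longleftrightarrow> \<not> d x) \<in> RM v m"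
  by (auto simp: RM_iff_vanishing intro: vanishing_xor)

lemma RM_zero: "(\<lambda>x. False) \<in> RM v m"
  by (simp add: RM_iff_vanishing vanishing_zero)

lemma RM_pullback:
  assumes "c \<in> RM v n'" "\<And>x. x \<in> cube n \<Longrightarrow> \<phi> x \<in> cube n'"
    and "\<And>x y. x \<in> cube n \<Longrightarrow> y \<in> cube n \<Longrightarrow> \<phi> (x \<oplus> y) = \<phi> x \<oplus> \<phi> y"
  shows "(\<lambda>x. x \<in> cube n \<and> c (\<phi> x)) \<in> RM v n"
proof -
  have "vanishing n (Suc v) (\<lambda>x. c (\<phi> x))"
    using assms by (intro vanishing_compose[of n \<phi> n' \<phi>])
      (auto simp: RM_iff_vanishing)
  then have "vanishing n (Suc v) (\<lambda>x. x \<in> cube n \<and> c (\<phi> x))"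
    by (subst vanishing_cong[where g = "\<lambda>x. c (\<phi> x)"]) auto
  then show ?thesis by (auto simp: RM_iff_vanishing)
qed

lemma RM_translate:
  assumes "c \<in> RM v n" "a \<in> cube n"
  shows "(\<lambda>x. c (x \<oplus> a)) \<in> RM v n"
proof -
  have "x \<in> cube n" if "c (x \<oplus> a)" for x
    using RM_outside[OF assms(1) that] assms(2) sd_in_Pow[of "x \<oplus> a" "{..<n}" a] by simp
  then show ?thesis
    using assms vanishing_translate[of a n "Suc v" c]
    by (auto simp: RM_iff_vanishing)
qed

section \<open>Biased expectations and Fourier analysis\<close>

text \<open>Expectation over a random subset of \<open>I\<close> that contains each element
  independently with probability \<open>p\<close>; on the BEC this subset is the erasure
  pattern.\<close>

definition EP :: "'a set \<Rightarrow> real \<Rightarrow> ('a set \<Rightarrow> real) \<Rightarrow> real" where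
  "EP I p \<phi> = (\<Sum>E\<in>Pow I. p ^ card E * (1 - p) ^ card (I - E) * \<phi> E)"

lemma EP_empty [simp]: "EP {} p \<phi> = \<phi> {}"
  by (simp add: EP_def)

lemma EP_cong: "(\<And>E. E \<subseteq> I \<Longrightarrow> \<phi> E = \<psi> E) \<Longrightarrow> EP I p \<phi> = EP I p \<psi>"
  by (simp add: EP_def)

lemma EP_insert:
  assumes "finite I" "i \<notin> I"
  shows "EP (insert i I) p \<phi> = p * EP I p (\<lambda>E. \<phi> (insert i E)) + (1 - p) * EP I p \<phi>"
proof -
  let ?w = "\<lambda>E. p ^ card E * (1 - p) ^ card (insert i I - E) * \<phi> E"
  have "EP (insert i I) p \<phi> = sum ?w (Pow I) + sum ?w (insert i ` Pow I)"
    unfolding EP_def Pow_insert using assms by (intro sum.union_disjoint) auto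
  also have "sum ?w (insert i ` Pow I) = (\<Sum>E\<in>Pow I. ?w (insert i E))"
    using assms by (subst sum.reindex) (auto simp: inj_on_def)
  also have "\<dots> = p * EP I p (\<lambda>E. \<phi> (insert i E))"
    unfolding EP_def sum_distrib_left
  proof (intro sum.cong refl)
    fix E assume "E \<in> Pow I"
    then have "finite E" "i \<notin> E" "insert i I - insert i E = I - E"
      using assms finite_subset by auto
    then show "?w (insert i E) = p * (p ^ card E * (1 - p) ^ card (I - E) * \<phi> (insert i E))"
      by simp
  qed
  also have "sum ?w (Pow I) = (1 - p) * EP I p \<phi>"
    unfolding EP_def sum_distrib_left
  proof (intro sum.cong refl)
    fix E assume "E \<in> Pow I"
    then have "insert i I - E = insert i (I - E)" using assms by auto
    then show "?w E = (1 - p) * (p ^ card E * (1 - p) ^ card (I - E) * \<phi> E)"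
      using assms by simp
  qed
  finally show ?thesis by simp
qed

lemma EP_add: "EP I p (\<lambda>E. \<phi> E + \<psi> E) = EP I p \<phi> + EP I p \<psi>"
  by (simp add: EP_def sum.distrib algebra_simps)

lemma EP_diff: "EP I p (\<lambda>E. \<phi> E - \<psi> E) = EP I p \<phi> - EP I p \<psi>"
  by (simp add: EP_def sum_subtractf algebra_simps)

lemma EP_cmult: "EP I p (\<lambda>E. c * \<phi> E) = c * EP I p \<phi>"
  by (simp add: EP_def sum_distrib_left algebra_simps)

lemma EP_sum: "EP I p (\<lambda>E. \<Sum>x\<in>A. \<phi> x E) = (\<Sum>x\<in>A. EP I p (\<phi> x))"
  unfolding EP_def sum_distrib_left by (rule sum.swap)

lemma EP_const: "finite I \<Longrightarrow> EP I p (\<lambda>E. c) = c"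
  by (induction I rule: finite_induct) (auto simp: EP_insert algebra_simps)

lemma EP_mono:
  assumes "0 \<le> p" "p \<le> 1" "\<And>E. E \<subseteq> I \<Longrightarrow> \<phi> E \<le> \<psi> E"
  shows "EP I p \<phi> \<le> EP I p \<psi>"
  unfolding EP_def using assms by (intro sum_mono mult_left_mono) auto

lemma EP_nonneg:
  assumes "0 \<le> p" "p \<le> 1" "\<And>E. E \<subseteq> I \<Longrightarrow> 0 \<le> \<phi> E"
  shows "0 \<le> EP I p \<phi>"
  unfolding EP_def using assms by (intro sum_nonneg) auto

lemma EP_restrict:
  assumes "finite I" "J \<subseteq> I"
  shows "EP I p (\<lambda>E. \<phi> (E \<inter> J)) = EP J p \<phi>"
proof -
  have "finite K \<Longrightarrow> K \<inter> J = {} \<Longrightarrow> EP (J \<union> K) p (\<lambda>E. \<phi> (E \<inter> J)) = EP J p \<phi>" for K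
  proof (induction K rule: finite_induct)
    case empty
    show ?case by (auto intro!: EP_cong simp: Int_absorb2)
  next
    case (insert k K)
    have JK: "finite (J \<union> K)" "k \<notin> J \<union> K"
      using insert assms finite_subset by auto
    have "insert k E \<inter> J = E \<inter> J" for E using insert.prems by auto
    then show ?case using insert EP_insert[OF JK, of p "\<lambda>E. \<phi> (E \<inter> J)"] by (simp add: algebra_simps)
  qed
  from this[of "I - J"] show ?thesis
    using assms by (simp add: Un_absorb1 Diff_Int_distrib2)
qed

lemma EP_image:
  assumes "inj_on g I"
  shows "EP (g ` I) p \<phi> = EP I p (\<lambda>E. \<phi> (g ` E))"
proof -
  have "EP (g ` I) p \<phi> = (\<Sum>E\<in>Pow I. p ^ card (g ` E) * (1 - p) ^ card (g ` I - g ` E) * \<phi> (g ` E))"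
    unfolding EP_def image_Pow_surj[OF refl, symmetric]
    using inj_on_image_Pow[OF assms] by (subst sum.reindex) auto
  also have "\<dots> = EP I p (\<lambda>E. \<phi> (g ` E))"
    unfolding EP_def
  proof (intro sum.cong refl)
    fix E assume "E \<in> Pow I"
    then have "inj_on g E" "inj_on g (I - E)" using assms by (auto intro: inj_on_subset)
    moreover have "g ` I - g ` E = g ` (I - E)"
      using \<open>E \<in> Pow I\<close> inj_on_image_set_diff[OF assms, of I E] by auto
    ultimately have "card (g ` E) = card E" "card (g ` I - g ` E) = card (I - E)"
      by (simp_all add: card_image)
    then show "p ^ card (g ` E) * (1 - p) ^ card (g ` I - g ` E) * \<phi> (g ` E) =
        p ^ card E * (1 - p) ^ card (I - E) * \<phi> (g ` E)" by simp
  qed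
  finally show ?thesis .
qed

lemma EP_superset:
  assumes "finite I" "S \<subseteq> I"
  shows "EP I p (\<lambda>E. of_bool (S \<subseteq> E)) = p ^ card S"
proof -
  have "finite S" using assms finite_subset by blast
  then have "EP S p (\<lambda>E. of_bool (S \<subseteq> E)) = p ^ card S"
  proof (induction S rule: finite_induct)
    case (insert i S)
    have "EP S p (\<lambda>E. of_bool (insert i S \<subseteq> E)) = EP S p (\<lambda>E. 0)"
      using insert.hyps by (intro EP_cong) auto
    moreover have "EP S p (\<lambda>E. of_bool (insert i S \<subseteq> insert i E)) = EP S p (\<lambda>E. of_bool (S \<subseteq> E))"
      using insert.hyps by (intro EP_cong) auto
    ultimately show ?case
      unfolding EP_insert[OF insert.hyps] using insert by (simp only: EP_const insert.IH) simp
  qed simp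
  moreover have "EP I p (\<lambda>E. of_bool (S \<subseteq> E)) = EP I p (\<lambda>E. of_bool (S \<subseteq> E \<inter> S))"
    by (intro EP_cong) simp
  ultimately show ?thesis using EP_restrict[OF assms, of p "\<lambda>E. of_bool (S \<subseteq> E)"] by simp
qed

lemma EP_Cauchy_Schwarz:
  assumes "0 \<le> p" "p \<le> 1"
  shows "(EP I p (\<lambda>E. \<phi> E * \<psi> E))\<^sup>2 \<le> EP I p (\<lambda>E. (\<phi> E)\<^sup>2) * EP I p (\<lambda>E. (\<psi> E)\<^sup>2)"
proof -
  define w where "w E = sqrt (p ^ card E * (1 - p) ^ card (I - E))" for E
  have w: "p ^ card E * (1 - p) ^ card (I - E) = (w E)\<^sup>2" for E
    unfolding w_def using assms by simp
  show ?thesis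
    using Cauchy_Schwarz_ineq_sum[of "\<lambda>E. w E * \<phi> E" "\<lambda>E. w E * \<psi> E" "Pow I"]
    by (simp add: EP_def w power2_eq_square algebra_simps)
qed

text \<open>The Margulis-Russo formula, by induction on \<open>I\<close> through the product rule
  applied to \<open>EP_insert\<close>.\<close>

lemma EP_has_derivative:
  assumes "finite I"
  shows "((\<lambda>p. EP I p \<phi>) has_real_derivative
    (\<Sum>i\<in>I. EP (I - {i}) p (\<lambda>E. \<phi> (insert i E) - \<phi> E))) (at p)"
  using assms
proof (induction I arbitrary: \<phi> rule: finite_induct)
  case empty
  show ?case by simp
next
  case (insert j I)
  let ?\<phi>' = "\<lambda>E. \<phi> (insert j E)"
  let ?D = "\<lambda>\<phi>. \<Sum>i\<in>I. EP (I - {i}) p (\<lambda>E. \<phi> (insert i E) - \<phi> E)"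
  have "((\<lambda>p. p * EP I p ?\<phi>' + (1 - p) * EP I p \<phi>) has_real_derivative
      (1 * EP I p ?\<phi>' + ?D ?\<phi>' * p) + ((0 - 1) * EP I p \<phi> + ?D \<phi> * (1 - p))) (at p)"
    by (intro DERIV_add DERIV_mult DERIV_diff DERIV_ident DERIV_const insert.IH)
  moreover have "(\<Sum>i\<in>insert j I. EP (insert j I - {i}) p (\<lambda>E. \<phi> (insert i E) - \<phi> E)) =
      (1 * EP I p ?\<phi>' + ?D ?\<phi>' * p) + ((0 - 1) * EP I p \<phi> + ?D \<phi> * (1 - p))"
  proof -
    have "EP (insert j I - {i}) p (\<lambda>E. \<phi> (insert i E) - \<phi> E) =
        p * EP (I - {i}) p (\<lambda>E. ?\<phi>' (insert i E) - ?\<phi>' E) +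
        (1 - p) * EP (I - {i}) p (\<lambda>E. \<phi> (insert i E) - \<phi> E)" if "i \<in> I" for i
    proof -
      have "insert j I - {i} = insert j (I - {i})" using that insert.hyps by auto
      then show ?thesis using insert.hyps by (simp add: EP_insert insert_commute)
    qed
    then have "(\<Sum>i\<in>I. EP (insert j I - {i}) p (\<lambda>E. \<phi> (insert i E) - \<phi> E)) =
        ?D ?\<phi>' * p + ?D \<phi> * (1 - p)"
      by (simp add: sum.distrib sum_distrib_left mult.commute)
    moreover have "insert j I - {j} = I" using insert.hyps by auto
    ultimately show ?thesis
      using insert.hyps EP_diff[of I p ?\<phi>' \<phi>] by simp
  qed
  ultimately show ?case using insert.hyps by (simp add: EP_insert)
qed

lemma EP_mono_p:
  assumes "finite I" "0 \<le> p" "p \<le> q" "q \<le> 1"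
    and "\<And>i E. i \<in> I \<Longrightarrow> E \<subseteq> I \<Longrightarrow> \<phi> E \<le> \<phi> (insert i E)"
  shows "EP I p \<phi> \<le> EP I q \<phi>"
proof (rule DERIV_nonneg_imp_nondecreasing[OF assms(3)])
  fix x assume x: "p \<le> x" "x \<le> q"
  have "0 \<le> (\<Sum>i\<in>I. EP (I - {i}) x (\<lambda>E. \<phi> (insert i E) - \<phi> E))"
    using assms x by (intro sum_nonneg EP_nonneg) (auto simp: subset_iff)
  then show "\<exists>y. ((\<lambda>p. EP I p \<phi>) has_real_derivative y) (at x) \<and> 0 \<le> y"
    using EP_has_derivative[OF assms(1)] by blast
qed

section \<open>The p-biased Fourier basis\<close>

definition chi :: "real \<Rightarrow> 'a set \<Rightarrow> 'a set \<Rightarrow> real" where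
  "chi p S E = (\<Prod>i\<in>S. (of_bool (i \<in> E) - p) / sqrt (p * (1 - p)))"

context
  fixes p :: real
  assumes p: "0 < p" "p < 1"
begin

text \<open>The two values of a single factor of \<open>chi\<close>, for an element outside and
  inside \<open>E\<close>. The normalisation gives mean zero and variance one.\<close>

definition "chi0 = - p / sqrt (p * (1 - p))"
definition "chi1 = (1 - p) / sqrt (p * (1 - p))"

lemma chi_split:
  assumes "finite I" "i \<notin> I" "S \<subseteq> I" "E \<subseteq> I"
  shows "chi p S (insert i E) = chi p S E"
    and "chi p (insert i S) (insert i E) = chi1 * chi p S E"
    and "chi p (insert i S) E = chi0 * chi p S E"
proof -
  have "finite S" "i \<notin> S" "i \<notin> E" using assms finite_subset by auto
  moreover show *: "chi p S (insert i E) = chi p S E"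
    unfolding chi_def using assms by (intro prod.cong) auto
  ultimately show "chi p (insert i S) (insert i E) = chi1 * chi p S E"
    and "chi p (insert i S) E = chi0 * chi p S E"
    using * by (simp_all add: chi_def chi0_def chi1_def)
qed

text \<open>The third and fourth moments follow from the second by bounding the remaining factors by
  \<open>1 / sqrt (p * (1 - p))\<close> in absolute value.\<close>

lemma chi_moments:
  shows "p * chi1 + (1 - p) * chi0 = 0"
    and "p * chi1\<^sup>2 + (1 - p) * chi0\<^sup>2 = 1"
    and "\<bar>p * chi1 ^ 3 + (1 - p) * chi0 ^ 3\<bar> \<le> 1 / sqrt (p * (1 - p))"
    and "p * chi1 ^ 4 + (1 - p) * chi0 ^ 4 \<le> (1 / sqrt (p * (1 - p)))\<^sup>2"
proof -
  define s where "s = sqrt (p * (1 - p))"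
  have s: "s > 0" "s\<^sup>2 = p * (1 - p)" using p by (auto simp: s_def)
  have c: "chi1 = (1 - p) / s" "chi0 = - p / s" by (simp_all add: chi1_def chi0_def s_def)
  show "p * chi1 + (1 - p) * chi0 = 0" by (simp add: c algebra_simps)
  show two: "p * chi1\<^sup>2 + (1 - p) * chi0\<^sup>2 = 1"
  proof -
    have "p * chi1\<^sup>2 + (1 - p) * chi0\<^sup>2 = (p * (1 - p)) / s\<^sup>2"
      by (simp add: c power_divide add_divide_distrib[symmetric] power2_eq_square algebra_simps)
    then show ?thesis using s p by simp
  qed
  have b: "\<bar>chi1\<bar> \<le> 1 / s" "\<bar>chi0\<bar> \<le> 1 / s" using p s by (auto simp: c divide_right_mono)
  have "\<bar>p * chi1 ^ 3 + (1 - p) * chi0 ^ 3\<bar> \<le> p * chi1\<^sup>2 * \<bar>chi1\<bar> + (1 - p) * chi0\<^sup>2 * \<bar>chi0\<bar>"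
  proof -
    have "\<bar>p * chi1 ^ 3\<bar> = p * chi1\<^sup>2 * \<bar>chi1\<bar>" "\<bar>(1 - p) * chi0 ^ 3\<bar> = (1 - p) * chi0\<^sup>2 * \<bar>chi0\<bar>"
      using p by (simp_all add: abs_mult power3_eq_cube power2_eq_square)
    then show ?thesis using abs_triangle_ineq[of "p * chi1 ^ 3" "(1 - p) * chi0 ^ 3"] by simp
  qed
  also have "\<dots> \<le> p * chi1\<^sup>2 * (1 / s) + (1 - p) * chi0\<^sup>2 * (1 / s)"
    using p b by (intro add_mono mult_left_mono) auto
  also have "\<dots> = (p * chi1\<^sup>2 + (1 - p) * chi0\<^sup>2) * (1 / s)" by (simp add: algebra_simps)
  finally show "\<bar>p * chi1 ^ 3 + (1 - p) * chi0 ^ 3\<bar> \<le> 1 / sqrt (p * (1 - p))"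
    unfolding two by (simp add: s_def)
  have sq: "chi1\<^sup>2 \<le> (1 / s)\<^sup>2" "chi0\<^sup>2 \<le> (1 / s)\<^sup>2"
    using power_mono[OF b(1), of 2] power_mono[OF b(2), of 2] by auto
  have "p * chi1 ^ 4 + (1 - p) * chi0 ^ 4 = p * chi1\<^sup>2 * chi1\<^sup>2 + (1 - p) * chi0\<^sup>2 * chi0\<^sup>2"
    by (simp add: power4_eq_xxxx power2_eq_square)
  also have "\<dots> \<le> p * chi1\<^sup>2 * (1 / s)\<^sup>2 + (1 - p) * chi0\<^sup>2 * (1 / s)\<^sup>2"
    using p sq by (intro add_mono mult_left_mono) auto
  also have "\<dots> = (p * chi1\<^sup>2 + (1 - p) * chi0\<^sup>2) * (1 / s)\<^sup>2" by (simp add: algebra_simps)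
  finally show "p * chi1 ^ 4 + (1 - p) * chi0 ^ 4 \<le> (1 / sqrt (p * (1 - p)))\<^sup>2"
    unfolding two by (simp add: s_def)
qed

lemma chi_orthonormal:
  assumes "finite I" "S \<subseteq> I" "T \<subseteq> I"
  shows "EP I p (\<lambda>E. chi p S E * chi p T E) = of_bool (S = T)"
  using assms
proof (induction I arbitrary: S T rule: finite_induct)
  case empty
  then show ?case by (simp add: chi_def)
next
  case (insert i I)
  note sp = chi_split[OF insert.hyps]
  define S' where "S' = S - {i}"
  define T' where "T' = T - {i}"
  have sub: "S' \<subseteq> I" "T' \<subseteq> I" using insert.prems by (auto simp: S'_def T'_def)
  have gen: "EP I p (\<lambda>E. (a * chi p S' E) * (b * chi p T' E)) = (a * b) * of_bool (S' = T')" for a b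
    using insert.IH[OF sub] EP_cmult[of I p "a * b" "\<lambda>E. chi p S' E * chi p T' E"]
    by (simp add: algebra_simps)
  \<comment> \<open>The factor that element \<open>i\<close> contributes to \<open>chi p U\<close>,
    with \<open>i\<close> inside (\<open>c1\<close>) or outside (\<open>c0\<close>) the random set;
    orthonormality then reduces to the first two moments.\<close>
  define c1 where "c1 U = (if i \<in> U then chi1 else 1)" for U
  define c0 where "c0 U = (if i \<in> U then chi0 else 1)" for U
  have in1: "chi p U (insert i E) = c1 U * chi p (U - {i}) E"
    and in0: "chi p U E = c0 U * chi p (U - {i}) E" if "U \<subseteq> insert i I" "E \<subseteq> I" for U E
  proof -
    have U': "U - {i} \<subseteq> I" using that by auto
    show "chi p U (insert i E) = c1 U * chi p (U - {i}) E" "chi p U E = c0 U * chi p (U - {i}) E"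
      using sp[OF U' that(2)] by (cases "i \<in> U"; simp add: c1_def c0_def insert_absorb)+
  qed
  have "EP I p (\<lambda>E. chi p S (insert i E) * chi p T (insert i E)) =
      EP I p (\<lambda>E. (c1 S * chi p S' E) * (c1 T * chi p T' E))"
    using insert.prems by (intro EP_cong) (simp add: in1 S'_def T'_def)
  moreover have "EP I p (\<lambda>E. chi p S E * chi p T E) = EP I p (\<lambda>E. (c0 S * chi p S' E) * (c0 T * chi p T' E))"
    using insert.prems in0 by (intro EP_cong) (simp add: S'_def T'_def)
  ultimately have "EP (insert i I) p (\<lambda>E. chi p S E * chi p T E) =
      (p * (c1 S * c1 T) + (1 - p) * (c0 S * c0 T)) * of_bool (S' = T')"
    unfolding EP_insert[OF insert.hyps] by (simp only: gen) (simp add: algebra_simps)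
  moreover have "p * (c1 S * c1 T) + (1 - p) * (c0 S * c0 T) = of_bool ((i \<in> S) = (i \<in> T))"
    using chi_moments(1,2) by (auto simp: c0_def c1_def power2_eq_square algebra_simps)
  moreover have "S = T \<longleftrightarrow> S' = T' \<and> (i \<in> S) = (i \<in> T)"
    unfolding S'_def T'_def by blast
  ultimately show ?case by auto
qed

text \<open>Parseval's identity for expansions over different families: only the common characters
  survive.\<close>

lemma chi_inner:
  assumes "finite I" "A \<subseteq> Pow I" "B \<subseteq> Pow I"
  shows "EP I p (\<lambda>E. (\<Sum>S\<in>A. a S * chi p S E) * (\<Sum>T\<in>B. b T * chi p T E)) = (\<Sum>S\<in>A \<inter> B. a S * b S)"
proof -
  have fin: "finite A" "finite B" using assms by (auto intro: finite_subset[OF _ finite_Pow_iff[THEN iffD2]])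
  have "EP I p (\<lambda>E. (\<Sum>S\<in>A. a S * chi p S E) * (\<Sum>T\<in>B. b T * chi p T E)) =
      EP I p (\<lambda>E. \<Sum>S\<in>A. \<Sum>T\<in>B. (a S * b T) * (chi p S E * chi p T E))"
    by (simp add: sum_product algebra_simps)
  also have "\<dots> = (\<Sum>S\<in>A. \<Sum>T\<in>B. (a S * b T) * EP I p (\<lambda>E. chi p S E * chi p T E))"
    by (simp add: EP_sum EP_cmult)
  also have "\<dots> = (\<Sum>S\<in>A. \<Sum>T\<in>B. if S = T then a S * b T else 0)"
    using assms by (intro sum.cong refl) (auto simp: chi_orthonormal subset_iff)
  also have "\<dots> = (\<Sum>S\<in>A. if S \<in> B then a S * b S else 0)"
    using fin by simp
  also have "\<dots> = (\<Sum>S\<in>A \<inter> B. a S * b S)"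
    using fin by (simp add: sum.inter_restrict)
  finally show ?thesis .
qed

lemma sum_Pow_insert:
  assumes "finite I" "i \<notin> I"
  shows "(\<Sum>S\<in>Pow (insert i I). g S) = (\<Sum>S\<in>Pow I. g S) + (\<Sum>S\<in>Pow I. g (insert i S) :: real)"
proof -
  have "(\<Sum>S\<in>Pow (insert i I). g S) = sum g (Pow I) + sum g (insert i ` Pow I)"
    unfolding Pow_insert using assms by (intro sum.union_disjoint) auto
  also have "sum g (insert i ` Pow I) = (\<Sum>S\<in>Pow I. g (insert i S))"
    using assms by (subst sum.reindex) (auto simp: inj_on_def)
  finally show ?thesis .
qed

text \<open>For a new element \<open>i\<close>, the average of \<open>\<phi>\<close> over
  \<open>i\<close> supplies the coefficients of the sets without \<open>i\<close>, and the scaled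
  difference in \<open>i\<close> supplies those of the sets with \<open>i\<close>.\<close>

lemma chi_expansion:
  assumes "finite I"
  shows "\<exists>a. \<forall>E\<subseteq>I. \<phi> E = (\<Sum>S\<in>Pow I. a S * chi p S E)"
  using assms
proof (induction I arbitrary: \<phi> rule: finite_induct)
  case empty
  show ?case by (rule exI[of _ "\<lambda>_. \<phi> {}"]) (simp add: chi_def)
next
  case (insert i I)
  define s where "s = sqrt (p * (1 - p))"
  have s: "chi1 * s = 1 - p" "chi0 * s = - p" using p by (auto simp: s_def chi1_def chi0_def)
  note sp = chi_split[OF insert.hyps]
  obtain a where a: "\<And>E. E \<subseteq> I \<Longrightarrow> p * \<phi> (insert i E) + (1 - p) * \<phi> E = (\<Sum>S\<in>Pow I. a S * chi p S E)"
    using insert.IH[of "\<lambda>E. p * \<phi> (insert i E) + (1 - p) * \<phi> E"] by auto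
  obtain b where b: "\<And>E. E \<subseteq> I \<Longrightarrow> s * (\<phi> (insert i E) - \<phi> E) = (\<Sum>S\<in>Pow I. b S * chi p S E)"
    using insert.IH[of "\<lambda>E. s * (\<phi> (insert i E) - \<phi> E)"] by auto
  define c where "c S = (if i \<in> S then b (S - {i}) else a S)" for S
  have c: "(\<Sum>S\<in>Pow (insert i I). c S * chi p S E) =
      (\<Sum>S\<in>Pow I. a S * chi p S E) + (\<Sum>S\<in>Pow I. b S * chi p (insert i S) E)" for E
  proof -
    have "(\<Sum>S\<in>Pow I. c S * chi p S E) = (\<Sum>S\<in>Pow I. a S * chi p S E)"
      using insert.hyps by (intro sum.cong) (auto simp: c_def)
    moreover have "(\<Sum>S\<in>Pow I. c (insert i S) * chi p (insert i S) E) = (\<Sum>S\<in>Pow I. b S * chi p (insert i S) E)"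
    proof (intro sum.cong refl)
      fix S assume "S \<in> Pow I"
      then have "insert i S - {i} = S" using insert.hyps by auto
      then show "c (insert i S) * chi p (insert i S) E = b S * chi p (insert i S) E"
        by (simp add: c_def)
    qed
    ultimately show ?thesis using insert.hyps by (simp add: sum_Pow_insert)
  qed
  have "\<phi> E = (\<Sum>S\<in>Pow (insert i I). c S * chi p S E)" if E: "E \<subseteq> insert i I" for E
  proof (cases "i \<in> E")
    case True
    define E' where "E' = E - {i}"
    have E': "E = insert i E'" "E' \<subseteq> I" using True E by (auto simp: E'_def)
    have "(\<Sum>S\<in>Pow (insert i I). c S * chi p S E) =
        (\<Sum>S\<in>Pow I. a S * chi p S E') + chi1 * (\<Sum>S\<in>Pow I. b S * chi p S E')"
      unfolding c sum_distrib_left using E'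
      by (intro arg_cong2[where f = "(+)"] sum.cong) (auto simp: sp algebra_simps)
    also have "\<dots> = (p * \<phi> E + (1 - p) * \<phi> E') + chi1 * (s * (\<phi> E - \<phi> E'))"
      using a[OF E'(2)] b[OF E'(2)] E'(1) by simp
    also have "chi1 * (s * (\<phi> E - \<phi> E')) = (1 - p) * (\<phi> E - \<phi> E')"
      using s by (simp flip: mult.assoc)
    finally show ?thesis by (simp add: algebra_simps)
  next
    case False
    then have E': "E \<subseteq> I" using E by auto
    have "(\<Sum>S\<in>Pow (insert i I). c S * chi p S E) =
        (\<Sum>S\<in>Pow I. a S * chi p S E) + chi0 * (\<Sum>S\<in>Pow I. b S * chi p S E)"
      unfolding c sum_distrib_left using E'
      by (intro arg_cong2[where f = "(+)"] sum.cong) (auto simp: sp algebra_simps)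
    also have "\<dots> = (p * \<phi> (insert i E) + (1 - p) * \<phi> E) + chi0 * (s * (\<phi> (insert i E) - \<phi> E))"
      using a[OF E'] b[OF E'] by simp
    also have "chi0 * (s * (\<phi> (insert i E) - \<phi> E)) = - p * (\<phi> (insert i E) - \<phi> E)"
      using s by (simp flip: mult.assoc)
    finally show ?thesis by (simp add: algebra_simps)
  qed
  then show ?case by blast
qed

section \<open>Hypercontractivity and the weight of Boolean functions on low degrees\<close>

definition hyper_const :: real where
  "hyper_const = 3 + 1 / sqrt (p * (1 - p))"

lemma hyper_const_ge: "hyper_const \<ge> 3"
  using p by (simp add: hyper_const_def)

lemma low_degree_sum_insert:
  assumes "finite I" "i \<notin> I"
  shows "(\<Sum>S\<in>{S \<in> Pow (insert i I). card S \<le> Suc r}. g S) =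
    (\<Sum>S\<in>{S \<in> Pow I. card S \<le> Suc r}. g S) + (\<Sum>S\<in>{S \<in> Pow I. card S \<le> r}. g (insert i S) :: real)"
proof -
  have *: "(\<Sum>S\<in>{S \<in> Pow J. card S \<le> k}. h S) = (\<Sum>S\<in>Pow J. if card S \<le> k then h S else 0)"
    if "finite J" for J :: "'a set" and k and h :: "'a set \<Rightarrow> real"
    using that by (intro sum.inter_filter) simp
  have "card (insert i S) = Suc (card S)" if "S \<in> Pow I" for S
  proof -
    have "finite S" "i \<notin> S" using that assms finite_subset by auto
    then show ?thesis by simp
  qed
  then have "(\<Sum>S\<in>Pow I. if card (insert i S) \<le> Suc r then g (insert i S) else 0) =
      (\<Sum>S\<in>Pow I. if card S \<le> r then g (insert i S) else 0)"
    by (intro sum.cong) auto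
  then show ?thesis
    unfolding *[OF assms(1)] *[OF finite.insertI[OF assms(1)]] sum_Pow_insert[OF assms] by simp
qed

lemma low_degree_zero:
  assumes "finite I"
  shows "{S \<in> Pow I. card S \<le> 0} = {{}}"
  using finite_subset[OF _ assms] by auto

text \<open>Bonami's lemma for biased bits, by induction on \<open>I\<close>. Write the polynomial
  as \<open>Q + x R\<close> with \<open>x\<close> the normalised coordinate \<open>i\<close>. In the
  expanded fourth power the term linear in \<open>x\<close> has mean zero, and the mixed term is
  handled by Cauchy-Schwarz and the induction hypotheses for \<open>Q\<close> and
  \<open>R\<close>.\<close>

lemma bonami:
  assumes "finite I"
  shows "EP I p (\<lambda>E. (\<Sum>S\<in>{S \<in> Pow I. card S \<le> r}. a S * chi p S E) ^ 4) \<le>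
    hyper_const ^ (2 * r) * (\<Sum>S\<in>{S \<in> Pow I. card S \<le> r}. (a S)\<^sup>2)\<^sup>2"
  using assms
proof (induction I arbitrary: a r rule: finite_induct)
  case empty
  have "{S \<in> Pow {}. card S \<le> r} = {{}::'a set}" by auto
  moreover have "1 * (a {}) ^ 4 \<le> hyper_const ^ (2 * r) * (a {}) ^ 4"
    using hyper_const_ge by (intro mult_right_mono one_le_power) auto
  ultimately show ?case by (simp add: chi_def)
next
  case (insert i I)
  show ?case
  proof (cases r)
    case 0
    have *: "{S \<in> Pow (insert i I). card S \<le> 0} = {{}}" using insert.hyps by (intro low_degree_zero) auto
    show ?thesis
      unfolding 0 * using insert.hyps by (simp add: chi_def EP_const)
  next
    case (Suc k)
    define M where "M = 1 / sqrt (p * (1 - p))"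
    define K where "K = hyper_const"
    have M: "M > 0" "K = 3 + M" using p by (auto simp: M_def K_def hyper_const_def)
    define Q where "Q E = (\<Sum>S\<in>{S \<in> Pow I. card S \<le> Suc k}. a S * chi p S E)" for E
    define R where "R E = (\<Sum>S\<in>{S \<in> Pow I. card S \<le> k}. a (insert i S) * chi p S E)" for E
    define A where "A = (\<Sum>S\<in>{S \<in> Pow I. card S \<le> Suc k}. (a S)\<^sup>2)"
    define B where "B = (\<Sum>S\<in>{S \<in> Pow I. card S \<le> k}. (a (insert i S))\<^sup>2)"
    define P where "P E = (\<Sum>S\<in>{S \<in> Pow (insert i I). card S \<le> Suc k}. a S * chi p S E)" for E
    define X where "X = K ^ (2 * k)"
    have X: "X \<ge> 0" using M by (simp add: X_def)
    have AB: "A \<ge> 0" "B \<ge> 0" by (auto simp: A_def B_def intro: sum_nonneg)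
    note sp = chi_split[OF insert.hyps]
    have P1: "P (insert i E) = Q E + chi1 * R E" if "E \<subseteq> I" for E
      unfolding P_def low_degree_sum_insert[OF insert.hyps] Q_def R_def sum_distrib_left
      using that by (intro arg_cong2[where f = "(+)"] sum.cong) (auto simp: sp algebra_simps)
    have P0: "P E = Q E + chi0 * R E" if "E \<subseteq> I" for E
      unfolding P_def low_degree_sum_insert[OF insert.hyps] Q_def R_def sum_distrib_left
      using that by (intro arg_cong2[where f = "(+)"] sum.cong) (auto simp: sp algebra_simps)
    define c3 where "c3 = p * chi1 ^ 3 + (1 - p) * chi0 ^ 3"
    define c4 where "c4 = p * chi1 ^ 4 + (1 - p) * chi0 ^ 4"
    have c34: "\<bar>c3\<bar> \<le> M" "c4 \<le> M\<^sup>2"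
      using chi_moments(3,4) by (auto simp: c3_def c4_def M_def)
    have pointwise: "p * (Q E + chi1 * R E) ^ 4 + (1 - p) * (Q E + chi0 * R E) ^ 4 \<le>
        (Q E) ^ 4 + (6 + 2 * M) * ((Q E)\<^sup>2 * (R E)\<^sup>2) + (2 * M + M\<^sup>2) * (R E) ^ 4" for E
    proof -
      define q where "q = Q E"
      define t where "t = R E"
      have "p * (q + chi1 * t) ^ 4 + (1 - p) * (q + chi0 * t) ^ 4 =
          q ^ 4 + 4 * q ^ 3 * t * (p * chi1 + (1 - p) * chi0)
          + 6 * q\<^sup>2 * t\<^sup>2 * (p * chi1\<^sup>2 + (1 - p) * chi0\<^sup>2) + 4 * q * t ^ 3 * c3 + t ^ 4 * c4"
      proof -
        have e: "(q + c * t) ^ 4 = q ^ 4 + 4 * q ^ 3 * t * c + 6 * q\<^sup>2 * t\<^sup>2 * c\<^sup>2 + 4 * q * t ^ 3 * c ^ 3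
            + t ^ 4 * c ^ 4" for c
          by (simp add: eval_nat_numeral algebra_simps)
        show ?thesis unfolding c3_def c4_def e by (simp add: algebra_simps)
      qed
      also have "\<dots> = q ^ 4 + 6 * (q\<^sup>2 * t\<^sup>2) + 4 * (q * t ^ 3 * c3) + t ^ 4 * c4"
        unfolding chi_moments(1,2) by simp
      \<comment> \<open>For biased bits the third moment need not vanish; by the
        arithmetic-geometric mean inequality its term is absorbed into the neighbouring even
        terms.\<close>
      also have "4 * (q * t ^ 3 * c3) \<le> 2 * M * (q\<^sup>2 * t\<^sup>2 + t ^ 4)"
      proof -
        have "0 \<le> (q * t - t\<^sup>2)\<^sup>2" "0 \<le> (q * t + t\<^sup>2)\<^sup>2" by simp_all
        then have "2 * (q * t ^ 3) \<le> q\<^sup>2 * t\<^sup>2 + t ^ 4" "- (2 * (q * t ^ 3)) \<le> q\<^sup>2 * t\<^sup>2 + t ^ 4"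
          by (simp_all add: power2_eq_square power3_eq_cube power4_eq_xxxx algebra_simps)
        then have 1: "2 * \<bar>q * t ^ 3\<bar> \<le> q\<^sup>2 * t\<^sup>2 + t ^ 4" by linarith
        have "q * t ^ 3 * c3 \<le> \<bar>q * t ^ 3\<bar> * \<bar>c3\<bar>" by (metis abs_ge_self abs_mult)
        also have "\<dots> \<le> \<bar>q * t ^ 3\<bar> * M" using c34 by (intro mult_left_mono) auto
        finally have "4 * (q * t ^ 3 * c3) \<le> 2 * M * (2 * \<bar>q * t ^ 3\<bar>)" by (simp add: mult.commute)
        also have "\<dots> \<le> 2 * M * (q\<^sup>2 * t\<^sup>2 + t ^ 4)" using 1 M by (intro mult_left_mono) auto
        finally show ?thesis .
      qed
      also have "t ^ 4 * c4 \<le> t ^ 4 * M\<^sup>2" using c34 by (intro mult_left_mono) auto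
      finally show ?thesis by (simp add: q_def t_def algebra_simps)
    qed
    \<comment> \<open>\<open>R\<close> has degree one lower than \<open>Q\<close>, so its bound is
      smaller by a factor of the square of \<open>K\<close>, and the mixed term sits halfway at
      \<open>K\<close>.\<close>
    have KX: "K ^ (2 * Suc k) = X * K\<^sup>2" by (simp add: X_def power2_eq_square algebra_simps)
    have Q4: "EP I p (\<lambda>E. (Q E) ^ 4) \<le> X * K\<^sup>2 * A\<^sup>2"
      using insert.IH[where a = a and r = "Suc k"]
      unfolding K_def[symmetric] KX Q_def[symmetric] A_def[symmetric] .
    have R4: "EP I p (\<lambda>E. (R E) ^ 4) \<le> X * B\<^sup>2"
      using insert.IH[where a = "\<lambda>S. a (insert i S)" and r = k]
      unfolding K_def[symmetric] X_def[symmetric] R_def[symmetric] B_def[symmetric] .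
    have QR: "EP I p (\<lambda>E. (Q E)\<^sup>2 * (R E)\<^sup>2) \<le> X * K * (A * B)"
    proof -
      have 1: "EP I p (\<lambda>E. ((Q E)\<^sup>2)\<^sup>2) \<le> X * K\<^sup>2 * A\<^sup>2"
        using Q4 by simp
      have 2: "EP I p (\<lambda>E. ((R E)\<^sup>2)\<^sup>2) \<le> X * B\<^sup>2"
        using R4 by simp
      have "(EP I p (\<lambda>E. (Q E)\<^sup>2 * (R E)\<^sup>2))\<^sup>2 \<le> (X * K\<^sup>2 * A\<^sup>2) * (X * B\<^sup>2)"
        using p X by (intro order.trans[OF EP_Cauchy_Schwarz] mult_mono 1 2 EP_nonneg) auto
      also have "\<dots> = (X * K * (A * B))\<^sup>2" by (simp add: power2_eq_square algebra_simps)
      finally show ?thesis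
        by (rule power2_le_imp_le) (use X AB M in auto)
    qed
    have "EP (insert i I) p (\<lambda>E. (P E) ^ 4) =
        EP I p (\<lambda>E. p * (Q E + chi1 * R E) ^ 4 + (1 - p) * (Q E + chi0 * R E) ^ 4)"
      unfolding EP_insert[OF insert.hyps] EP_add EP_cmult
      by (intro arg_cong2[where f = "(+)"] arg_cong2[where f = "(*)"] refl EP_cong) (auto simp: P1 P0)
    also have "\<dots> \<le> EP I p (\<lambda>E. (Q E) ^ 4 + (6 + 2 * M) * ((Q E)\<^sup>2 * (R E)\<^sup>2) + (2 * M + M\<^sup>2) * (R E) ^ 4)"
      using p pointwise by (intro EP_mono) auto
    also have "\<dots> = EP I p (\<lambda>E. (Q E) ^ 4) + (6 + 2 * M) * EP I p (\<lambda>E. (Q E)\<^sup>2 * (R E)\<^sup>2)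
        + (2 * M + M\<^sup>2) * EP I p (\<lambda>E. (R E) ^ 4)"
      by (simp only: EP_add EP_cmult)
    also have "\<dots> \<le> X * K\<^sup>2 * A\<^sup>2 + (6 + 2 * M) * (X * K * (A * B)) + K\<^sup>2 * (X * B\<^sup>2)"
    proof (intro add_mono mult_mono QR Q4 R4)
      show "2 * M + M\<^sup>2 \<le> K\<^sup>2" using M by (simp add: power2_eq_square algebra_simps)
    qed (use M p in \<open>auto intro: EP_nonneg\<close>)
    \<comment> \<open>The summand 3 in \<open>hyper_const\<close> makes \<open>6 + 2 * M\<close>
      equal to \<open>2 * K\<close>, which completes the square.\<close>
    also have "\<dots> = X * K\<^sup>2 * (A + B)\<^sup>2" unfolding M(2) by (simp add: power2_eq_square algebra_simps)
    also have "A + B = (\<Sum>S\<in>{S \<in> Pow (insert i I). card S \<le> Suc k}. (a S)\<^sup>2)"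
      unfolding low_degree_sum_insert[OF insert.hyps] A_def B_def ..
    finally show ?thesis
      unfolding Suc P_def[symmetric] K_def[symmetric] KX .
  qed
qed

text \<open>The low-degree weight \<open>W\<close> is the inner product of \<open>f\<close> with its
  low-degree part \<open>P\<close>. Two applications of Cauchy-Schwarz, using that \<open>f\<close>
  is its own square, leave the fourth moment of \<open>P\<close>, which \<open>bonami\<close> bounds
  by the square of \<open>W\<close>; this square is then cancelled.\<close>

lemma low_degree_weight:
  assumes "finite I" and f01: "\<And>E. E \<subseteq> I \<Longrightarrow> f E = 0 \<or> f E = 1"
    and f: "\<And>E. E \<subseteq> I \<Longrightarrow> f E = (\<Sum>S\<in>Pow I. a S * chi p S E)"
  shows "(\<Sum>S\<in>{S \<in> Pow I. card S \<le> r}. (a S)\<^sup>2)\<^sup>2 \<le> hyper_const ^ (2 * r) * (EP I p f) ^ 3"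
proof -
  define L where "L = {S \<in> Pow I. card S \<le> r}"
  define P where "P E = (\<Sum>S\<in>L. a S * chi p S E)" for E
  define W where "W = (\<Sum>S\<in>L. (a S)\<^sup>2)"
  define h where "h = EP I p f"
  have f0: "0 \<le> f E" and f2: "(f E)\<^sup>2 = f E" if "E \<subseteq> I" for E using f01[OF that] by auto
  have h: "h \<ge> 0" unfolding h_def using p f0 by (intro EP_nonneg) simp_all
  have sq: "EP I p (\<lambda>E. (f E)\<^sup>2) = h" unfolding h_def using f2 by (rule EP_cong)
  have "W = EP I p (\<lambda>E. P E * (\<Sum>S\<in>Pow I. a S * chi p S E))"
  proof -
    have L: "L \<subseteq> Pow I" by (auto simp: L_def)
    show ?thesis
      unfolding P_def chi_inner[OF assms(1) L order.refl] W_def Int_absorb2[OF L] power2_eq_square ..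
  qed
  also have "\<dots> = EP I p (\<lambda>E. (P E * f E) * f E)"
  proof (rule EP_cong)
    fix E assume "E \<subseteq> I"
    then show "P E * (\<Sum>S\<in>Pow I. a S * chi p S E) = P E * f E * f E"
      using f[of E, symmetric] f2[of E] by (simp add: power2_eq_square)
  qed
  finally have "W\<^sup>2 \<le> EP I p (\<lambda>E. (P E * f E)\<^sup>2) * h"
    using EP_Cauchy_Schwarz[of p I "\<lambda>E. P E * f E" f] p sq by simp
  also have "EP I p (\<lambda>E. (P E * f E)\<^sup>2) = EP I p (\<lambda>E. (P E)\<^sup>2 * f E)"
    using f2 by (intro EP_cong) (simp add: power_mult_distrib)
  finally have 1: "W\<^sup>2 \<le> EP I p (\<lambda>E. (P E)\<^sup>2 * f E) * h" .
  have "(EP I p (\<lambda>E. (P E)\<^sup>2 * f E))\<^sup>2 \<le> EP I p (\<lambda>E. ((P E)\<^sup>2)\<^sup>2) * h"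
    using EP_Cauchy_Schwarz[of p I "\<lambda>E. (P E)\<^sup>2" f] p sq by simp
  also have "\<dots> \<le> (hyper_const ^ (2 * r) * W\<^sup>2) * h"
    using bonami[OF assms(1), of a r] h by (intro mult_right_mono) (simp_all add: P_def W_def L_def)
  finally have 2: "(EP I p (\<lambda>E. (P E)\<^sup>2 * f E))\<^sup>2 \<le> hyper_const ^ (2 * r) * W\<^sup>2 * h" .
  have "(W\<^sup>2)\<^sup>2 \<le> (EP I p (\<lambda>E. (P E)\<^sup>2 * f E) * h)\<^sup>2"
    using 1 by (intro power_mono) auto
  also have "\<dots> \<le> (hyper_const ^ (2 * r) * W\<^sup>2 * h) * h\<^sup>2"
    using 2 by (simp add: power_mult_distrib mult_right_mono)
  finally have 3: "W\<^sup>2 * W\<^sup>2 \<le> W\<^sup>2 * (hyper_const ^ (2 * r) * h ^ 3)"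
    by (simp add: power2_eq_square power3_eq_cube algebra_simps)
  have "W\<^sup>2 \<le> hyper_const ^ (2 * r) * h ^ 3"
  proof (cases "W = 0")
    case False
    then show ?thesis using 3 by (subst (asm) mult_le_cancel_left_pos) auto
  qed (use h hyper_const_ge in auto)
  then show ?thesis by (simp add: W_def L_def h_def)
qed

end

section \<open>Rates of Reed-Muller codes\<close>

lemma rm_rate_binomial:
  "rm_rate v m = measure_pmf.prob (binomial_pmf m (1/2)) {..v}"
proof -
  have "measure_pmf.prob (binomial_pmf m (1/2)) {..v} = (\<Sum>k\<le>v. pmf (binomial_pmf m (1/2)) k)"
    by (simp add: measure_measure_pmf_finite)
  also have "\<dots> = (\<Sum>k\<le>v. real (m choose k) / 2 ^ m)"
  proof (intro sum.cong refl)
    fix k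
    show "pmf (binomial_pmf m (1/2)) k = real (m choose k) / 2 ^ m"
    proof (cases "k \<le> m")
      case True
      have "(1/2::real) ^ k * (1/2) ^ (m - k) = 1 / 2 ^ m"
        unfolding power_add[symmetric] using True by (simp add: power_divide)
      then show ?thesis by (simp add: mult.assoc)
    qed (simp add: binomial_eq_0)
  qed
  finally show ?thesis by (simp add: rm_rate_def sum_divide_distrib)
qed

section \<open>De Moivre-Laplace theorem by characteristic functions\<close>

definition std_binomial :: "nat \<Rightarrow> real measure" where
  "std_binomial m = distr (measure_pmf (binomial_pmf m (1/2))) borel (\<lambda>k. (2 * real k - real m) / sqrt (real m))"

lemma real_distribution_std_binomial: "real_distribution (std_binomial m)"
  unfolding std_binomial_def by (intro prob_space.real_distribution_distr) (auto simp: measure_pmf.prob_space_axioms)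

lemma char_std_binomial:
  "char (std_binomial m) t = of_real (cos (t / sqrt (real m)) ^ m)"
proof -
  define s where "s = t / sqrt (real m)"
  have "char (std_binomial m) t =
      (CLINT k|measure_pmf (binomial_pmf m (1/2)). iexp (t * ((2 * real k - real m) / sqrt (real m))))"
    unfolding char_def std_binomial_def by (subst integral_distr) auto
  also have "\<dots> = (\<Sum>k\<le>m. pmf (binomial_pmf m (1/2)) k *\<^sub>R iexp (t * ((2 * real k - real m) / sqrt (real m))))"
    by (rule integral_measure_pmf) auto
  also have "\<dots> = (\<Sum>k\<le>m. of_nat (m choose k) * (iexp s / 2) ^ k * (iexp (- s) / 2) ^ (m - k))"
  proof (intro sum.cong refl)
    fix k assume k: "k \<in> {..m}"
    have "t * ((2 * real k - real m) / sqrt (real m)) = real k * s + real (m - k) * (- s)"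
      using k by (simp add: s_def of_nat_diff field_simps diff_divide_distrib)
    then have "iexp (t * ((2 * real k - real m) / sqrt (real m))) = iexp s ^ k * iexp (- s) ^ (m - k)"
      by (simp only: exp_of_nat_mult[symmetric] exp_add[symmetric])
        (simp add: algebra_simps)
    then show "pmf (binomial_pmf m (1/2)) k *\<^sub>R iexp (t * ((2 * real k - real m) / sqrt (real m))) =
        of_nat (m choose k) * (iexp s / 2) ^ k * (iexp (- s) / 2) ^ (m - k)"
      by (simp add: scaleR_conv_of_real power_divide)
  qed
  also have "\<dots> = (iexp s / 2 + iexp (- s) / 2) ^ m"
    by (simp add: binomial_ring)
  also have "iexp s / 2 + iexp (- s) / 2 = of_real (cos s)"
    by (simp add: cos_of_real[symmetric] cos_exp_eq add_divide_distrib)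
  finally show ?thesis by (simp add: s_def)
qed

lemma cos_power_limit:
  fixes t :: real
  shows "(\<lambda>m. cos (t / sqrt (real m)) ^ m) \<longlonglongrightarrow> exp (- (t\<^sup>2) / 2)"
proof (cases "t = 0")
  case False
  \<comment> \<open>Positive \<open>s\<close> suffices because the cosine is even.\<close>
  have "(\<lambda>m::nat. cos (s / sqrt (real m)) ^ m) \<longlonglongrightarrow> exp (- (s * s / 2))" if "s > 0" for s :: real
    using that by real_asymp
  from this[of "\<bar>t\<bar>"] have "(\<lambda>m::nat. cos (\<bar>t\<bar> / sqrt (real m)) ^ m) \<longlonglongrightarrow> exp (- (t\<^sup>2) / 2)"
    using False by (simp add: power2_eq_square)
  moreover have "cos (\<bar>t\<bar> / sqrt (real m)) = cos (t / sqrt (real m))" for m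
    by (cases "t \<ge> 0") auto
  ultimately show ?thesis by simp
qed simp

lemma std_binomial_weak_conv: "weak_conv_m std_binomial std_normal_distribution"
proof (rule levy_continuity[OF real_distribution_std_binomial real_dist_normal_dist])
  fix t
  show "(\<lambda>m. char (std_binomial m) t) \<longlonglongrightarrow> char std_normal_distribution t"
    unfolding char_std_binomial char_std_normal_distribution
    by (intro tendsto_of_real cos_power_limit)
qed

section \<open>The Gaussian tail function and its inverse\<close>

interpretation SN: real_distribution std_normal_distribution
  by (rule real_dist_normal_dist)

lemma measure_std_normal:
  assumes "A \<in> sets borel"
  shows "measure std_normal_distribution A = (LBINT x:A. std_normal_density x)"
proof -
  have "measure std_normal_distribution A = (LINT x|std_normal_distribution. indicator A x)"
    using assms by simp
  also have "\<dots> = (LBINT x:A. std_normal_density x)"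
    unfolding set_lebesgue_integral_def
    using assms by (subst integral_density) (auto simp: mult.commute)
  finally show ?thesis .
qed

lemma Qfun_eq_cdf: "Qfun t = 1 - cdf std_normal_distribution t"
proof -
  have "Qfun t = (LBINT x:{t<..}. std_normal_density x)"
    unfolding Qfun_def std_normal_density_def by simp
  also have "\<dots> = measure std_normal_distribution {t<..}"
    by (simp add: measure_std_normal)
  also have "{t<..} = UNIV - {..t}" by auto
  also have "measure std_normal_distribution (UNIV - {..t}) = 1 - cdf std_normal_distribution t"
    using SN.prob_compl[of "{..t}"] by (simp add: cdf_def)
  finally show ?thesis .
qed

lemma isCont_cdf_std_normal: "isCont (cdf std_normal_distribution) x"
proof -
  have "{x} \<in> null_sets std_normal_distribution"
  proof (subst null_sets_density_iff, simp, intro conjI)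
    show "AE y in lborel. y \<in> {x} \<longrightarrow> ennreal (std_normal_density y) = 0"
      using AE_lborel_singleton[of x] by (rule eventually_mono) simp
  qed simp
  then show ?thesis unfolding SN.isCont_cdf by (simp add: measure_eq_0_null_sets)
qed

lemma cdf_std_normal_strict_mono:
  assumes "a < b"
  shows "cdf std_normal_distribution a < cdf std_normal_distribution b"
proof -
  have pos: "std_normal_density x \<noteq> 0" for x
    using normal_density_pos[of 1 0 x] by simp
  have "\<not> {a<..b} \<in> null_sets std_normal_distribution"
  proof
    assume "{a<..b} \<in> null_sets std_normal_distribution"
    then have "AE x in lborel. x \<notin> {a<..b}"
      by (subst (asm) null_sets_density_iff) (auto simp: pos)
    then have "{a<..b} \<in> null_sets lborel" by (subst AE_iff_null_sets) auto
    then show False using assms by (auto simp: null_sets_def)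
  qed
  then have "measure std_normal_distribution {a<..b} \<noteq> 0"
    by (auto simp: SN.emeasure_eq_measure null_sets_def)
  then have "measure std_normal_distribution {a<..b} > 0"
    using measure_nonneg[of std_normal_distribution "{a<..b}"] by linarith
  then show ?thesis using SN.cdf_diff_eq[OF assms] by simp
qed

text \<open>The description in \<open>Qinv\<close> denotes: existence by the intermediate value
  theorem, uniqueness by strict monotonicity of the normal distribution function.\<close>

lemma Qfun_Qinv:
  assumes "0 < y" "y < 1"
  shows "Qfun (Qinv y) = y"
proof -
  let ?F = "cdf std_normal_distribution"
  have "\<forall>\<^sub>F x in at_top. ?F x > 1 - y"
    using SN.cdf_lim_at_top_prob assms by (intro order_tendstoD) auto
  then obtain b where b: "?F b > 1 - y" by (auto dest: eventually_happens)
  have "\<forall>\<^sub>F x in at_bot. ?F x < 1 - y"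
    using SN.cdf_lim_at_bot assms by (intro order_tendstoD) auto
  then obtain a where a: "?F a < 1 - y" by (auto dest: eventually_happens)
  have "a \<le> b" using a b SN.cdf_nondecreasing[of b a] by linarith
  then obtain t where t: "?F t = 1 - y"
    using IVT[of ?F a "1 - y" b] a b isCont_cdf_std_normal by force
  have "Qfun t = y" by (simp add: Qfun_eq_cdf t)
  moreover have "s = t" if "Qfun s = y" for s
    using that t cdf_std_normal_strict_mono[of s t] cdf_std_normal_strict_mono[of t s]
    by (cases s t rule: linorder_cases) (auto simp: Qfun_eq_cdf)
  ultimately show ?thesis unfolding Qinv_def by (rule theI2) auto
qed

text \<open>The rate is a binomial probability, and \<open>k \<le> v m\<close> says exactly that the
  standardised value of \<open>k\<close> is at most \<open>q\<close>, once \<open>m\<close> is large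
  enough for the truncation at 0 to be inactive.\<close>

lemma rm_rate_limit:
  fixes r q :: real and v :: "nat \<Rightarrow> nat"
  assumes "\<And>m. v m = nat (max \<lfloor>real m / 2 + sqrt (real m) / 2 * q\<rfloor> 0)"
  shows "(\<lambda>m. rm_rate (v m) m) \<longlonglongrightarrow> 1 - Qfun q"
proof -
  have "(\<lambda>m. cdf (std_binomial m) q) \<longlonglongrightarrow> cdf std_normal_distribution q"
    using std_binomial_weak_conv isCont_cdf_std_normal by (auto simp: weak_conv_m_def weak_conv_def)
  moreover have "\<forall>\<^sub>F m in sequentially. cdf (std_binomial m) q = rm_rate (v m) m"
  proof -
    have "\<forall>\<^sub>F m::nat in sequentially. real m / 2 + sqrt (real m) / 2 * q \<ge> 0 \<and> m > 0"
      by (intro eventually_conj eventually_gt_at_top) real_asymp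
    then show ?thesis
    proof eventually_elim
      case (elim m)
      have v: "int (v m) = \<lfloor>real m / 2 + sqrt (real m) / 2 * q\<rfloor>" using elim by (simp add: assms)
      have "(2 * real k - real m) / sqrt (real m) \<le> q \<longleftrightarrow> k \<le> v m" for k
      proof -
        have "(2 * real k - real m) / sqrt (real m) \<le> q \<longleftrightarrow> real k \<le> real m / 2 + sqrt (real m) / 2 * q"
          using elim by (subst pos_divide_le_eq) (auto simp: field_simps)
        also have "\<dots> \<longleftrightarrow> int k \<le> int (v m)" unfolding v by (simp add: le_floor_iff)
        finally show ?thesis by simp
      qed
      then have "{k. (2 * real k - real m) / sqrt (real m) \<le> q} = {..v m}" by auto
      then show ?case
        unfolding cdf_def std_binomial_def rm_rate_binomial by (simp add: measure_distr vimage_def)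
    qed
  qed
  ultimately show ?thesis by (simp add: Qfun_eq_cdf tendsto_cong)
qed

section \<open>Sizes of binomial coefficients and their tails\<close>

lemma rm_rate_Suc: "rm_rate v n - rm_rate v (Suc n) = real (n choose v) / 2 ^ Suc n"
proof -
  have "(\<Sum>k\<le>v. real (Suc n choose k)) = 2 * (\<Sum>k\<le>v. real (n choose k)) - real (n choose v)"
    by (induction v) auto
  then show ?thesis by (simp add: rm_rate_def field_simps)
qed

text \<open>The ratio of consecutive central coefficients is
  \<open>2 * (2 * n + 1) / (n + 1)\<close>, and the induction closes because
  \<open>(2 * n + 1) * (2 * n + 3)\<close> is at most \<open>4 * (n + 1) ^ 2\<close>.\<close>

lemma central_binomial_le: "real (2 * n choose n) \<le> 4 ^ n / sqrt (2 * real n + 1)"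
proof (induction n)
  case (Suc n)
  have "real (Suc n) * real (2 * Suc n choose Suc n) = 2 * (2 * real n + 1) * real (2 * n choose n)"
  proof -
    have "Suc n * (2 * Suc n choose Suc n) = 2 * Suc n * (Suc (2 * n) choose n)"
      using Suc_times_binomial[of n "Suc (2 * n)"] by (simp add: algebra_simps)
    then have 1: "(2 * Suc n choose Suc n) = 2 * (Suc (2 * n) choose n)" by (metis mult.assoc mult.commute mult_left_cancel nat.distinct(1))
    have "Suc n * (Suc (2 * n) choose n) = Suc (2 * n) * (2 * n choose n)"
      using Suc_times_binomial[of n "2 * n"] binomial_symmetric[of "Suc n" "Suc (2 * n)"] by simp
    then have "Suc n * (2 * Suc n choose Suc n) = 2 * (Suc (2 * n) * (2 * n choose n))"
      unfolding 1 by (simp only: mult.left_commute)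
    moreover have "real (Suc n) * real x = 2 * (2 * real n + 1) * real y"
      if "Suc n * x = 2 * (Suc (2 * n) * y)" for x y
      using arg_cong[OF that, of real] by (simp add: algebra_simps)
    ultimately show ?thesis by blast
  qed
  then have "real (2 * Suc n choose Suc n) = 2 * (2 * real n + 1) / (real n + 1) * real (2 * n choose n)"
    by (simp add: field_simps)
  also have "\<dots> \<le> 2 * (2 * real n + 1) / (real n + 1) * (4 ^ n / sqrt (2 * real n + 1))"
    using Suc by (intro mult_left_mono) auto
  also have "\<dots> = 4 ^ n * 2 * (sqrt (2 * real n + 1) / (real n + 1))"
  proof -
    have "2 * a / b * (c / sqrt a) = c * 2 * (sqrt a / b)" if "a \<ge> 0" for a b c :: real
    proof -
      have "2 * a / b * (c / sqrt a) = c * 2 * ((a / sqrt a) / b)" by (simp add: mult_ac)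
      then show ?thesis unfolding real_div_sqrt[OF that] .
    qed
    from this[of "2 * real n + 1"] show ?thesis by simp
  qed
  also have "\<dots> \<le> 4 ^ n * 2 * (2 / sqrt (2 * real n + 3))"
  proof (intro mult_left_mono)
    have "sqrt (2 * real n + 1) * sqrt (2 * real n + 3) \<le> 2 * (real n + 1)"
      unfolding real_sqrt_mult[symmetric]
      by (rule real_le_lsqrt) (auto simp: power2_eq_square algebra_simps)
    then show "sqrt (2 * real n + 1) / (real n + 1) \<le> 2 / sqrt (2 * real n + 3)"
      by (simp add: field_simps)
  qed auto
  finally show ?case by (simp add: algebra_simps)
qed simp

text \<open>Even rows are bounded by their central coefficient. By Pascal's rule a normalised
  coefficient of an odd row is the mean of two from the even row above; \<open>k = 0\<close> has
  only one parent and is done directly.\<close>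

lemma binomial_le_sqrt:
  assumes "n > 0"
  shows "real (n choose k) / 2 ^ n \<le> 1 / sqrt (real n)"
proof -
  have even: "real (2 * j choose i) / 2 ^ (2 * j) \<le> 1 / sqrt (2 * real j + 1)" for i j
  proof -
    have "real (2 * j choose i) \<le> real (2 * j choose j)"
      using binomial_maximum'[of j i] by simp
    also note central_binomial_le
    finally have "real (2 * j choose i) \<le> 4 ^ j / sqrt (2 * real j + 1)" .
    then have "real (2 * j choose i) / 4 ^ j \<le> 4 ^ j / sqrt (2 * real j + 1) / 4 ^ j"
      by (intro divide_right_mono) auto
    moreover have "(2::real) ^ (2 * j) = 4 ^ j" by (simp add: power_mult)
    ultimately show ?thesis by simp
  qed
  show ?thesis
  proof (cases "even n")
    case True
    then obtain j where j: "n = 2 * j" by auto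
    have "1 / sqrt (2 * real j + 1) \<le> 1 / sqrt (real n)" using assms j by (intro divide_left_mono) auto
    then show ?thesis using even[of j k] j by simp
  next
    case False
    then obtain j where j: "n = Suc (2 * j)" by (auto elim: oddE)
    have "real (n choose k) / 2 ^ n \<le> 1 / sqrt (2 * real j + 1)"
    proof (cases k)
      case 0
      have "sqrt (2 * real j + 1) \<le> 2 ^ n"
      proof (rule real_le_lsqrt)
        have "real n * 1 \<le> 2 ^ n * 2 ^ n"
          using of_nat_less_two_power[of n, where 'a = real] by (intro mult_mono) auto
        then show "2 * real j + 1 \<le> (2 ^ n)\<^sup>2" by (simp add: j power2_eq_square)
      qed auto
      then show ?thesis using 0 by (simp add: divide_left_mono)
    next
      case (Suc l)
      have "real (n choose k) / 2 ^ n = (real (2 * j choose l) / 2 ^ (2 * j) + real (2 * j choose k) / 2 ^ (2 * j)) / 2"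
        unfolding j Suc binomial_Suc_Suc of_nat_add power_Suc by (simp add: add_divide_distrib)
      also have "\<dots> \<le> 1 / sqrt (2 * real j + 1)"
      proof -
        have "(x + y) / 2 \<le> z" if "x \<le> z" "y \<le> z" for x y z :: real using that by simp
        then show ?thesis using even by blast
      qed
      finally show ?thesis .
    qed
    then show ?thesis by (simp add: j add.commute)
  qed
qed

text \<open>Hoeffding's inequality for fair coin flips.\<close>

lemma binomial_tail:
  fixes x :: real
  assumes "n > 0" "x \<ge> 0" "real u \<le> real n / 2 - x"
  shows "(\<Sum>k\<le>u. real (n choose k)) \<le> 2 ^ n * exp (- 2 * x\<^sup>2 / real n)"
proof -
  interpret binomial_distribution n "1/2" by unfold_locales auto
  have "rm_rate u n \<le> measure_pmf.prob (binomial_pmf n (1/2)) {k. real k \<le> real n * (1/2) - x}"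
    unfolding rm_rate_binomial using assms by (intro measure_pmf.finite_measure_mono) auto
  also have "\<dots> \<le> exp (- 2 * x\<^sup>2 / real n)" using assms by (intro prob_le) auto
  finally show ?thesis by (simp add: rm_rate_def field_simps)
qed

section \<open>Codewords of small weight\<close>

definition dot :: "nat set \<Rightarrow> nat set \<Rightarrow> bool" where
  "dot x y \<longleftrightarrow> odd (card (x \<inter> y))"

lemma dot_commute: "dot x y = dot y x"
  by (simp add: dot_def Int_commute)

lemma dot_sd:
  assumes "finite y"
  shows "dot (x \<oplus> x') y \<longleftrightarrow> (dot x y \<longleftrightarrow> \<not> dot x' y)"
proof -
  have "(x \<oplus> x') \<inter> y = {i \<in> y. i \<in> x \<longleftrightarrow> \<not> i \<in> x'}" "x \<inter> y = {i \<in> y. i \<in> x}"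
    "x' \<inter> y = {i \<in> y. i \<in> x'}" by (auto simp: sd_iff)
  then show ?thesis unfolding dot_def using odd_card_xor[OF assms, of "\<lambda>i. i \<in> x" "\<lambda>i. i \<in> x'"] by auto
qed

lemma psum_sd:
  assumes "finite T" "finite A"
  shows "psum z (T \<oplus> A) = psum z T \<oplus> psum z A"
proof -
  have *: "j \<in> psum z B \<longleftrightarrow> dot B ({i. j \<in> z i} \<inter> (T \<union> A))" if "B \<subseteq> T \<union> A" for B j
    unfolding dot_def psum_def mem_Collect_eq using that by (intro arg_cong[where f = "\<lambda>C. odd (card C)"]) auto
  have sub: "T \<oplus> A \<subseteq> T \<union> A" by (auto simp: sd_def)
  have fin: "finite ({i. j \<in> z i} \<inter> (T \<union> A))" for j using assms by auto
  show ?thesis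
  proof (rule set_eqI)
    fix j
    show "j \<in> psum z (T \<oplus> A) \<longleftrightarrow> j \<in> psum z T \<oplus> psum z A"
      unfolding sd_iff[of j "psum z T"] *[OF sub] *[OF Un_upper1] *[OF Un_upper2] dot_sd[OF fin]
      by blast
  qed
qed

lemma psum_shear:
  "finite T \<Longrightarrow> psum (\<lambda>i. {i} \<oplus> z i) T = T \<oplus> psum z T"
proof (induction T rule: finite_induct)
  case (insert i T)
  have "psum (\<lambda>i. {i} \<oplus> z i) (insert i T) = ({i} \<oplus> z i) \<oplus> (T \<oplus> psum z T)"
    using insert by (simp add: psum_insert)
  also have "\<dots> = ({i} \<oplus> T) \<oplus> (z i \<oplus> psum z T)" by (simp add: sd_ac)
  also have "{i} \<oplus> T = insert i T" using insert.hyps by (subst sd_disjoint) auto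
  also have "z i \<oplus> psum z T = psum z (insert i T)" using insert.hyps by (simp add: psum_insert)
  finally show ?case .
qed simp

abbreviation supp :: "nat \<Rightarrow> (nat set \<Rightarrow> bool) \<Rightarrow> nat set set" where
  "supp m f \<equiv> {x \<in> cube m. f x}"

text \<open>Derivatives in the \<open>k\<close> directions \<open>e\<^sub>i + z\<^sub>i\<close>, where the \<open>e\<^sub>i\<close> are the last \<open>k\<close> unit vectors
  and the \<open>z\<^sub>i\<close> range over the span of the first \<open>n\<close> ones. For any non-empty set of directions,
  their sum is uniformly distributed over a coset of that span when \<open>z\<close> is.\<close>

definition shears :: "nat \<Rightarrow> nat \<Rightarrow> (nat \<Rightarrow> nat set) set" where
  "shears n k = (\<Pi>\<^sub>E i\<in>{n..<n + k}. cube n)"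

definition shear_deriv ::
  "nat \<Rightarrow> nat \<Rightarrow> (nat \<Rightarrow> nat set) \<Rightarrow> (nat set \<Rightarrow> bool) \<Rightarrow> nat set \<Rightarrow> bool" where
  "shear_deriv n k z f = deriv_along (\<lambda>i. {i} \<oplus> z i) {n..<n + k} f"

lemma card_shears: "card (shears n k) = 2 ^ (n * k)"
  by (simp add: shears_def card_PiE power_mult)

lemma finite_shears [simp]: "finite (shears n k)"
  by (simp add: shears_def finite_PiE)

lemma shear_psum_in_cube:
  assumes "z \<in> shears n k" "T \<subseteq> {n..<n + k}"
  shows "psum z T \<in> cube n"
proof (rule psum_in_cube)
  fix i assume "i \<in> T"
  then have "i \<in> {n..<n + k}" using assms by auto
  then show "z i \<in> cube n" using assms(1) unfolding shears_def by (rule PiE_mem[rotated])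
qed

lemma shear_deriv_alt:
  "shear_deriv n k z f x \<longleftrightarrow> odd (card {T \<in> Pow {n..<n + k}. f (x \<oplus> T \<oplus> psum z T)})"
proof -
  have "finite T" if "T \<in> Pow {n..<n + k}" for T using that finite_subset by auto
  then have "{T \<in> Pow {n..<n + k}. f (x \<oplus> psum (\<lambda>i. {i} \<oplus> z i) T)} =
      {T \<in> Pow {n..<n + k}. f (x \<oplus> T \<oplus> psum z T)}"
    by (auto simp: psum_shear sd_assoc)
  then show ?thesis by (simp add: shear_deriv_def deriv_along_def)
qed

text \<open>A derivative over F_2 is invariant under translation by its own directions, and those
  indexed by \<open>A\<close> add up to \<open>A \<oplus> psum z A\<close>. So the values on
  \<open>cube n\<close> determine the whole derivative.\<close>

lemma shear_deriv_periodic: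
  assumes "A \<subseteq> {n..<n + k}"
  shows "shear_deriv n k z f (w \<oplus> A) = shear_deriv n k z f (w \<oplus> psum z A)"
proof -
  let ?U = "{n..<n + k}"
  have fin: "finite A" "\<And>T. T \<in> Pow ?U \<Longrightarrow> finite T" using assms finite_subset by auto
  have "bij_betw (\<lambda>T. T \<oplus> A) {T \<in> Pow ?U. f (w \<oplus> A \<oplus> T \<oplus> psum z T)}
      {T \<in> Pow ?U. f (w \<oplus> psum z A \<oplus> T \<oplus> psum z T)}"
  proof (rule bij_betwI[where g = "\<lambda>T. T \<oplus> A"])
    show "(\<lambda>T. T \<oplus> A) \<in> {T \<in> Pow ?U. f (w \<oplus> A \<oplus> T \<oplus> psum z T)} \<rightarrow>
        {T \<in> Pow ?U. f (w \<oplus> psum z A \<oplus> T \<oplus> psum z T)}"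
    proof (intro Pi_I)
      fix T assume T: "T \<in> {T \<in> Pow ?U. f (w \<oplus> A \<oplus> T \<oplus> psum z T)}"
      have "w \<oplus> psum z A \<oplus> (T \<oplus> A) \<oplus> psum z (T \<oplus> A) = w \<oplus> A \<oplus> T \<oplus> psum z T"
        using T fin by (simp add: psum_sd sd_ac)
      then show "T \<oplus> A \<in> {T \<in> Pow ?U. f (w \<oplus> psum z A \<oplus> T \<oplus> psum z T)}"
        using T assms by (auto simp del: atLeastLessThan_iff)
    qed
    show "(\<lambda>T. T \<oplus> A) \<in> {T \<in> Pow ?U. f (w \<oplus> psum z A \<oplus> T \<oplus> psum z T)} \<rightarrow>
        {T \<in> Pow ?U. f (w \<oplus> A \<oplus> T \<oplus> psum z T)}"
    proof (intro Pi_I)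
      fix T assume T: "T \<in> {T \<in> Pow ?U. f (w \<oplus> psum z A \<oplus> T \<oplus> psum z T)}"
      have "w \<oplus> A \<oplus> (T \<oplus> A) \<oplus> psum z (T \<oplus> A) = w \<oplus> psum z A \<oplus> T \<oplus> psum z T"
        using T fin by (simp add: psum_sd sd_ac)
      then show "T \<oplus> A \<in> {T \<in> Pow ?U. f (w \<oplus> A \<oplus> T \<oplus> psum z T)}"
        using T assms by (auto simp del: atLeastLessThan_iff)
    qed
  qed (simp_all)
  then show ?thesis unfolding shear_deriv_alt by (simp add: bij_betw_same_card)
qed

lemma vanishing_shear_deriv:
  assumes "z \<in> shears n k" "vanishing (n + k) (k + j) f"
  shows "vanishing (n + k) j (shear_deriv n k z f)"
  unfolding shear_deriv_def
proof (rule vanishing_deriv_along)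
  fix i assume i: "i \<in> {n..<n + k}"
  then have "z i \<in> cube n" using assms(1) unfolding shears_def by (rule PiE_mem[rotated])
  then show "{i} \<oplus> z i \<in> cube (n + k)" using i by (auto simp: sd_def)
qed (use assms(2) in auto)

lemma shear_deriv_in_RM:
  assumes "z \<in> shears n k" "f \<in> RM v (n + k)" "k \<le> v"
  shows "(\<lambda>x. x \<in> cube n \<and> shear_deriv n k z f x) \<in> RM (v - k) n"
proof -
  have "vanishing (n + k) (Suc (v - k)) (shear_deriv n k z f)"
    using assms by (intro vanishing_shear_deriv) (auto simp: RM_iff_vanishing)
  then have "vanishing n (Suc (v - k)) (\<lambda>x. shear_deriv n k z f (id x))"
    by (rule vanishing_compose[where \<psi> = id, rotated 3]) auto
  then have "vanishing n (Suc (v - k)) (\<lambda>x. x \<in> cube n \<and> shear_deriv n k z f x)"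
    by (subst vanishing_cong[where g = "\<lambda>x. shear_deriv n k z f (id x)"]) auto
  then show ?thesis by (simp add: RM_iff_vanishing)
qed

text \<open>For a fixed \<open>i \<in> T\<close>, the prescribed sum determines \<open>z i\<close>
  from the remaining directions.\<close>

lemma card_psum_fibre:
  assumes "T \<subseteq> {n..<n + k}" "T \<noteq> {}"
  shows "card {z \<in> shears n k. psum z T = w} \<le> 2 ^ (n * (k - 1))"
proof -
  let ?U = "{n..<n + k}"
  obtain i where i: "i \<in> T" using assms by auto
  have fin: "finite T" using assms finite_subset by blast
  have "inj_on (\<lambda>z. restrict z (?U - {i})) {z \<in> shears n k. psum z T = w}"
  proof (rule inj_onI)
    fix z z' assume z: "z \<in> {z \<in> shears n k. psum z T = w}" and z': "z' \<in> {z \<in> shears n k. psum z T = w}"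
      and eq: "restrict z (?U - {i}) = restrict z' (?U - {i})"
    have e: "z j = z' j" if "j \<in> ?U - {i}" for j
      using fun_cong[OF eq, of j] that by simp
    have "psum z (T - {i}) = psum z' (T - {i})"
      unfolding psum_def using e assms(1) by (intro Collect_cong arg_cong[where f = "\<lambda>C. odd (card C)"]) blast
    moreover have "psum y T = y i \<oplus> psum y (T - {i})" for y
      using psum_insert[of "T - {i}" i y] i fin by (simp add: insert_absorb)
    ultimately have "z i \<oplus> psum z (T - {i}) = z' i \<oplus> psum z (T - {i})" using z z' by auto
    then have "z i = z' i" by (metis sd_cancel(2))
    then have "z j = z' j" if "j \<in> ?U" for j using e that by (cases "j = i") auto
    moreover have "z \<in> ?U \<rightarrow>\<^sub>E cube n" "z' \<in> ?U \<rightarrow>\<^sub>E cube n" using z z' by (auto simp: shears_def)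
    ultimately show "z = z'" by (intro PiE_ext) auto
  qed
  moreover have "(\<lambda>z. restrict z (?U - {i})) ` {z \<in> shears n k. psum z T = w} \<subseteq> (\<Pi>\<^sub>E j\<in>?U - {i}. cube n)"
  proof (intro image_subsetI)
    fix z assume "z \<in> {z \<in> shears n k. psum z T = w}"
    then have "z j \<in> cube n" if "j \<in> ?U" for j using that PiE_mem unfolding shears_def by blast
    then show "restrict z (?U - {i}) \<in> (\<Pi>\<^sub>E j\<in>?U - {i}. cube n)"
      by (subst restrict_PiE_iff) blast
  qed
  ultimately have "card {z \<in> shears n k. psum z T = w} \<le> card (\<Pi>\<^sub>E j\<in>?U - {i}. cube n)"
    by (intro card_inj_on_le) (auto intro: finite_PiE)
  also have "\<dots> = 2 ^ (n * (k - 1))"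
    using i assms(1) by (subst card_PiE) (auto simp: power_mult)
  finally show ?thesis .
qed

text \<open>The term \<open>T = {}\<close> of the derivative is \<open>f x\<close> itself, so an
  error requires \<open>f\<close> to be true at another of the summed points. The union bound runs
  over the non-empty \<open>T\<close> and the possible subset sums \<open>w\<close>; such pairs
  inject into the support, each accounting for one fibre of \<open>psum\<close>.\<close>

lemma card_wrong_shears:
  assumes "x \<in> cube (n + k)"
  shows "card {z \<in> shears n k. shear_deriv n k z f x \<noteq> f x} \<le> card (supp (n + k) f) * 2 ^ (n * (k - 1))"
proof -
  let ?U = "{n..<n + k}"
  let ?P = "Pow ?U - {{}}"
  define H where "H T = {w \<in> cube n. f (x \<oplus> T \<oplus> w)}" for T
  have finH: "finite (H T)" for T by (simp add: H_def)
  have "{z \<in> shears n k. shear_deriv n k z f x \<noteq> f x} \<subseteq>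
      (\<Union>T\<in>?P. \<Union>w\<in>H T. {z \<in> shears n k. psum z T = w})"
  proof
    fix z assume z: "z \<in> {z \<in> shears n k. shear_deriv n k z f x \<noteq> f x}"
    have "\<exists>T\<in>?P. f (x \<oplus> T \<oplus> psum z T)"
    proof (rule ccontr)
      assume "\<not> ?thesis"
      then have "{T \<in> Pow ?U. f (x \<oplus> T \<oplus> psum z T)} = (if f x then {{}} else {})" by auto
      then have "shear_deriv n k z f x = f x" by (simp add: shear_deriv_alt)
      then show False using z by simp
    qed
    then obtain T where "T \<in> ?P" "f (x \<oplus> T \<oplus> psum z T)" by blast
    then show "z \<in> (\<Union>T\<in>?P. \<Union>w\<in>H T. {z \<in> shears n k. psum z T = w})"
      using z shear_psum_in_cube[of z n k T] by (auto simp: H_def)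
  qed
  then have "card {z \<in> shears n k. shear_deriv n k z f x \<noteq> f x} \<le>
      card (\<Union>T\<in>?P. \<Union>w\<in>H T. {z \<in> shears n k. psum z T = w})"
    by (intro card_mono) (auto simp: finH)
  also have "\<dots> \<le> (\<Sum>T\<in>?P. card (\<Union>w\<in>H T. {z \<in> shears n k. psum z T = w}))"
    by (intro card_UN_le) auto
  also have "\<dots> \<le> (\<Sum>T\<in>?P. \<Sum>w\<in>H T. card {z \<in> shears n k. psum z T = w})"
    by (intro sum_mono card_UN_le finH)
  also have "\<dots> \<le> (\<Sum>T\<in>?P. \<Sum>w\<in>H T. 2 ^ (n * (k - 1)))"
    by (intro sum_mono card_psum_fibre) auto
  also have "\<dots> = card (SIGMA T:?P. H T) * 2 ^ (n * (k - 1))"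
    using finH by (subst card_SigmaI) (auto simp: sum_distrib_right)
  also have "card (SIGMA T:?P. H T) \<le> card (supp (n + k) f)"
  proof (rule card_inj_on_le[where f = "\<lambda>(T, w). x \<oplus> T \<oplus> w"])
    show "inj_on (\<lambda>(T, w). x \<oplus> T \<oplus> w) (SIGMA T:?P. H T)"
    proof (rule inj_onI)
      fix q q' assume q: "q \<in> (SIGMA T:?P. H T)" "q' \<in> (SIGMA T:?P. H T)"
        "(\<lambda>(T, w). x \<oplus> T \<oplus> w) q = (\<lambda>(T, w). x \<oplus> T \<oplus> w) q'"
      then obtain T w T' w' where qq: "q = (T, w)" "q' = (T', w')" by (cases q, cases q')
      then have *: "x \<oplus> T \<oplus> w = x \<oplus> T' \<oplus> w'" "T \<subseteq> ?U" "T' \<subseteq> ?U" "w \<in> H T" "w' \<in> H T'"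
        using q by auto
      have eq: "T \<oplus> w = T' \<oplus> w'" using *(1) by (simp add: sd_assoc)
      have w: "w \<subseteq> {..<n}" "w' \<subseteq> {..<n}" using * by (auto simp: H_def)
      \<comment> \<open>\<open>T\<close> and \<open>w\<close> occupy disjoint blocks of coordinates,
        so both can be read off their sum.\<close>
      have "T = (T \<oplus> w) \<inter> ?U" "T' = (T' \<oplus> w') \<inter> ?U"
        "w = (T \<oplus> w) \<inter> {..<n}" "w' = (T' \<oplus> w') \<inter> {..<n}"
        using w *(2,3) by (fastforce simp: sd_iff)+
      then show "q = q'" using eq qq by metis
    qed
    show "(\<lambda>(T, w). x \<oplus> T \<oplus> w) ` (SIGMA T:?P. H T) \<subseteq> supp (n + k) f"
    proof
      fix u assume "u \<in> (\<lambda>(T, w). x \<oplus> T \<oplus> w) ` (SIGMA T:?P. H T)"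
      then obtain T w where T: "T \<subseteq> ?U" "w \<in> H T" and u: "u = x \<oplus> T \<oplus> w" by auto
      have "T \<in> cube (n + k)" "w \<in> cube (n + k)" using T by (auto simp: H_def)
      then have "u \<in> cube (n + k)" unfolding u using assms by (intro sd_in_Pow)
      then show "u \<in> supp (n + k) f" using T(2) u by (simp add: H_def)
    qed
  qed simp
  finally show ?thesis by simp
qed

text \<open>Derivatives of order \<open>v + 1\<close> vanish, so at a point of the support every
  choice of directions is wrong; \<open>card_wrong_shears\<close> then forces the support to be
  large.\<close>

theorem RM_min_weight:
  assumes "f \<in> RM v (n + Suc v)" "f x"
  shows "2 ^ n \<le> card (supp (n + Suc v) f)"
proof -
  have x: "x \<in> cube (n + Suc v)" using assms RM_outside by blast
  have "shear_deriv n (Suc v) z f x \<noteq> f x" if "z \<in> shears n (Suc v)" for z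
    using vanishing_shear_deriv[OF that, of 0 f] assms x by (simp add: RM_iff_vanishing)
  then have "{z \<in> shears n (Suc v). shear_deriv n (Suc v) z f x \<noteq> f x} = shears n (Suc v)" by auto
  then have "2 ^ (n * Suc v) \<le> card (supp (n + Suc v) f) * 2 ^ (n * v)"
    using card_wrong_shears[OF x, of f] by (simp add: card_shears)
  then have "2 ^ n * 2 ^ (n * v) \<le> card (supp (n + Suc v) f) * 2 ^ (n * v)"
    by (simp add: power_add)
  then show ?thesis by simp
qed

text \<open>Greedy choice of a list of tests that is correct in the majority at every point, driven by
  the potential \<open>\<Sum>x. 16 ^ (number of wrong tests at x)\<close>.\<close>

lemma majority_list:
  fixes wrong :: "'z \<Rightarrow> 'x \<Rightarrow> bool"
  assumes "finite X" "finite Z" "Z \<noteq> {}" and few: "\<And>x. x \<in> X \<Longrightarrow> 16 * card {z \<in> Z. wrong z x} \<le> card Z"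
  shows "\<exists>zs. length zs = t \<and> set zs \<subseteq> Z \<and>
    (\<Sum>x\<in>X. (16::nat) ^ length (filter (\<lambda>z. wrong z x) zs)) \<le> card X * 2 ^ t"
proof (induction t)
  case 0
  show ?case by (rule exI[of _ "[]"]) simp
next
  case (Suc t)
  then obtain zs where zs: "length zs = t" "set zs \<subseteq> Z"
    "(\<Sum>x\<in>X. (16::nat) ^ length (filter (\<lambda>z. wrong z x) zs)) \<le> card X * 2 ^ t" by blast
  define W where "W x = (16::nat) ^ length (filter (\<lambda>z. wrong z x) zs)" for x
  define V where "V z = (\<Sum>x\<in>X. (16::nat) ^ length (filter (\<lambda>z. wrong z x) (z # zs)))" for z
  have "(\<Sum>z\<in>Z. V z) = (\<Sum>x\<in>X. \<Sum>z\<in>Z. W x * (1 + 15 * of_bool (wrong z x)))"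
    unfolding V_def W_def by (subst sum.swap) (auto intro!: sum.cong)
  also have "\<dots> = (\<Sum>x\<in>X. W x * (card Z + 15 * card {z \<in> Z. wrong z x}))"
  proof (intro sum.cong refl)
    fix x
    have "(\<Sum>z\<in>Z. of_bool (wrong z x)) = card {z \<in> Z. wrong z x}"
      using assms(2) by (simp add: Int_def)
    then show "(\<Sum>z\<in>Z. W x * (1 + 15 * of_bool (wrong z x))) = W x * (card Z + 15 * card {z \<in> Z. wrong z x})"
      by (simp only: sum_distrib_left[symmetric] sum.distrib) simp
  qed
  \<comment> \<open>A wrong test multiplies the term at \<open>x\<close> by 16 and at most one test
    in 16 is wrong, so the average factor is at most \<open>1 + 15 / 16\<close>.\<close>
  also have "\<dots> \<le> (\<Sum>x\<in>X. W x * (2 * card Z))"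
    using few by (intro sum_mono mult_left_mono) fastforce+
  also have "\<dots> = card Z * (2 * (\<Sum>x\<in>X. W x))"
    by (simp add: sum_distrib_left sum_distrib_right mult_ac)
  finally have le: "(\<Sum>z\<in>Z. V z) \<le> card Z * (2 * (\<Sum>x\<in>X. W x))" .
  have "\<exists>z\<in>Z. V z \<le> 2 * (\<Sum>x\<in>X. W x)"
  proof (rule ccontr)
    assume "\<not> ?thesis"
    then have "(\<Sum>z\<in>Z. 2 * (\<Sum>x\<in>X. W x)) < (\<Sum>z\<in>Z. V z)"
      using assms(2,3) by (intro sum_strict_mono) auto
    then show False using le by simp
  qed
  then obtain z where z: "z \<in> Z" "V z \<le> 2 * (\<Sum>x\<in>X. W x)" by blast
  have "V z \<le> card X * 2 ^ Suc t" using z(2) zs(3) by (simp add: W_def)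
  then show ?case using z(1) zs unfolding V_def by (intro exI[of _ "z # zs"]) simp
qed

text \<open>Small weight makes at most a sixteenth of the directions wrong at any point, so
  \<open>majority_list\<close> provides \<open>m + 1\<close> derivatives whose pointwise majority is
  \<open>f\<close>. The directions, together with the derivatives restricted to
  \<open>cube n\<close>, encode \<open>f\<close> injectively, and each restricted derivative lies in
  the small code \<open>RM (v - k) n\<close>.\<close>

theorem card_low_weight_RM:
  assumes "1 \<le> k" "k \<le> v"
  shows "card {f \<in> RM v (n + k). 16 * card (supp (n + k) f) \<le> 2 ^ n} \<le>
    (2 ^ (n * k) * 2 ^ (\<Sum>i\<le>v - k. n choose i)) ^ Suc (n + k)"
proof -
  define m where "m = n + k"
  define F where "F = {f \<in> RM v m. 16 * card (supp m f) \<le> 2 ^ n}"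
  define D where "D = shear_deriv n k"
  have "\<exists>zs. length zs = Suc m \<and> set zs \<subseteq> shears n k \<and>
      (\<forall>x\<in>cube m. 2 * length (filter (\<lambda>z. D z f x \<noteq> f x) zs) < Suc m)" if f: "f \<in> F" for f
  proof -
    have "16 * card {z \<in> shears n k. D z f x \<noteq> f x} \<le> card (shears n k)" if "x \<in> cube m" for x
    proof -
      have "16 * card {z \<in> shears n k. D z f x \<noteq> f x} \<le> (16 * card (supp m f)) * 2 ^ (n * (k - 1))"
        using card_wrong_shears[of x n k f] that by (simp add: D_def m_def)
      also have "\<dots> \<le> 2 ^ n * 2 ^ (n * (k - 1))" using f by (intro mult_right_mono) (auto simp: F_def)
      also have "\<dots> = 2 ^ (n * k)" using assms(1) by (cases k) (auto simp: power_add)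
      finally show ?thesis by (simp add: card_shears)
    qed
    moreover have "shears n k \<noteq> {}" using card_shears[of n k] by auto
    ultimately obtain zs where zs: "length zs = Suc m" "set zs \<subseteq> shears n k"
      "(\<Sum>x\<in>cube m. (16::nat) ^ length (filter (\<lambda>z. D z f x \<noteq> f x) zs)) \<le> card (cube m) * 2 ^ Suc m"
      using majority_list[of "cube m" "shears n k" "\<lambda>z x. D z f x \<noteq> f x" "Suc m"] by auto
    have "2 * length (filter (\<lambda>z. D z f x \<noteq> f x) zs) < Suc m" if x: "x \<in> cube m" for x
    proof (rule ccontr)
      assume "\<not> ?thesis"
      \<comment> \<open>A point with at least half of the tests wrong would alone contribute
        \<open>2 ^ (2 * (m + 1))\<close>, more than the total potential
        \<open>2 ^ m * 2 ^ (m + 1)\<close>.\<close>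
      then have "Suc m + Suc m \<le> 4 * length (filter (\<lambda>z. D z f x \<noteq> f x) zs)" by simp
      then have "(2::nat) ^ (Suc m + Suc m) \<le> 2 ^ (4 * length (filter (\<lambda>z. D z f x \<noteq> f x) zs))"
        by (rule power_increasing) simp
      also have "\<dots> = 16 ^ length (filter (\<lambda>z. D z f x \<noteq> f x) zs)" by (simp add: power_mult)
      also have "\<dots> \<le> (\<Sum>x\<in>cube m. (16::nat) ^ length (filter (\<lambda>z. D z f x \<noteq> f x) zs))"
        using x by (intro member_le_sum) auto
      also note zs(3)
      finally show False by (simp add: power_add)
    qed
    then show ?thesis using zs by blast
  qed
  then obtain Z where Z: "\<And>f. f \<in> F \<Longrightarrow> length (Z f) = Suc m" "\<And>f. f \<in> F \<Longrightarrow> set (Z f) \<subseteq> shears n k"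
    "\<And>f x. f \<in> F \<Longrightarrow> x \<in> cube m \<Longrightarrow> 2 * length (filter (\<lambda>z. D z f x \<noteq> f x) (Z f)) < Suc m"
    by metis
  define data where "data f = map (\<lambda>z. (z, \<lambda>x. x \<in> cube n \<and> D z f x)) (Z f)" for f
  define L where "L = {xs. set xs \<subseteq> shears n k \<times> RM (v - k) n \<and> length xs = Suc m}"
  \<comment> \<open>Decoding splits \<open>x\<close> into its first \<open>n\<close> coordinates and
    the block \<open>A\<close>; by periodicity \<open>A\<close> may be replaced by
    \<open>psum z A\<close>, which leads back into \<open>cube n\<close>, where the data are
    stored.\<close>
  have recover: "f x \<longleftrightarrow> x \<in> cube m \<and>
      2 * length (filter (\<lambda>(z, g). g ((x \<inter> {..<n}) \<oplus> psum z (x \<inter> {n..<n + k}))) (data f)) > Suc m"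
    if f: "f \<in> F" for f x
  proof (cases "x \<in> cube m")
    case True
    define A where "A = x \<inter> {n..<n + k}"
    define w where "w = x \<inter> {..<n}"
    have xw: "x = w \<oplus> A" using True by (auto simp: w_def A_def sd_iff m_def)
    have "filter (\<lambda>(z, g). g (w \<oplus> psum z A)) (data f) =
        map (\<lambda>z. (z, \<lambda>x. x \<in> cube n \<and> D z f x)) (filter (\<lambda>z. D z f x) (Z f))"
    proof -
      have "w \<oplus> psum z A \<in> cube n \<and> D z f (w \<oplus> psum z A) \<longleftrightarrow> D z f x" if z: "z \<in> set (Z f)" for z
      proof -
        have "z \<in> shears n k" using Z(2)[OF f] z by auto
        then have "psum z A \<in> cube n" by (rule shear_psum_in_cube) (simp add: A_def)
        moreover have "w \<in> cube n" by (simp add: w_def)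
        ultimately have "w \<oplus> psum z A \<in> cube n" by (intro sd_in_Pow)
        moreover have "D z f x = D z f (w \<oplus> psum z A)"
          unfolding xw D_def by (rule shear_deriv_periodic) (simp add: A_def)
        ultimately show ?thesis by simp
      qed
      then have "filter ((\<lambda>(z, g). g (w \<oplus> psum z A)) \<circ> (\<lambda>z. (z, \<lambda>x. x \<in> cube n \<and> D z f x))) (Z f) =
          filter (\<lambda>z. D z f x) (Z f)"
        by (intro filter_cong) auto
      then show ?thesis unfolding data_def filter_map by simp
    qed
    then have len: "length (filter (\<lambda>(z, g). g (w \<oplus> psum z A)) (data f)) = length (filter (\<lambda>z. D z f x) (Z f))"
      by simp
    have "2 * length (filter (\<lambda>z. D z f x) (Z f)) > Suc m \<longleftrightarrow> f x"
    proof (cases "f x")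
      case True
      have "length (filter (\<lambda>z. D z f x) (Z f)) + length (filter (\<lambda>z. \<not> D z f x) (Z f)) = Suc m"
        using Z(1)[OF f] sum_length_filter_compl[of "\<lambda>z. D z f x" "Z f"] by simp
      then show ?thesis using Z(3)[OF f \<open>x \<in> cube m\<close>] True by simp
    next
      case False
      then show ?thesis using Z(3)[OF f \<open>x \<in> cube m\<close>] by simp
    qed
    then show ?thesis using len True by (simp add: A_def w_def)
  next
    case False
    moreover have "f \<in> RM v m" using f by (simp add: F_def)
    ultimately show ?thesis using RM_outside[of f v m x] by blast
  qed
  have "inj_on data F"
  proof (rule inj_onI)
    fix f g assume "f \<in> F" "g \<in> F" "data f = data g"
    then show "f = g" using recover[of f] recover[of g] by (intro ext) simp
  qed
  moreover have "data ` F \<subseteq> L"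
  proof (intro subsetI, elim imageE)
    fix xs f assume f: "f \<in> F" "xs = data f"
    have "(\<lambda>x. x \<in> cube n \<and> D z f x) \<in> RM (v - k) n" if "z \<in> set (Z f)" for z
      unfolding D_def using that Z(2)[OF f(1)] f(1) assms
      by (intro shear_deriv_in_RM) (auto simp: F_def m_def)
    then show "xs \<in> L" using Z(1,2)[OF f(1)] f by (auto simp: L_def data_def)
  qed
  moreover have "finite L" unfolding L_def by (intro finite_lists_length_eq) simp
  ultimately have "card F \<le> card L" by (rule card_inj_on_le)
  also have "card L = (card (shears n k) * card (RM (v - k) n)) ^ Suc m"
    unfolding L_def by (subst card_lists_length_eq) (auto simp: card_cartesian_product)
  finally show ?thesis by (simp add: F_def m_def card_shears card_RM)
qed

section \<open>EXIT functions of nested codes\<close>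

definition chr :: "nat set \<Rightarrow> nat set \<Rightarrow> real" where
  "chr x y = (if dot x y then -1 else 1)"

lemma chr_sd: "finite y \<Longrightarrow> chr (x \<oplus> x') y = chr x y * chr x' y"
  by (simp add: chr_def dot_sd)

lemma chr_empty [simp]: "chr {} y = 1"
  by (simp add: chr_def dot_def)

lemma sum_chr:
  assumes "u \<in> cube n" "u \<noteq> {}"
  shows "(\<Sum>y\<in>cube n. chr u y) = 0"
proof -
  obtain j where j: "j \<in> u" using assms by auto
  have fin: "finite u" using assms finite_subset by auto
  have jn: "{j} \<in> cube n" using j assms by auto
  have "(\<Sum>y\<in>cube n. chr u y) = (\<Sum>y\<in>cube n. chr u (y \<oplus> {j}))"
    by (rule sum.reindex_bij_witness[where i = "\<lambda>y. y \<oplus> {j}" and j = "\<lambda>y. y \<oplus> {j}"])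
      (use jn in \<open>auto simp del: Pow_iff intro: sd_in_Pow\<close>)
  also have "\<dots> = (\<Sum>y\<in>cube n. - chr u y)"
  proof (intro sum.cong refl)
    fix y
    have "dot u {j}" using j by (simp add: dot_def)
    then show "chr u (y \<oplus> {j}) = - chr u y"
      using dot_sd[OF fin, of y "{j}"] by (auto simp: chr_def dot_commute[of u])
  qed
  finally show ?thesis by (simp add: sum_negf)
qed

text \<open>Second moment of the character sum over \<open>S\<close> with the zero vector adjoined,
  which is where the \<open>+ 1\<close> comes from. Every annihilating \<open>y\<close> contributes
  the square of the number of characters, while orthogonality makes the total \<open>2 ^ n\<close>
  times that number. Equality holds for subspaces.\<close>

lemma card_annihilator:
  assumes "S \<subseteq> cube n - {{}}"
  shows "real (card {y \<in> cube n. \<forall>s\<in>S. \<not> dot s y}) * (real (card S) + 1) \<le> 2 ^ n"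
proof -
  define A where "A = {y \<in> cube n. \<forall>s\<in>S. \<not> dot s y}"
  define S0 where "S0 = insert {} S"
  have finS: "finite S" using assms by (auto intro: finite_subset[of S "cube n"])
  have "{} \<notin> S" using assms by blast
  then have S0: "S0 \<subseteq> cube n" "finite S0" "card S0 = card S + 1"
    using assms finS by (auto simp: S0_def)
  have "real (card A) * (real (card S0))\<^sup>2 = (\<Sum>y\<in>A. (\<Sum>s\<in>S0. chr s y)\<^sup>2)"
  proof -
    have "(\<Sum>s\<in>S0. chr s y) = real (card S0)" if "y \<in> A" for y
    proof -
      have "(\<Sum>s\<in>S0. chr s y) = (\<Sum>s\<in>S0. 1)"
        using that by (intro sum.cong) (auto simp: S0_def A_def chr_def dot_def)
      then show ?thesis by simp
    qed
    then show ?thesis by simp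
  qed
  also have "\<dots> \<le> (\<Sum>y\<in>cube n. (\<Sum>s\<in>S0. chr s y)\<^sup>2)"
    by (intro sum_mono2) (auto simp: A_def)
  also have "\<dots> = (\<Sum>y\<in>cube n. \<Sum>s\<in>S0. \<Sum>s'\<in>S0. chr (s \<oplus> s') y)"
  proof (intro sum.cong refl)
    fix y assume "y \<in> cube n"
    then have "finite y" using finite_subset by auto
    then show "(\<Sum>s\<in>S0. chr s y)\<^sup>2 = (\<Sum>s\<in>S0. \<Sum>s'\<in>S0. chr (s \<oplus> s') y)"
      by (simp add: chr_sd power2_eq_square sum_product)
  qed
  also have "\<dots> = (\<Sum>s\<in>S0. \<Sum>s'\<in>S0. \<Sum>y\<in>cube n. chr (s \<oplus> s') y)"
    by (subst sum.swap) (intro sum.cong refl sum.swap)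
  also have "\<dots> = (\<Sum>s\<in>S0. \<Sum>s'\<in>S0. if s = s' then 2 ^ n else 0)"
  proof (intro sum.cong refl)
    fix s s' assume s: "s \<in> S0" "s' \<in> S0"
    show "(\<Sum>y\<in>cube n. chr (s \<oplus> s') y) = (if s = s' then 2 ^ n else 0)"
    proof (cases "s = s'")
      case False
      then have "s \<oplus> s' \<noteq> {}" by (auto simp: sd_def)
      moreover have "s \<oplus> s' \<in> cube n" using s S0(1) by (intro sd_in_Pow) auto
      ultimately show ?thesis using False by (simp add: sum_chr)
    qed simp
  qed
  also have "\<dots> = real (card S0) * 2 ^ n" using S0(2) by simp
  finally have "(real (card A) * real (card S0)) * real (card S0) \<le> 2 ^ n * real (card S0)"
    by (simp add: power2_eq_square mult_ac)
  then have "real (card A) * real (card S0) \<le> 2 ^ n"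
    by (rule mult_right_le_imp_le) (simp add: S0(3))
  then show ?thesis by (simp add: A_def S0(3) add.commute)
qed

section \<open>Unrecoverable bits and their restriction to hyperplanes\<close>

definition unrec :: "nat \<Rightarrow> nat \<Rightarrow> nat set \<Rightarrow> nat set set \<Rightarrow> bool" where
  "unrec v n i E \<longleftrightarrow> (\<exists>c\<in>RM v n. c i \<and> (\<forall>x. c x \<longrightarrow> x = i \<or> x \<in> E))"

text \<open>By linearity, \<open>unrec v n i E\<close> says that two codewords agree outside
  \<open>E\<close> and \<open>i\<close> but differ at \<open>i\<close>. Bit \<open>i\<close> counts
  as unobserved, hence the expectation over the other positions; here \<open>i\<close> is the
  origin.\<close>

definition exit_fun :: "nat \<Rightarrow> nat \<Rightarrow> real \<Rightarrow> real" where
  "exit_fun v n p = EP (cube n - {{}}) p (\<lambda>E. of_bool (unrec v n {} E))"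

lemma unrec_mono: "E \<subseteq> E' \<Longrightarrow> unrec v n i E \<Longrightarrow> unrec v n i E'"
  unfolding unrec_def by blast

lemma unrec_translate:
  assumes "unrec v n i E" "a \<in> cube n"
  shows "unrec v n (i \<oplus> a) ((\<lambda>x. x \<oplus> a) ` E)"
proof -
  obtain c where c: "c \<in> RM v n" "c i" "\<And>x. c x \<Longrightarrow> x = i \<or> x \<in> E"
    using assms(1) by (auto simp: unrec_def)
  have "x = i \<oplus> a \<or> x \<in> (\<lambda>x. x \<oplus> a) ` E" if "c (x \<oplus> a)" for x
    using c(3)[OF that] by (metis image_eqI sd_cancel(2))
  then show ?thesis
    unfolding unrec_def using RM_translate[OF c(1) assms(2)] c(2)
    by (intro bexI[of _ "\<lambda>x. c (x \<oplus> a)"]) auto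
qed

text \<open>Translations preserve the code and move the origin to any position, so every bit has the
  same EXIT function.\<close>

lemma EP_unrec:
  assumes "i \<in> cube n"
  shows "EP (cube n - {i}) p (\<lambda>E. of_bool (unrec v n i E)) = exit_fun v n p"
proof -
  have inj: "inj (\<lambda>x. x \<oplus> i)" by (metis injI sd_cancel(2))
  have "(\<lambda>x. x \<oplus> i) ` cube n = cube n"
  proof (intro equalityI image_subsetI subsetI)
    fix x assume "x \<in> cube n"
    then have "x \<oplus> i \<in> cube n" using assms by (intro sd_in_Pow)
    then show "x \<in> (\<lambda>x. x \<oplus> i) ` cube n" by (intro image_eqI[of _ _ "x \<oplus> i"]) auto
  qed (use assms in \<open>simp only: sd_in_Pow\<close>)
  then have img: "cube n - {i} = (\<lambda>x. x \<oplus> i) ` (cube n - {{}})"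
    using inj by (simp add: image_set_diff)
  have "unrec v n i ((\<lambda>x. x \<oplus> i) ` E) \<longleftrightarrow> unrec v n {} E" for E
  proof
    assume "unrec v n i ((\<lambda>x. x \<oplus> i) ` E)"
    from unrec_translate[OF this assms] show "unrec v n {} E" by (simp add: image_image)
  next
    assume "unrec v n {} E"
    from unrec_translate[OF this assms] show "unrec v n i ((\<lambda>x. x \<oplus> i) ` E)" by simp
  qed
  then show ?thesis
    unfolding img exit_fun_def by (subst EP_image) (auto intro: inj_on_subset[OF inj])
qed

text \<open>Linear embedding of \<open>cube n\<close> onto the hyperplane of
  \<open>cube (Suc n)\<close> on which coordinate \<open>n\<close> equals the inner product with
  \<open>y\<close>; \<open>y = {}\<close> gives \<open>cube n\<close> itself.\<close>

definition graph_map :: "nat \<Rightarrow> nat set \<Rightarrow> nat set \<Rightarrow> nat set" where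
  "graph_map n y x = (if dot x y then insert n x else x)"

lemma graph_map_in_cube: "x \<in> cube n \<Longrightarrow> graph_map n y x \<in> cube (Suc n)"
  by (auto simp: graph_map_def)

lemma graph_map_restrict: "x \<in> cube n \<Longrightarrow> graph_map n y x \<inter> {..<n} = x"
  by (auto simp: graph_map_def)

lemma graph_map_sd:
  assumes "x \<in> cube n" "x' \<in> cube n" "y \<in> cube n"
  shows "graph_map n y (x \<oplus> x') = graph_map n y x \<oplus> graph_map n y x'"
proof -
  have "finite y" using assms finite_subset[of y "{..<n}"] by auto
  moreover have "n \<notin> x" "n \<notin> x'" using assms by auto
  ultimately show ?thesis by (auto simp: graph_map_def dot_sd sd_iff)
qed

text \<open>The codeword witnessing the failure pulls back along the embedding, which is linear and
  fixes the origin.\<close>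

lemma unrec_graph:
  assumes "unrec v (Suc n) {} E" "y \<in> cube n"
  shows "unrec v n {} ((cube n - {{}}) \<inter> graph_map n y -` E)"
proof -
  obtain c where c: "c \<in> RM v (Suc n)" "c {}" "\<And>x. c x \<Longrightarrow> x = {} \<or> x \<in> E"
    using assms(1) by (auto simp: unrec_def)
  have "(\<lambda>x. x \<in> cube n \<and> c (graph_map n y x)) \<in> RM v n"
    using assms(2) by (intro RM_pullback[OF c(1)]) (simp_all only: graph_map_sd graph_map_in_cube)
  moreover have "graph_map n y {} = {}" by (simp add: graph_map_def dot_def)
  moreover have "x = {} \<or> x \<in> (cube n - {{}}) \<inter> graph_map n y -` E"
    if "x \<in> cube n" "c (graph_map n y x)" for x
    using c(3)[OF that(2)] that(1) by (auto simp: graph_map_def split: if_splits)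
  ultimately show ?thesis
    unfolding unrec_def using c(2)
    by (intro bexI[of _ "\<lambda>x. x \<in> cube n \<and> c (graph_map n y x)"]) auto
qed

lemma unrec_restrict:
  assumes "unrec v (Suc n) {} E"
  shows "unrec v n {} (E \<inter> (cube n - {{}}))"
proof -
  have "graph_map n {} -` E = E" by (auto simp: graph_map_def dot_def)
  then show ?thesis using unrec_graph[OF assms, of "{}"] by (simp add: Int_commute)
qed

context
  fixes p :: real
  assumes p: "0 < p" "p < 1"
begin

text \<open>If bit \<open>{}\<close> of the longer code cannot be recovered then it cannot be recovered inside either
  of two hyperplanes \<open>A = cube n\<close> and \<open>B\<close> (the graph of the functional \<open>y\<close>). The Fourier
  coefficients common to these two looks are those supported on \<open>A \<inter> B\<close>.\<close>

lemma two_looks: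
  assumes "y \<in> cube n"
    and a: "\<And>E. E \<subseteq> cube n - {{}} \<Longrightarrow>
      of_bool (unrec v n {} E) = (\<Sum>S\<in>Pow (cube n - {{}}). a S * chi p S E)"
  shows "exit_fun v (Suc n) p \<le> (\<Sum>S\<in>{S \<in> Pow (cube n - {{}}). \<forall>s\<in>S. \<not> dot s y}. (a S)\<^sup>2)"
proof -
  define I where "I = cube n - {{}}"
  define I' where "I' = cube (Suc n) - {{}}"
  define g where "g = graph_map n y"
  have finI: "finite I" "finite I'" by (auto simp: I_def I'_def)
  have II: "I \<subseteq> I'" by (auto simp: I_def I'_def lessThan_Suc)
  have inj: "inj_on g I"
    by (rule inj_on_inverseI[where g = "\<lambda>x. x \<inter> {..<n}"])
      (auto simp: g_def I_def graph_map_restrict simp del: Pow_iff)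
  have gI: "g x \<in> I'" if "x \<in> I" for x
    using that graph_map_in_cube[of x n y] by (auto simp: g_def I_def I'_def graph_map_def split: if_splits)
  \<comment> \<open>The second look has the same coefficients as the first, carried along
    \<open>g\<close> to the positions in \<open>B\<close>.\<close>
  define b where "b U = a (I \<inter> g -` U)" for U
  define B where "B = (`) g ` Pow I"
  have preimage: "I \<inter> g -` g ` T = T" if "T \<subseteq> I" for T
    using that inj by (auto simp: inj_on_def)
  have f1: "of_bool (unrec v n {} (E \<inter> I)) = (\<Sum>S\<in>Pow I. a S * chi p S E)" for E
  proof -
    have "of_bool (unrec v n {} (E \<inter> I)) = (\<Sum>S\<in>Pow I. a S * chi p S (E \<inter> I))"
      using a[of "E \<inter> I"] by (simp add: I_def)
    also have "\<dots> = (\<Sum>S\<in>Pow I. a S * chi p S E)"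
      by (intro sum.cong refl arg_cong2[where f = "(*)"]) (auto simp: chi_def intro!: prod.cong)
    finally show ?thesis .
  qed
  have f2: "of_bool (unrec v n {} (I \<inter> g -` E)) = (\<Sum>U\<in>B. b U * chi p U E)" for E
  proof -
    have "of_bool (unrec v n {} (I \<inter> g -` E)) = (\<Sum>S\<in>Pow I. a S * chi p S (I \<inter> g -` E))"
      using a[of "I \<inter> g -` E"] by (simp add: I_def)
    also have "\<dots> = (\<Sum>S\<in>Pow I. b (g ` S) * chi p (g ` S) E)"
    proof (intro sum.cong refl)
      fix S assume S: "S \<in> Pow I"
      have "inj_on g S" using inj S by (auto intro: inj_on_subset)
      then have "chi p (g ` S) E = chi p S (I \<inter> g -` E)"
        unfolding chi_def using S by (subst prod.reindex) (auto intro!: prod.cong)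
      then show "a S * chi p S (I \<inter> g -` E) = b (g ` S) * chi p (g ` S) E"
        using preimage[of S] S by (simp add: b_def)
    qed
    also have "\<dots> = (\<Sum>U\<in>B. b U * chi p U E)"
      unfolding B_def using inj_on_image_Pow[OF inj] by (subst sum.reindex) auto
    finally show ?thesis .
  qed
  have "exit_fun v (Suc n) p = EP I' p (\<lambda>E. of_bool (unrec v (Suc n) {} E))"
    by (simp add: exit_fun_def I'_def)
  also have "\<dots> \<le> EP I' p (\<lambda>E. of_bool (unrec v n {} (E \<inter> I)) * of_bool (unrec v n {} (I \<inter> g -` E)))"
    using p unrec_restrict unrec_graph[OF _ assms(1)] by (intro EP_mono) (auto simp: I_def g_def)
  also have "\<dots> = EP I' p (\<lambda>E. (\<Sum>S\<in>Pow I. a S * chi p S E) * (\<Sum>U\<in>B. b U * chi p U E))"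
    unfolding f1 f2 ..
  also have "\<dots> = (\<Sum>S\<in>Pow I \<inter> B. a S * b S)"
    using II gI by (intro chi_inner[OF p finI(2)]) (auto simp: B_def)
  also have "\<dots> = (\<Sum>S\<in>{S \<in> Pow I. \<forall>s\<in>S. \<not> dot s y}. (a S)\<^sup>2)"
  proof (rule sum.cong)
    \<comment> \<open>The embedding fixes the points orthogonal to \<open>y\<close> and moves all
      others out of \<open>cube n\<close>, so a set occurs in both expansions exactly when
      \<open>y\<close> annihilates it, and then with the same coefficient.\<close>
    have fixed: "g s = s" if "\<not> dot s y" for s using that by (simp add: g_def graph_map_def)
    have notin: "g s \<notin> I" if "dot s y" for s using that by (auto simp: g_def graph_map_def I_def)
    show "Pow I \<inter> B = {S \<in> Pow I. \<forall>s\<in>S. \<not> dot s y}"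
    proof (intro equalityI subsetI)
      fix S assume "S \<in> Pow I \<inter> B"
      then obtain T where T: "S \<subseteq> I" "T \<subseteq> I" "S = g ` T" by (auto simp: B_def)
      then have nd: "\<not> dot t y" if "t \<in> T" for t using notin[of t] that by auto
      then have "S = T" using T(3) fixed by (auto simp: image_iff)
      then show "S \<in> {S \<in> Pow I. \<forall>s\<in>S. \<not> dot s y}" using T nd by auto
    next
      fix S assume S: "S \<in> {S \<in> Pow I. \<forall>s\<in>S. \<not> dot s y}"
      then have "g ` S = S" using fixed by (auto simp: image_iff)
      then show "S \<in> Pow I \<inter> B" using S by (auto simp: B_def image_iff)
    qed
    fix S assume S: "S \<in> {S \<in> Pow I. \<forall>s\<in>S. \<not> dot s y}"
    then have "g ` S = S" using fixed by (auto simp: image_iff)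
    then have "b S = a S" using preimage[of S] S by (simp add: b_def)
    then show "a S * b S = (a S)\<^sup>2" by (simp add: power2_eq_square)
  qed
  finally show ?thesis by (simp add: I_def)
qed

text \<open>The sum of squares is the mean because the function is 0/1-valued. Averaging
  \<open>two_looks\<close> over all \<open>y\<close> keeps the term of \<open>S\<close> only for the
  annihilating \<open>y\<close>, a fraction of at most \<open>1 / (card S + 1)\<close>.\<close>

lemma exit_fun_expansion:
  obtains a where
    "\<And>E. E \<subseteq> cube n - {{}} \<Longrightarrow>
      of_bool (unrec v n {} E) = (\<Sum>S\<in>Pow (cube n - {{}}). a S * chi p S E)"
    "(\<Sum>S\<in>Pow (cube n - {{}}). (a S)\<^sup>2) = exit_fun v n p"
    "exit_fun v (Suc n) p \<le> (\<Sum>S\<in>Pow (cube n - {{}}). (a S)\<^sup>2 / (real (card S) + 1))"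
proof -
  define I where "I = cube n - {{}}"
  have finI: "finite I" by (simp add: I_def)
  obtain a where a: "\<And>E. E \<subseteq> I \<Longrightarrow> of_bool (unrec v n {} E) = (\<Sum>S\<in>Pow I. a S * chi p S E)"
    using chi_expansion[OF p finI, of "\<lambda>E. of_bool (unrec v n {} E)"] by auto
  have "(\<Sum>S\<in>Pow I. (a S)\<^sup>2) = EP I p (\<lambda>E. (\<Sum>S\<in>Pow I. a S * chi p S E) * (\<Sum>S\<in>Pow I. a S * chi p S E))"
    using chi_inner[OF p finI, of "Pow I" "Pow I" a a] by (simp add: power2_eq_square)
  also have "\<dots> = EP I p (\<lambda>E. of_bool (unrec v n {} E))"
    by (intro EP_cong) (simp add: a[symmetric])
  finally have 1: "(\<Sum>S\<in>Pow I. (a S)\<^sup>2) = exit_fun v n p" by (simp add: exit_fun_def I_def)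
  have "2 ^ n * exit_fun v (Suc n) p = (\<Sum>y\<in>cube n. exit_fun v (Suc n) p)" by simp
  also have "\<dots> \<le> (\<Sum>y\<in>cube n. \<Sum>S\<in>{S \<in> Pow I. \<forall>s\<in>S. \<not> dot s y}. (a S)\<^sup>2)"
    using a by (intro sum_mono) (auto simp: I_def intro!: two_looks simp del: Pow_iff)
  also have "\<dots> = (\<Sum>y\<in>cube n. \<Sum>S\<in>Pow I. if \<forall>s\<in>S. \<not> dot s y then (a S)\<^sup>2 else 0)"
    using finI by (intro sum.cong refl sum.inter_filter) auto
  also have "\<dots> = (\<Sum>S\<in>Pow I. \<Sum>y\<in>cube n. if \<forall>s\<in>S. \<not> dot s y then (a S)\<^sup>2 else 0)"
    by (rule sum.swap)
  also have "\<dots> = (\<Sum>S\<in>Pow I. \<Sum>y\<in>{y \<in> cube n. \<forall>s\<in>S. \<not> dot s y}. (a S)\<^sup>2)"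
    by (intro sum.cong refl sum.inter_filter[symmetric]) auto
  also have "\<dots> \<le> (\<Sum>S\<in>Pow I. 2 ^ n * ((a S)\<^sup>2 / (real (card S) + 1)))"
  proof (rule sum_mono)
    fix S assume S: "S \<in> Pow I"
    have "real (card {y \<in> cube n. \<forall>s\<in>S. \<not> dot s y}) \<le> 2 ^ n / (real (card S) + 1)"
      using card_annihilator[of S n] S by (simp add: I_def pos_le_divide_eq)
    then have "real (card {y \<in> cube n. \<forall>s\<in>S. \<not> dot s y}) * (a S)\<^sup>2 \<le> 2 ^ n / (real (card S) + 1) * (a S)\<^sup>2"
      by (rule mult_right_mono) simp
    then show "(\<Sum>y\<in>{y \<in> cube n. \<forall>s\<in>S. \<not> dot s y}. (a S)\<^sup>2) \<le> 2 ^ n * ((a S)\<^sup>2 / (real (card S) + 1))"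
      by simp
  qed
  finally have "2 ^ n * exit_fun v (Suc n) p \<le> 2 ^ n * (\<Sum>S\<in>Pow I. (a S)\<^sup>2 / (real (card S) + 1))"
    by (simp add: sum_distrib_left)
  then have 2: "exit_fun v (Suc n) p \<le> (\<Sum>S\<in>Pow I. (a S)\<^sup>2 / (real (card S) + 1))" by simp
  show ?thesis by (rule that[of a]) (use a 1 2 in \<open>auto simp: I_def\<close>)
qed

text \<open>Sets of size at most \<open>r\<close> have denominator at least 1, larger ones at least
  \<open>r + 2\<close>. The resulting bound grows with the low weight, so that weight may be
  replaced by \<open>W\<close>.\<close>

lemma exit_fun_split:
  fixes P :: "'a set set"
  assumes nonneg: "\<And>S. S \<in> P \<Longrightarrow> 0 \<le> b S" and "finite P"
    and low: "(\<Sum>S\<in>{S \<in> P. card S \<le> r}. b S) \<le> (W::real)"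
  shows "(\<Sum>S\<in>P. b S / (real (card S) + 1)) \<le> W + ((\<Sum>S\<in>P. b S) - W) / (real r + 2)"
proof -
  have split: "(\<Sum>S\<in>P. g S) = (\<Sum>S\<in>{S \<in> P. card S \<le> r}. g S) + (\<Sum>S\<in>{S \<in> P. \<not> card S \<le> r}. g S)"
    for g :: "'a set \<Rightarrow> real"
    using assms(2) by (subst sum.union_disjoint[symmetric]) (auto intro!: sum.cong)
  define X where "X = (\<Sum>S\<in>{S \<in> P. card S \<le> r}. b S)"
  define Y where "Y = (\<Sum>S\<in>{S \<in> P. \<not> card S \<le> r}. b S)"
  have "(\<Sum>S\<in>{S \<in> P. card S \<le> r}. b S / (real (card S) + 1)) \<le> X"
    unfolding X_def
  proof (rule sum_mono)
    fix S assume "S \<in> {S \<in> P. card S \<le> r}"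
    then have "b S / (real (card S) + 1) \<le> b S / 1" using nonneg by (intro divide_left_mono) auto
    then show "b S / (real (card S) + 1) \<le> b S" by simp
  qed
  moreover have "(\<Sum>S\<in>{S \<in> P. \<not> card S \<le> r}. b S / (real (card S) + 1)) \<le> Y / (real r + 2)"
    unfolding Y_def sum_divide_distrib using nonneg by (intro sum_mono divide_left_mono) auto
  ultimately have "(\<Sum>S\<in>P. b S / (real (card S) + 1)) \<le> X + Y / (real r + 2)"
    unfolding split[of "\<lambda>S. b S / (real (card S) + 1)"] by linarith
  also have "\<dots> \<le> W + (X + Y - W) / (real r + 2)"
  proof -
    have "0 \<le> (W - X) * (1 - 1 / (real r + 2))" using low by (intro mult_nonneg_nonneg) (auto simp: X_def)
    then show ?thesis by (simp add: algebra_simps diff_divide_distrib add_divide_distrib)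
  qed
  also have "X + Y = (\<Sum>S\<in>P. b S)" unfolding X_def Y_def split[of b] ..
  finally show ?thesis .
qed

lemma exit_fun_bounds: "0 \<le> exit_fun v n p" "exit_fun v n p \<le> 1"
proof -
  show "0 \<le> exit_fun v n p" unfolding exit_fun_def using p by (intro EP_nonneg) auto
  have "exit_fun v n p \<le> EP (cube n - {{}}) p (\<lambda>E. 1)"
    unfolding exit_fun_def using p by (intro EP_mono) auto
  then show "exit_fun v n p \<le> 1" by (simp add: EP_const)
qed

text \<open>The case \<open>r = 0\<close>: the only low set is empty, and its coefficient is the
  mean, so its weight is the square of \<open>exit_fun v n p\<close>.\<close>

lemma exit_fun_step:
  "exit_fun v (Suc n) p \<le> exit_fun v n p * (1 + exit_fun v n p) / 2"
proof -
  define I where "I = cube n - {{}}"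
  obtain a where a: "\<And>E. E \<subseteq> I \<Longrightarrow> of_bool (unrec v n {} E) = (\<Sum>S\<in>Pow I. a S * chi p S E)"
    "(\<Sum>S\<in>Pow I. (a S)\<^sup>2) = exit_fun v n p"
    "exit_fun v (Suc n) p \<le> (\<Sum>S\<in>Pow I. (a S)\<^sup>2 / (real (card S) + 1))"
    using exit_fun_expansion unfolding I_def by blast
  have finI: "finite I" by (simp add: I_def)
  have "a {} = exit_fun v n p"
  proof -
    have "exit_fun v n p = EP I p (\<lambda>E. (\<Sum>S\<in>Pow I. a S * chi p S E) * (\<Sum>S\<in>{{}}. 1 * chi p S E))"
      unfolding exit_fun_def I_def[symmetric] by (intro EP_cong) (simp add: a(1) chi_def)
    also have "\<dots> = (\<Sum>S\<in>Pow I \<inter> {{}}. a S * 1)"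
      by (rule chi_inner[OF p finI]) auto
    finally show ?thesis by simp
  qed
  then have "(\<Sum>S\<in>{S \<in> Pow I. card S \<le> 0}. (a S)\<^sup>2) \<le> (exit_fun v n p)\<^sup>2"
    unfolding low_degree_zero[OF p finI] by simp
  from exit_fun_split[OF _ _ this] finI a(2,3)
  have "exit_fun v (Suc n) p \<le> (exit_fun v n p)\<^sup>2 + (exit_fun v n p - (exit_fun v n p)\<^sup>2) / 2" by simp
  then show ?thesis by (simp add: power2_eq_square field_simps)
qed

lemma exit_fun_decreasing: "exit_fun v (Suc n) p \<le> exit_fun v n p"
proof -
  have "exit_fun v n p * (1 + exit_fun v n p) \<le> exit_fun v n p * 2"
    using exit_fun_bounds by (intro mult_left_mono) auto
  then show ?thesis using exit_fun_step[of v n] by simp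
qed

text \<open>Here \<open>low_degree_weight\<close> bounds the weight up to degree \<open>r\<close>.
  The gain is close to \<open>r + 1\<close> once \<open>exit_fun\<close> is far below
  \<open>hyper_const p\<close> to the power \<open>- 2 * r\<close>.\<close>

lemma exit_fun_hyper_step:
  "exit_fun v (Suc n) p \<le>
    exit_fun v n p * (hyper_const p ^ r * sqrt (exit_fun v n p) + 1 / (real r + 1))"
proof -
  define I where "I = cube n - {{}}"
  define h where "h = exit_fun v n p"
  have h: "h \<ge> 0" using exit_fun_bounds by (simp add: h_def)
  obtain a where a: "\<And>E. E \<subseteq> I \<Longrightarrow> of_bool (unrec v n {} E) = (\<Sum>S\<in>Pow I. a S * chi p S E)"
    "(\<Sum>S\<in>Pow I. (a S)\<^sup>2) = h"
    "exit_fun v (Suc n) p \<le> (\<Sum>S\<in>Pow I. (a S)\<^sup>2 / (real (card S) + 1))"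
    using exit_fun_expansion unfolding I_def h_def by blast
  have finI: "finite I" by (simp add: I_def)
  have W: "0 \<le> h * (hyper_const p ^ r * sqrt h)" using h hyper_const_ge[OF p] by simp
  have "(\<Sum>S\<in>{S \<in> Pow I. card S \<le> r}. (a S)\<^sup>2)\<^sup>2 \<le> hyper_const p ^ (2 * r) * h ^ 3"
  proof -
    have "EP I p (\<lambda>E. of_bool (unrec v n {} E)) = h" by (simp add: h_def exit_fun_def I_def)
    moreover have "(\<Sum>S\<in>{S \<in> Pow I. card S \<le> r}. (a S)\<^sup>2)\<^sup>2 \<le>
        hyper_const p ^ (2 * r) * EP I p (\<lambda>E. of_bool (unrec v n {} E)) ^ 3"
      by (rule low_degree_weight[OF p finI _ a(1)]) simp
    ultimately show ?thesis by (simp only:)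
  qed
  also have "hyper_const p ^ (2 * r) = (hyper_const p ^ r)\<^sup>2"
    by (simp add: mult.commute flip: power_mult)
  also have "(hyper_const p ^ r)\<^sup>2 * h ^ 3 = (h * (hyper_const p ^ r * sqrt h))\<^sup>2"
    unfolding power_mult_distrib real_sqrt_pow2[OF h] by (simp add: power2_eq_square power3_eq_cube)
  finally have low: "(\<Sum>S\<in>{S \<in> Pow I. card S \<le> r}. (a S)\<^sup>2) \<le> h * (hyper_const p ^ r * sqrt h)"
    using W by (rule power2_le_imp_le)
  have "exit_fun v (Suc n) p \<le> h * (hyper_const p ^ r * sqrt h) +
      (h - h * (hyper_const p ^ r * sqrt h)) / (real r + 2)"
    using exit_fun_split[OF _ _ low] finI a(2,3) by simp
  also have "(h - h * (hyper_const p ^ r * sqrt h)) / (real r + 2) \<le> h / (real r + 1)"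
    using W h by (intro frac_le) auto
  finally show ?thesis by (simp add: h_def algebra_simps)
qed

end

section \<open>The area theorem and the sharp threshold\<close>

lemma EP_0: "finite I \<Longrightarrow> EP I 0 \<phi> = \<phi> {}"
  by (induction I arbitrary: \<phi> rule: finite_induct) (simp_all add: EP_insert)

lemma EP_1: "finite I \<Longrightarrow> EP I 1 \<phi> = \<phi> I"
  by (induction I arbitrary: \<phi> rule: finite_induct) (simp_all add: EP_insert)

definition subcode :: "nat \<Rightarrow> nat \<Rightarrow> nat set set \<Rightarrow> (nat set \<Rightarrow> bool) set" where
  "subcode v n E = {c \<in> RM v n. \<forall>x. c x \<longrightarrow> x \<in> E}"

lemma finite_subcode [simp]: "finite (subcode v n E)"
  by (simp add: subcode_def)

lemma zero_in_subcode: "(\<lambda>x. False) \<in> subcode v n E"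
  by (simp add: subcode_def RM_zero)

lemma card_subcode_pos: "card (subcode v n E) > 0"
  using zero_in_subcode[of v n E] by (auto simp: card_gt_0_iff)

text \<open>If some admissible codeword is one at \<open>i\<close>, then adding it exchanges the
  codewords that are one at \<open>i\<close> with those that are zero there; otherwise nothing is
  gained.\<close>

lemma card_subcode_insert:
  assumes "i \<notin> E"
  shows "card (subcode v n (insert i E)) = (if unrec v n i E then 2 else 1) * card (subcode v n E)"
proof (cases "unrec v n i E")
  case False
  have "\<not> c i" if "c \<in> subcode v n (insert i E)" for c
    using False that unfolding unrec_def subcode_def by blast
  then have "subcode v n (insert i E) = subcode v n E"
    unfolding subcode_def by blast
  then show ?thesis using False by simp
next
  case True
  then obtain c0 where c0: "c0 \<in> RM v n" "c0 i" "\<And>x. c0 x \<Longrightarrow> x = i \<or> x \<in> E"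
    unfolding unrec_def by blast
  define s where "s c x = (c x \<longleftrightarrow> \<not> c0 x)" for c x
  have ss: "s (s c) = c" for c by (auto simp: s_def)
  have sRM: "s c \<in> RM v n" if "c \<in> RM v n" for c
    using RM_xor[OF that c0(1)] by (simp add: s_def[abs_def])
  have "subcode v n (insert i E) = subcode v n E \<union> s ` subcode v n E"
  proof (intro equalityI subsetI)
    fix c assume c: "c \<in> subcode v n (insert i E)"
    show "c \<in> subcode v n E \<union> s ` subcode v n E"
    proof (cases "c i")
      case True
      have "x \<in> E" if "s c x" for x
      proof -
        have "x \<noteq> i" using that True c0(2) by (auto simp: s_def)
        moreover have "c x \<or> c0 x" using that by (auto simp: s_def)
        ultimately show ?thesis using c c0(3) by (auto simp: subcode_def)
      qed
      then have "s c \<in> subcode v n E" using c sRM by (auto simp: subcode_def)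
      then have "s (s c) \<in> s ` subcode v n E" by (rule imageI)
      then show ?thesis by (simp add: ss)
    next
      case False
      then have "c \<in> subcode v n E" using c unfolding subcode_def by blast
      then show ?thesis ..
    qed
  next
    fix c assume "c \<in> subcode v n E \<union> s ` subcode v n E"
    then show "c \<in> subcode v n (insert i E)"
    proof
      assume "c \<in> s ` subcode v n E"
      then obtain d where d: "d \<in> subcode v n E" "c = s d" by blast
      have "x \<in> insert i E" if "c x" for x
      proof -
        have "d x \<or> c0 x" using that d(2) by (auto simp: s_def)
        then show ?thesis using d(1) c0(3) by (auto simp: subcode_def)
      qed
      then show ?thesis using d sRM by (auto simp: subcode_def)
    qed (auto simp: subcode_def)
  qed
  moreover have "subcode v n E \<inter> s ` subcode v n E = {}"
  proof -
    have "\<not> c i" if "c \<in> subcode v n E" for c using that assms by (auto simp: subcode_def)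
    moreover have "s c i" if "c \<in> subcode v n E" for c
      using calculation[OF that] c0(2) by (simp add: s_def)
    ultimately show ?thesis by blast
  qed
  moreover have "inj_on s (subcode v n E)" by (rule inj_on_inverseI[where g = s]) (rule ss)
  ultimately have "card (subcode v n (insert i E)) = card (subcode v n E) + card (subcode v n E)"
    by (simp add: card_Un_disjoint card_image)
  then show ?thesis using True by simp
qed

text \<open>The conditional entropy of the codeword given the received word, divided by the length.\<close>

definition ambiguity :: "nat \<Rightarrow> nat \<Rightarrow> real \<Rightarrow> real" where
  "ambiguity v n p = EP (cube n) p (\<lambda>E. log 2 (real (card (subcode v n E)))) / 2 ^ n"

lemma ambiguity_0: "ambiguity v n 0 = 0"
proof -
  have "subcode v n {} = {\<lambda>x. False}" using zero_in_subcode[of v n "{}"] by (auto simp: subcode_def)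
  then show ?thesis by (simp add: ambiguity_def EP_0)
qed

lemma ambiguity_1: "ambiguity v n 1 = rm_rate v n"
proof -
  have "subcode v n (cube n) = RM v n" using RM_outside unfolding subcode_def by blast
  then have "ambiguity v n 1 = log 2 (real (card (RM v n))) / 2 ^ n"
    by (simp add: ambiguity_def EP_1)
  also have "real (card (RM v n)) = 2 powr real (\<Sum>k\<le>v. n choose k)"
    by (subst card_RM) (simp only: powr_realpow of_nat_power of_nat_numeral zero_less_numeral)
  finally show ?thesis by (simp only: log_powr_cancel) (simp add: rm_rate_def)
qed

text \<open>The area theorem in differential form. In the Margulis-Russo formula, adjoining
  \<open>i\<close> raises the logarithm by one exactly when bit \<open>i\<close> is unrecoverable,
  and all \<open>2 ^ n\<close> positions contribute equally.\<close>

lemma ambiguity_has_derivative: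
  "(ambiguity v n has_real_derivative exit_fun v n p) (at p)"
proof -
  let ?d = "\<lambda>E. log 2 (real (card (subcode v n E)))"
  have "EP (cube n - {i}) p (\<lambda>E. ?d (insert i E) - ?d E) = exit_fun v n p" if i: "i \<in> cube n" for i
  proof -
    have "EP (cube n - {i}) p (\<lambda>E. ?d (insert i E) - ?d E) =
        EP (cube n - {i}) p (\<lambda>E. of_bool (unrec v n i E))"
    proof (rule EP_cong)
      fix E assume "E \<subseteq> cube n - {i}"
      then have "i \<notin> E" by blast
      have "log 2 (real (k * q)) - log 2 (real q) = log 2 (real k)" if "k > 0" "q > 0" for k q :: nat
        using that by (simp add: log_mult)
      from this[OF _ card_subcode_pos[of v n E], of "if unrec v n i E then 2 else 1"]
      show "?d (insert i E) - ?d E = of_bool (unrec v n i E)"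
        unfolding card_subcode_insert[OF \<open>i \<notin> E\<close>] by (cases "unrec v n i E") simp_all
    qed
    then show ?thesis using EP_unrec[OF i] by simp
  qed
  then have "(\<Sum>i\<in>cube n. EP (cube n - {i}) p (\<lambda>E. ?d (insert i E) - ?d E)) = 2 ^ n * exit_fun v n p"
    by simp
  then have "((\<lambda>p. EP (cube n) p ?d) has_real_derivative 2 ^ n * exit_fun v n p) (at p)"
    using EP_has_derivative[of "cube n" ?d p] by (simp only: finite_Pow_iff finite_lessThan)
  from DERIV_cdivide[OF this, of "2 ^ n"] show ?thesis
    by (simp add: ambiguity_def[abs_def])
qed

lemma exit_fun_mono:
  assumes "0 \<le> p" "p \<le> q" "q \<le> 1"
  shows "exit_fun v n p \<le> exit_fun v n q"
  unfolding exit_fun_def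
proof (rule EP_mono_p[OF _ assms])
  fix i E
  show "(of_bool (unrec v n {} E) :: real) \<le> of_bool (unrec v n {} (insert i E))"
    using unrec_mono[of E "insert i E" v n "{}"] by auto
qed simp

text \<open>The sign is required only in the interior because the Fourier estimates are stated for
  \<open>0 < p < 1\<close>, while the area theorem uses both endpoints.\<close>

lemma nondecreasing_if_deriv_nonneg:
  fixes f :: "real \<Rightarrow> real"
  assumes "a \<le> b" "\<And>x. (f has_real_derivative f' x) (at x)" "\<And>x. a < x \<Longrightarrow> x < b \<Longrightarrow> 0 \<le> f' x"
  shows "f a \<le> f b"
proof (cases "a = b")
  case False
  then have "a < b" using assms(1) by simp
  then obtain z where "a < z" "z < b" "f b - f a = (b - a) * f' z"
    using MVT2[of a b f f'] assms(2) by blast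
  then show ?thesis using assms(1) assms(3)[of z] mult_nonneg_nonneg[of "b - a" "f' z"] by linarith
qed simp

text \<open>Integrate \<open>h (1 - h) \<le> 2 (h - h')\<close> from \<open>p\<close> to 1, where
  \<open>h\<close> and \<open>h'\<close> belong to lengths \<open>n\<close> and
  \<open>n + 1\<close>, after lowering the first factor to its value at \<open>p\<close>. By the
  area theorem the right side is at most twice the loss of rate, and the integral of
  \<open>1 - h\<close> is at least \<open>1 - p\<close> minus the rate.\<close>

theorem exit_fun_threshold:
  assumes "0 < p" "p < 1"
  shows "exit_fun v n p * (1 - rm_rate v n - p) \<le> real (n choose v) / 2 ^ n"
proof -
  define a where "a = exit_fun v n p"
  \<comment> \<open>\<open>\<Phi>\<close> is an antiderivative of the difference of the two sides;
    \<open>\<Psi>\<close> serves to discard the part of the rate loss that comes from below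
    \<open>p\<close>.\<close>
  define \<Phi> where "\<Phi> q = 2 * (ambiguity v n q - ambiguity v (Suc n) q) - a * (q - ambiguity v n q)" for q
  define \<Psi> where "\<Psi> q = ambiguity v n q - ambiguity v (Suc n) q" for q
  have "\<Phi> p \<le> \<Phi> 1"
  proof (rule nondecreasing_if_deriv_nonneg[OF less_imp_le[OF assms(2)]])
    fix q
    show "(\<Phi> has_real_derivative 2 * (exit_fun v n q - exit_fun v (Suc n) q) - a * (1 - exit_fun v n q)) (at q)"
      unfolding \<Phi>_def[abs_def]
      by (intro DERIV_diff DERIV_cmult DERIV_ident ambiguity_has_derivative)
    assume q: "p < q" "q < 1"
    define h where "h = exit_fun v n q"
    have h: "a \<le> h" "h \<le> 1" "exit_fun v (Suc n) q \<le> h * (1 + h) / 2"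
      using exit_fun_mono[of p q v n] exit_fun_bounds(2)[of q v n] exit_fun_step[of q v n] assms q
      by (auto simp: a_def h_def)
    have "a * (1 - h) \<le> h * (1 - h)" using h by (intro mult_right_mono) auto
    also have "\<dots> = 2 * (h - h * (1 + h) / 2)" by (simp add: algebra_simps)
    also have "\<dots> \<le> 2 * (h - exit_fun v (Suc n) q)" using h by simp
    finally show "0 \<le> 2 * (exit_fun v n q - exit_fun v (Suc n) q) - a * (1 - exit_fun v n q)"
      unfolding h_def by simp
  qed
  moreover have "\<Psi> 0 \<le> \<Psi> p"
  proof (rule nondecreasing_if_deriv_nonneg[OF less_imp_le[OF assms(1)]])
    fix q
    show "(\<Psi> has_real_derivative exit_fun v n q - exit_fun v (Suc n) q) (at q)"
      unfolding \<Psi>_def[abs_def] by (intro DERIV_diff ambiguity_has_derivative)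
    assume q: "0 < q" "q < p"
    then show "0 \<le> exit_fun v n q - exit_fun v (Suc n) q"
      using exit_fun_decreasing[of q v n] assms by auto
  qed
  moreover have "ambiguity v n 0 \<le> ambiguity v n p"
  proof (rule nondecreasing_if_deriv_nonneg[OF less_imp_le[OF assms(1)] ambiguity_has_derivative])
    fix q assume q: "0 < q" "q < p"
    then show "0 \<le> exit_fun v n q" using exit_fun_bounds(1)[of q v n] assms by auto
  qed
  moreover have "a \<ge> 0" using exit_fun_bounds(1)[OF assms] by (simp add: a_def)
  ultimately have "a * (1 - rm_rate v n) - 2 * (rm_rate v n - rm_rate v (Suc n)) \<le> a * p"
  proof -
    assume *: "\<Phi> p \<le> \<Phi> 1" "\<Psi> 0 \<le> \<Psi> p" "ambiguity v n 0 \<le> ambiguity v n p" "a \<ge> 0"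
    have "- (a * p) \<le> \<Phi> p"
    proof -
      have "0 \<le> a * ambiguity v n p" using *(3,4) by (simp add: ambiguity_0)
      then show ?thesis using *(2) by (simp add: \<Phi>_def \<Psi>_def ambiguity_0 algebra_simps)
    qed
    then show ?thesis using *(1) by (simp add: \<Phi>_def ambiguity_1)
  qed
  then show ?thesis
    unfolding rm_rate_Suc a_def by (simp add: algebra_simps)
qed

section \<open>From block failure to unrecoverable bits\<close>

lemma PB_eq:
  "PB v m p = EP (cube m) p (\<lambda>E. of_bool (\<exists>c\<in>RM v m. (\<exists>x. c x) \<and> supp m c \<subseteq> E))"
proof -
  define fail where "fail E \<longleftrightarrow> (\<exists>c\<in>RM v m. (\<exists>x. c x) \<and> supp m c \<subseteq> E)" for E
  \<comment> \<open>Linearity: subtracting \<open>X\<close> turns a competing codeword into a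
    nonzero codeword on the erased positions, so failure does not depend on the transmitted
    word.\<close>
  have fail: "(\<exists>X'\<in>RM v m. X' \<noteq> X \<and> (\<forall>i\<in>cube m - E. X' i = X i)) \<longleftrightarrow> fail E" if X: "X \<in> RM v m" for X E
  proof
    assume "\<exists>X'\<in>RM v m. X' \<noteq> X \<and> (\<forall>i\<in>cube m - E. X' i = X i)"
    then obtain X' where X': "X' \<in> RM v m" "X' \<noteq> X" "\<forall>i\<in>cube m - E. X' i = X i"
      by (elim bexE conjE) (rule that)
    have "\<exists>x. X' x \<longleftrightarrow> \<not> X x" using X'(2) unfolding fun_eq_iff not_all by (elim exE, intro exI, simp)
    moreover have "supp m (\<lambda>x. X' x \<longleftrightarrow> \<not> X x) \<subseteq> E"
    proof
      fix x assume "x \<in> supp m (\<lambda>x. X' x \<longleftrightarrow> \<not> X x)"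
      then have "x \<in> cube m" "X' x \<noteq> X x" by simp_all
      then show "x \<in> E" using bspec[OF X'(3), of x] by (cases "x \<in> E") simp_all
    qed
    ultimately show "fail E" unfolding fail_def by (intro bexI[OF _ RM_xor[OF X'(1) X]] conjI)
  next
    assume "fail E"
    then obtain c x where c: "c \<in> RM v m" "c x" "supp m c \<subseteq> E"
      unfolding fail_def by (elim bexE exE conjE) (rule that)
    define X' where "X' = (\<lambda>x. X x \<longleftrightarrow> \<not> c x)"
    have "X' \<in> RM v m" unfolding X'_def by (rule RM_xor[OF X c(1)])
    moreover have "X' \<noteq> X"
    proof
      assume "X' = X"
      then have "X' x = X x" by (rule arg_cong)
      then show False using c(2) by (simp add: X'_def)
    qed
    moreover have "X' i = X i" if "i \<in> cube m - E" for i
    proof -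
      have "\<not> c i" using c(3) that by blast
      then show ?thesis by (simp add: X'_def)
    qed
    ultimately show "\<exists>X'\<in>RM v m. X' \<noteq> X \<and> (\<forall>i\<in>cube m - E. X' i = X i)"
      by (intro bexI[of _ X'] conjI ballI)
  qed
  have "PB v m p = (\<Sum>X\<in>RM v m. (1 / real (card (RM v m))) * EP (cube m) p (\<lambda>E. of_bool (fail E)))"
    unfolding PB_def
  proof (intro sum.cong refl arg_cong2[where f = "(*)"])
    fix X assume X: "X \<in> RM v m"
    show "(\<Sum>E\<in>Pow (Pow {..<m}). p ^ card E * (1 - p) ^ (2 ^ m - card E) *
        (if \<exists>X'\<in>RM v m. X' \<noteq> X \<and> (\<forall>i\<in>Pow {..<m} - E. X' i = X i) then 1 else 0)) =
        EP (cube m) p (\<lambda>E. of_bool (fail E))"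
      unfolding EP_def fail[OF X]
    proof (intro sum.cong refl)
      fix E assume "E \<in> Pow (cube m)"
      then have "card (cube m - E) = 2 ^ m - card E"
        by (subst card_Diff_subset) (auto intro: finite_subset[of E "cube m"])
      then show "p ^ card E * (1 - p) ^ (2 ^ m - card E) * (if fail E then 1 else 0) =
          p ^ card E * (1 - p) ^ card (cube m - E) * of_bool (fail E)" by simp
    qed
  qed
  also have "\<dots> = EP (cube m) p (\<lambda>E. of_bool (fail E))"
    using card_RM[of v m] by simp
  finally show ?thesis unfolding fail_def .
qed

text \<open>A codeword of weight at least \<open>M\<close> inside the erasure pattern makes at least
  \<open>M\<close> bits unrecoverable, which Markov's inequality controls; lighter codewords are
  left to the union bound.\<close>

theorem PB_le:
  assumes "0 \<le> p" "p \<le> 1" "M > 0"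
  shows "PB v m p \<le> 2 ^ m * exit_fun v m p / real M +
    (\<Sum>c\<in>{c \<in> RM v m. (\<exists>x. c x) \<and> card (supp m c) < M}. p ^ card (supp m c))"
proof -
  define small where "small = {c \<in> RM v m. (\<exists>x. c x) \<and> card (supp m c) < M}"
  \<comment> \<open>The number of bits that cannot be recovered from the others; its mean is
    \<open>2 ^ m\<close> times the EXIT function.\<close>
  define N where "N E = (\<Sum>i\<in>cube m. of_bool (unrec v m i (E \<inter> (cube m - {i}))) :: real)" for E
  define B where "B E = (\<Sum>c\<in>small. of_bool (supp m c \<subseteq> E) :: real)" for E
  have pointwise: "of_bool (\<exists>c\<in>RM v m. (\<exists>x. c x) \<and> supp m c \<subseteq> E) \<le> 1 / real M * N E + B E" for E
  proof (cases "\<exists>c\<in>RM v m. (\<exists>x. c x) \<and> supp m c \<subseteq> E")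
    case True
    then obtain c where c: "c \<in> RM v m" "\<exists>x. c x" "supp m c \<subseteq> E" by blast
    have N0: "1 / real M * N E \<ge> 0" and B0: "B E \<ge> 0" by (auto simp: N_def B_def intro: sum_nonneg)
    show ?thesis
    proof (cases "card (supp m c) < M")
      case small: True
      then have "c \<in> small" using c by (simp add: small_def)
      then have "(\<Sum>d\<in>{c}. of_bool (supp m d \<subseteq> E) :: real) \<le> B E"
        unfolding B_def by (intro sum_mono2) (auto simp: small_def)
      then have "1 \<le> B E" using c(3) by simp
      then show ?thesis unfolding of_bool_def if_P[OF True] using N0 by linarith
    next
      case False
      have "real M \<le> real (card (supp m c))" using False by simp
      also have "\<dots> = (\<Sum>i\<in>supp m c. 1)" by simp
      also have "\<dots> \<le> (\<Sum>i\<in>supp m c. of_bool (unrec v m i (E \<inter> (cube m - {i}))))"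
      proof (rule sum_mono)
        fix i assume i: "i \<in> supp m c"
        have "x = i \<or> x \<in> E \<inter> (cube m - {i})" if "c x" for x
          using RM_outside[OF c(1) that] c(3) that by blast
        then have "unrec v m i (E \<inter> (cube m - {i}))" unfolding unrec_def using c(1) i by blast
        then show "(1::real) \<le> of_bool (unrec v m i (E \<inter> (cube m - {i})))" by simp
      qed
      also have "\<dots> \<le> N E" unfolding N_def by (intro sum_mono2) auto
      finally have "1 \<le> 1 / real M * N E" using assms(3) by simp
      then show ?thesis unfolding of_bool_def if_P[OF True] using B0 by linarith
    qed
  next
    case False
    show ?thesis unfolding of_bool_def if_not_P[OF False] N_def B_def
      by (intro add_nonneg_nonneg mult_nonneg_nonneg sum_nonneg) auto
  qed
  have "PB v m p \<le> EP (cube m) p (\<lambda>E. 1 / real M * N E + B E)"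
    unfolding PB_eq using assms(1,2) pointwise by (rule EP_mono)
  also have "\<dots> = 1 / real M * EP (cube m) p N + EP (cube m) p B"
    by (simp only: EP_add EP_cmult)
  also have "EP (cube m) p N = (\<Sum>i\<in>cube m. exit_fun v m p)"
    unfolding N_def EP_sum
  proof (rule sum.cong[OF refl])
    fix i assume i: "i \<in> cube m"
    have "EP (cube m) p (\<lambda>E. of_bool (unrec v m i (E \<inter> (cube m - {i})))) =
        EP (cube m - {i}) p (\<lambda>E. of_bool (unrec v m i E))"
      by (rule EP_restrict) auto
    then show "EP (cube m) p (\<lambda>E. of_bool (unrec v m i (E \<inter> (cube m - {i})))) = exit_fun v m p"
      using EP_unrec[OF i] by simp
  qed
  also have "EP (cube m) p B = (\<Sum>c\<in>small. p ^ card (supp m c))"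
    unfolding B_def EP_sum by (intro sum.cong refl EP_superset) auto
  finally show ?thesis by (simp add: small_def mult.commute)
qed

section \<open>Decay of the block error probability\<close>

lemma rm_rate_le_shorter:
  assumes "n > 0"
  shows "rm_rate v n \<le> rm_rate v (n + k) + real k / (2 * sqrt (real n))"
proof (induction k)
  case (Suc k)
  have "rm_rate v (n + k) - rm_rate v (n + Suc k) = real ((n + k) choose v) / 2 ^ (n + k) / 2"
    using rm_rate_Suc[of v "n + k"] by simp
  also have "\<dots> \<le> 1 / sqrt (real (n + k)) / 2"
    using assms by (intro divide_right_mono binomial_le_sqrt) auto
  also have "\<dots> \<le> 1 / sqrt (real n) / 2"
    using assms by (intro divide_right_mono divide_left_mono) auto
  finally show ?case using Suc by (simp add: add_divide_distrib)
qed simp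

text \<open>Below \<open>1 / 2\<close>, \<open>exit_fun_step\<close> contracts by at least
  \<open>(1 + 1 / 2) / 2 = 3 / 4\<close>.\<close>

lemma exit_fun_halving:
  assumes "0 < p" "p < 1" "exit_fun v n p \<le> 1 / 2"
  shows "exit_fun v (n + j) p \<le> (3 / 4) ^ j"
proof -
  have "exit_fun v (n + j) p \<le> 1 / 2 \<and> exit_fun v (n + j) p \<le> (3 / 4) ^ j"
  proof (induction j)
    case 0
    then show ?case using assms by simp
  next
    case (Suc j)
    define h where "h = exit_fun v (n + j) p"
    have h: "0 \<le> h" "h \<le> 1 / 2" "h \<le> (3 / 4) ^ j"
      using Suc exit_fun_bounds[OF assms(1,2)] by (auto simp: h_def)
    have "exit_fun v (n + Suc j) p \<le> h * (1 + h) / 2"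
      using exit_fun_step[OF assms(1,2), of v "n + j"] by (simp add: h_def)
    also have "\<dots> \<le> h * (3 / 4)" using mult_left_mono[of "1 + h" "3 / 2" h] h by simp
    finally show ?case using h by simp
  qed
  then show ?thesis ..
qed

lemma exit_fun_antimono:
  assumes "0 < p" "p < 1"
  shows "exit_fun v (n + j) p \<le> exit_fun v n p"
  by (induction j) (use exit_fun_decreasing[OF assms] in \<open>auto intro: order.trans\<close>)

text \<open>Apply \<open>exit_fun_hyper_step\<close> with \<open>r = J div s\<close>. Then
  \<open>hyper_const p ^ r\<close> is at most \<open>(16 / 15) ^ J\<close>, while the root of
  \<open>exit_fun\<close> is at most \<open>(7 / 8) ^ J\<close> since
  \<open>3 / 4 \<le> 49 / 64\<close>; their product is \<open>(14 / 15) ^ J\<close>.\<close>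

lemma exit_fun_fast_decay:
  assumes p: "0 < p" "p < 1" and h: "exit_fun v n p \<le> (3 / 4) ^ J"
    and s: "hyper_const p \<le> (16 / 15) ^ s" "s > 0" and J: "J > 0"
  shows "exit_fun v (n + j) p \<le> ((14 / 15) ^ J + real s / real J) ^ j"
proof (induction j)
  case 0
  then show ?case using exit_fun_bounds[OF p] by simp
next
  case (Suc j)
  define r where "r = J div s"
  define h where "h = exit_fun v (n + j) p"
  have h0: "h \<ge> 0" using exit_fun_bounds[OF p] by (simp add: h_def)
  have hJ: "h \<le> (3 / 4) ^ J" using exit_fun_antimono[OF p, of v n j] assms(3) by (simp add: h_def)
  have "hyper_const p ^ r * sqrt h \<le> (16 / 15) ^ J * (7 / 8) ^ J"
  proof (rule mult_mono)
    have "hyper_const p ^ r \<le> ((16 / 15) ^ s) ^ r"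
      using s hyper_const_ge[OF p] by (intro power_mono) auto
    also have "\<dots> = (16 / 15) ^ (s * r)" by (simp add: power_mult)
    also have "\<dots> \<le> (16 / 15) ^ J" by (intro power_increasing) (auto simp: r_def)
    finally show "hyper_const p ^ r \<le> (16 / 15) ^ J" .
    have "sqrt h \<le> sqrt (((7 / 8) ^ J)\<^sup>2)"
    proof (rule real_sqrt_le_mono)
      have "(3 / 4 :: real) ^ J \<le> (49 / 64) ^ J" by (intro power_mono) auto
      then show "h \<le> ((7 / 8) ^ J)\<^sup>2" using hJ
        by (simp add: power2_eq_square flip: power_mult_distrib)
    qed
    then show "sqrt h \<le> (7 / 8) ^ J" by simp
  qed (use h0 in auto)
  also have "\<dots> = (14 / 15) ^ J" by (simp flip: power_mult_distrib)
  finally have 1: "hyper_const p ^ r * sqrt h \<le> (14 / 15) ^ J" .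
  have "real J / real s \<le> real r + 1"
  proof -
    have "J < s * (r + 1)" using s(2) by (simp add: r_def dividend_less_times_div)
    then have "real J \<le> real (s * (r + 1))" by linarith
    then show ?thesis using s(2) by (simp add: divide_le_eq algebra_simps)
  qed
  then have 2: "1 / (real r + 1) \<le> real s / real J"
    using le_imp_inverse_le[of "real J / real s" "real r + 1"] s(2) J by (simp add: inverse_eq_divide)
  have "exit_fun v (n + Suc j) p \<le> h * (hyper_const p ^ r * sqrt h + 1 / (real r + 1))"
    using exit_fun_hyper_step[OF p, of v "n + j" r] by (simp add: h_def)
  also have "\<dots> \<le> ((14 / 15) ^ J + real s / real J) ^ j * ((14 / 15) ^ J + real s / real J)"
    using Suc 1 2 h0 hyper_const_ge[OF p] by (intro mult_mono add_mono) (auto simp: h_def)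
  finally show ?case by (simp add: mult.commute)
qed

text \<open>Start at length \<open>n = m - 2 * j\<close> with \<open>j\<close> about
  \<open>c * sqrt m\<close>. The threshold bound makes \<open>exit_fun\<close> at most
  \<open>1 / 2\<close> there, the first \<open>j\<close> steps bring it down to
  \<open>(3 / 4) ^ j\<close>, and each of the other \<open>j\<close> steps gains a factor of order
  \<open>sqrt m\<close>.\<close>

lemma exit_fun_decay:
  fixes v :: "nat \<Rightarrow> nat"
  assumes p: "0 < p" "p < 1" and "\<eta> > 0"
    and rate: "\<forall>\<^sub>F m in sequentially. rm_rate (v m) m \<le> 1 - p - 3 / 4 * \<eta>"
  shows "\<exists>b>0. \<exists>c>0. \<forall>\<^sub>F m in sequentially. exit_fun (v m) m p \<le> (b / sqrt (real m)) powr (c * sqrt (real m))"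
proof -
  \<comment> \<open>Shortening by \<open>2 * j\<close> raises the rate by at most
    \<open>2 * c \<le> \<eta> / 4\<close>, so a gap of \<open>\<eta> / 2\<close> to the threshold
    remains.\<close>
  define c where "c = min (\<eta> / 8) 1"
  have c: "0 < c" "c \<le> \<eta> / 8" "c \<le> 1" using assms by (auto simp: c_def)
  define K where "K = hyper_const p"
  obtain s0 :: nat where s0: "K < (16 / 15) ^ s0" using real_arch_pow[of "16 / 15" K] by auto
  define s where "s = Suc s0"
  have s: "K \<le> (16 / 15) ^ s" "s > 0"
    using s0 order.strict_implies_order[OF order.strict_trans2[OF s0 power_increasing[of s0 s]]] by (auto simp: s_def)
  \<comment> \<open>From \<open>2 * s / j\<close> with \<open>j \<ge> c / 2 * sqrt m\<close>; the
    half in this lower bound pays for the floor in \<open>J\<close>.\<close>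
  define b where "b = 4 * real s / c"
  define J where "J m = nat \<lfloor>c * sqrt (real m)\<rfloor>" for m
  have b: "b > 0" using c s by (simp add: b_def)
  have ev1: "\<forall>\<^sub>F m::nat in sequentially. c * sqrt (real m) \<ge> 2" using c by real_asymp
  have ev2: "\<forall>\<^sub>F m::nat in sequentially. 2 * (c * sqrt (real m)) \<le> 3 / 4 * real m" using c by real_asymp
  have ev3: "\<forall>\<^sub>F m::nat in sequentially. 4 / (\<eta> * sqrt (real m)) \<le> 1 / 2" using assms by real_asymp
  have ev4: "\<forall>\<^sub>F m::nat in sequentially. b / sqrt (real m) < 1" using b by real_asymp
  have "filterlim J at_top sequentially"
    unfolding J_def using c by real_asymp
  moreover have "\<forall>\<^sub>F j::nat in sequentially. (14 / 15) ^ j \<le> real s / real j"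
    using s(2) by real_asymp
  ultimately have ev5: "\<forall>\<^sub>F m in sequentially. (14 / 15) ^ J m \<le> real s / real (J m)"
    by (rule eventually_compose_filterlim[rotated])
  have "\<forall>\<^sub>F m in sequentially. exit_fun (v m) m p \<le> (b / sqrt (real m)) powr (c / 2 * sqrt (real m))"
    using ev1 ev2 ev3 ev4 ev5 rate eventually_gt_at_top[of 0]
  proof eventually_elim
    case (elim m)
    define j where "j = J m"
    have jle: "real j \<le> c * sqrt (real m)" and jge: "real j \<ge> c * sqrt (real m) - 1"
      using elim(1) by (auto simp: j_def J_def)
    have jge': "real j \<ge> c / 2 * sqrt (real m)" "j > 0" using jge elim(1) by auto
    have "real (2 * j) \<le> 3 / 4 * real m" using jle elim(2) by simp
    then have j2: "2 * j \<le> m" by linarith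
    define n where "n = m - 2 * j"
    have n: "m = n + j + j" "m = n + 2 * j" using j2 by (auto simp: n_def)
    have "real n \<ge> real m / 4" using \<open>real (2 * j) \<le> 3 / 4 * real m\<close> n by simp
    then have sq: "sqrt (real n) \<ge> sqrt (real m) / 2" and n0: "n > 0"
      using elim(7) real_sqrt_le_mono[of "real m / 4" "real n"] by (auto simp: real_sqrt_divide)
    have sm: "sqrt (real m) > 0" using elim(7) by simp
    have "rm_rate (v m) n \<le> rm_rate (v m) m + real (2 * j) / (2 * sqrt (real n))"
      using rm_rate_le_shorter[OF n0, of "v m" "2 * j"] n(2) by simp
    also have "real (2 * j) / (2 * sqrt (real n)) \<le> 2 * (c * sqrt (real m)) / (2 * (sqrt (real m) / 2))"
      using jle sq sm by (intro frac_le) auto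
    also have "\<dots> = 2 * c" using sm by simp
    finally have "1 - rm_rate (v m) n - p \<ge> \<eta> / 2" using elim(6) c by linarith
    then have "exit_fun (v m) n p * (\<eta> / 2) \<le> exit_fun (v m) n p * (1 - rm_rate (v m) n - p)"
      using exit_fun_bounds[OF p] by (intro mult_left_mono) auto
    also have "\<dots> \<le> 1 / sqrt (real n)"
      using exit_fun_threshold[OF p, of "v m" n] binomial_le_sqrt[OF n0, of "v m"] by linarith
    also have "\<dots> \<le> 1 / (sqrt (real m) / 2)" using sq sm by (intro frac_le) auto
    finally have "exit_fun (v m) n p \<le> 4 / (\<eta> * sqrt (real m))"
      using assms(3) sm by (simp add: field_simps)
    then have "exit_fun (v m) n p \<le> 1 / 2" using elim(3) by linarith
    then have "exit_fun (v m) (n + j) p \<le> (3 / 4) ^ j" by (rule exit_fun_halving[OF p])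
    then have "exit_fun (v m) (n + j + j) p \<le> ((14 / 15) ^ j + real s / real j) ^ j"
      using s jge'(2) by (intro exit_fun_fast_decay[OF p]) (auto simp: K_def)
    also have "\<dots> \<le> (b / sqrt (real m)) ^ j"
    proof (rule power_mono)
      have "(14 / 15) ^ j + real s / real j \<le> 2 * real s / real j" using elim(5) by (simp add: j_def)
      also have "\<dots> \<le> 2 * real s / (c / 2 * sqrt (real m))"
        using jge' c sm by (intro divide_left_mono) auto
      also have "\<dots> = b / sqrt (real m)" using c by (simp add: b_def)
      finally show "(14 / 15) ^ j + real s / real j \<le> b / sqrt (real m)" .
    qed auto
    also have "\<dots> = (b / sqrt (real m)) powr real j"
      using b sm by (intro powr_realpow[symmetric]) auto
    also have "\<dots> \<le> (b / sqrt (real m)) powr (c / 2 * sqrt (real m))"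
      using elim(4) b sm jge'(1) by (intro powr_mono') auto
    finally show ?case using n(1) by simp
  qed
  then show ?thesis using b c by (intro exI[of _ b] exI[of _ "c / 2"] conjI) auto
qed

section \<open>Union bound over light codewords\<close>

lemma dyadic_level:
  fixes w m l0 v :: nat
  assumes "2 ^ (m - v - 1) \<le> w" "w < 2 ^ (m - l0)" "v < m" "l0 \<le> m"
  shows "\<exists>l\<in>{l0..v}. 2 ^ (m - l - 1) \<le> w \<and> w < 2 ^ (m - l)"
proof -
  define a where "a = floor_log w"
  have "w > 0" using assms(1) by (metis gr0I le_zero_eq power_not_zero zero_neq_numeral)
  then have a: "2 ^ a \<le> w" "w < 2 ^ Suc a"
    using floor_log_exp2_le[of w] floor_log_exp2_gt[of w] by (auto simp: a_def)
  have "(2::nat) ^ a < 2 ^ (m - l0)" using a assms by linarith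
  then have 1: "a < m - l0" by simp
  have "(2::nat) ^ (m - v - 1) < 2 ^ Suc a" using a assms by linarith
  then have 2: "m - v - 1 < Suc a" by (simp only: power_strict_increasing_iff one_less_numeral_iff semiring_norm)
  define l where "l = m - a - 1"
  have "l \<in> {l0..v}" "m - l - 1 = a" "m - l = Suc a" using 1 2 assms by (auto simp: l_def)
  then show ?thesis using a by metis
qed

text \<open>One dyadic weight class. The hypothesis \<open>tail\<close> bounds the dimension of the
  code of derivatives by a fraction \<open>\<tau>\<close> of its length, so
  \<open>card_low_weight_RM\<close> counts few codewords, each contained in the erasure pattern with
  probability at most \<open>p ^ (N / 2)\<close>.\<close>

lemma small_weight_level:
  fixes p \<tau> :: real
  assumes p: "0 < p" "p < 1" and l: "5 \<le> l" "l \<le> v" "v < m"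
    and tail: "(\<Sum>i\<le>v - (l - 4). real ((m - (l - 4)) choose i)) \<le> 2 ^ (m - (l - 4)) * \<tau>"
    and c1: "16 * (real m + 1) * \<tau> \<le> ln (1 / p) / 8"
    and c2: "(real m + 1) * (real m)\<^sup>2 \<le> ln (1 / p) / 8 * 2 ^ (m - v)"
  shows "(\<Sum>c\<in>{c \<in> RM v m. 2 ^ (m - l - 1) \<le> card (supp m c) \<and> card (supp m c) < 2 ^ (m - l)}.
      p ^ card (supp m c)) \<le> exp (- (2 ^ (m - v) * ln (1 / p) / 4))"
proof -
  define \<kappa> where "\<kappa> = ln (1 / p)"
  have \<kappa>: "\<kappa> > 0" using p by (simp add: \<kappa>_def ln_div)
  \<comment> \<open>The offset 4 makes the weight bound \<open>2 ^ (m - l)\<close> equal to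
    \<open>2 ^ n / 16\<close>, as the counting theorem demands; \<open>5 \<le> l\<close> keeps
    \<open>k\<close> positive.\<close>
  define k where "k = l - 4"
  define n where "n = m - k"
  have kn: "1 \<le> k" "k \<le> v" "m = n + k" "n = (m - l) + 4" using l by (auto simp: k_def n_def)
  define C where "C = {c \<in> RM v m. 2 ^ (m - l - 1) \<le> card (supp m c) \<and> card (supp m c) < 2 ^ (m - l)}"
  define F where "F = {f \<in> RM v m. 16 * card (supp m f) \<le> 2 ^ n}"
  define T where "T = (\<Sum>i\<le>v - k. n choose i)"
  define N where "N = (2::real) ^ (m - l)"
  have finF: "finite F" by (simp add: F_def)
  have "C \<subseteq> F" by (auto simp: C_def F_def kn(4) power_add)
  have "real (card C) \<le> real (card F)" using card_mono[OF finF \<open>C \<subseteq> F\<close>] by simp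
  also have "\<dots> \<le> real ((2 ^ (n * k) * 2 ^ T) ^ Suc m)"
    using card_low_weight_RM[OF kn(1,2), of n] unfolding F_def T_def kn(3)[symmetric] by (rule of_nat_mono)
  also have "\<dots> = 2 ^ ((n * k + T) * Suc m)" by (simp add: power_mult power_add)
  also have "\<dots> = exp (ln 2 * real ((n * k + T) * Suc m))"
    by (simp only: exp_of_nat2_mult) simp
  also have "\<dots> \<le> exp ((real m + 1) * ((real m)\<^sup>2 + 16 * N * \<tau>))"
  proof -
    have "real T \<le> 16 * N * \<tau>"
      using tail unfolding T_def of_nat_sum k_def[symmetric] n_def[symmetric] N_def kn(4) by (simp add: power_add)
    moreover have "real (n * k) \<le> (real m)\<^sup>2"
    proof -
      have "n * k \<le> m * m" using kn by (intro mult_mono) auto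
      then have "real (n * k) \<le> real (m * m)" by (rule of_nat_mono)
      then show ?thesis by (simp add: power2_eq_square)
    qed
    ultimately have "(real (n * k) + real T) * (real m + 1) \<le> ((real m)\<^sup>2 + 16 * N * \<tau>) * (real m + 1)"
      by (intro mult_right_mono) auto
    moreover have "ln 2 * real ((n * k + T) * Suc m) \<le> 1 * real ((n * k + T) * Suc m)"
      using ln_2_less_1 by (intro mult_right_mono) auto
    moreover have "real ((n * k + T) * Suc m) = (real (n * k) + real T) * (real m + 1)"
      by (simp add: algebra_simps)
    ultimately show ?thesis by (simp add: mult.commute)
  qed
  finally have cardC: "real (card C) \<le> exp ((real m + 1) * ((real m)\<^sup>2 + 16 * N * \<tau>))" .
  have N: "N > 0" "2 ^ (m - v) \<le> N" using l by (auto simp: N_def intro!: power_increasing)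
  have pw: "p ^ w \<le> exp (- (N / 2 * \<kappa>))" if "2 ^ (m - l - 1) \<le> w" for w :: nat
  proof -
    have "p ^ w \<le> p ^ (2 ^ (m - l - 1))" using that p by (intro power_decreasing) auto
    also have "\<dots> = exp (real (2 ^ (m - l - 1)) * ln p)" using p by (simp only: exp_of_nat_mult exp_ln)
    also have "real (2 ^ (m - l - 1)) = N / 2"
    proof -
      have "m - l = Suc (m - l - 1)" using l by simp
      then have "N = 2 * 2 ^ (m - l - 1)" unfolding N_def by (metis power_Suc)
      then show ?thesis by simp
    qed
    finally show ?thesis using p by (simp add: \<kappa>_def ln_div)
  qed
  have "(\<Sum>c\<in>C. p ^ card (supp m c)) \<le> (\<Sum>c\<in>C. exp (- (N / 2 * \<kappa>)))"
    by (intro sum_mono pw) (simp add: C_def)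
  also have "\<dots> = real (card C) * exp (- (N / 2 * \<kappa>))" by simp
  also have "\<dots> \<le> exp ((real m + 1) * ((real m)\<^sup>2 + 16 * N * \<tau>)) * exp (- (N / 2 * \<kappa>))"
    using cardC by (intro mult_right_mono) auto
  also have "\<dots> = exp ((real m + 1) * (real m)\<^sup>2 + 16 * (real m + 1) * \<tau> * N - N / 2 * \<kappa>)"
    by (simp add: exp_add[symmetric] algebra_simps)
  \<comment> \<open>Out of \<open>N * \<kappa> / 2\<close>, the hypotheses \<open>c1\<close> and
    \<open>c2\<close> each consume an eighth of \<open>N * \<kappa>\<close>, which leaves a
    quarter.\<close>
  also have "\<dots> \<le> exp (- (2 ^ (m - v) * \<kappa> / 4))"
  proof -
    have "16 * (real m + 1) * \<tau> * N \<le> \<kappa> / 8 * N" using c1 N by (intro mult_right_mono) (auto simp: \<kappa>_def)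
    moreover have "(real m + 1) * (real m)\<^sup>2 \<le> \<kappa> / 8 * N"
    proof -
      have "\<kappa> / 8 * 2 ^ (m - v) \<le> \<kappa> / 8 * N" using N \<kappa> by (intro mult_left_mono) auto
      then show ?thesis using c2 by (simp add: \<kappa>_def)
    qed
    moreover have "2 ^ (m - v) * \<kappa> \<le> N * \<kappa>" using N \<kappa> by (intro mult_right_mono) auto
    moreover have "\<kappa> / 8 * N = N * \<kappa> / 8" "N / 2 * \<kappa> = N * \<kappa> / 2" by simp_all
    ultimately have "(real m + 1) * (real m)\<^sup>2 + 16 * (real m + 1) * \<tau> * N - N / 2 * \<kappa> \<le> - (2 ^ (m - v) * \<kappa> / 4)"
      by linarith
    then show ?thesis by simp
  qed
  finally show ?thesis by (simp add: C_def \<kappa>_def)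
qed

lemma sum_UNION_le:
  fixes g :: "'a \<Rightarrow> real"
  assumes "finite I" "\<And>i. i \<in> I \<Longrightarrow> finite (A i)" "\<And>x. 0 \<le> g x"
  shows "sum g (\<Union>i\<in>I. A i) \<le> (\<Sum>i\<in>I. sum g (A i))"
  using assms
proof (induction I rule: finite_induct)
  case (insert i I)
  let ?B = "\<Union>i\<in>I. A i"
  have "sum g (A i \<union> ?B) = sum g (A i) + sum g ?B - sum g (A i \<inter> ?B)"
    using insert by (intro sum_Un) auto
  also have "\<dots> \<le> sum g (A i) + sum g ?B"
    using insert.prems(2) by (simp add: sum_nonneg)
  finally show ?case using insert by (auto intro: order.trans)
qed simp

text \<open>By \<open>RM_min_weight\<close> no nonzero codeword has weight below
  \<open>2 ^ (m - v - 1)\<close>, so only the levels from \<open>l0\<close> to \<open>v\<close>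
  occur, at most \<open>m + 1\<close> of them.\<close>

lemma small_weight_sum:
  fixes p \<tau> :: real
  assumes p: "0 < p" "p < 1" and l0: "5 \<le> l0" "l0 \<le> m" "v < m"
    and tail: "\<And>l. l0 \<le> l \<Longrightarrow> l \<le> v \<Longrightarrow>
      (\<Sum>i\<le>v - (l - 4). real ((m - (l - 4)) choose i)) \<le> 2 ^ (m - (l - 4)) * \<tau>"
    and c1: "16 * (real m + 1) * \<tau> \<le> ln (1 / p) / 8"
    and c2: "(real m + 1) * (real m)\<^sup>2 \<le> ln (1 / p) / 8 * 2 ^ (m - v)"
  shows "(\<Sum>c\<in>{c \<in> RM v m. (\<exists>x. c x) \<and> card (supp m c) < 2 ^ (m - l0)}. p ^ card (supp m c))
    \<le> (real m + 1) * exp (- (2 ^ (m - v) * ln (1 / p) / 4))"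
proof -
  define C where "C l = {c \<in> RM v m. 2 ^ (m - l - 1) \<le> card (supp m c) \<and> card (supp m c) < 2 ^ (m - l)}" for l
  define X where "X = exp (- (2 ^ (m - v) * ln (1 / p) / 4))"
  have "{c \<in> RM v m. (\<exists>x. c x) \<and> card (supp m c) < 2 ^ (m - l0)} \<subseteq> (\<Union>l\<in>{l0..v}. C l)"
  proof
    fix c assume "c \<in> {c \<in> RM v m. (\<exists>x. c x) \<and> card (supp m c) < 2 ^ (m - l0)}"
    then obtain x where c: "c \<in> RM v m" "c x" "card (supp m c) < 2 ^ (m - l0)" by blast
    have "m = (m - v - 1) + Suc v" using l0 by simp
    then have "2 ^ (m - v - 1) \<le> card (supp m c)" using RM_min_weight[of c v "m - v - 1" x] c by simp
    from dyadic_level[OF this c(3) l0(3,2)] obtain l where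
      "l \<in> {l0..v}" "2 ^ (m - l - 1) \<le> card (supp m c)" "card (supp m c) < 2 ^ (m - l)" by blast
    then show "c \<in> (\<Union>l\<in>{l0..v}. C l)" using c(1) unfolding C_def by blast
  qed
  then have "(\<Sum>c\<in>{c \<in> RM v m. (\<exists>x. c x) \<and> card (supp m c) < 2 ^ (m - l0)}. p ^ card (supp m c))
      \<le> (\<Sum>c\<in>(\<Union>l\<in>{l0..v}. C l). p ^ card (supp m c))"
    using p by (intro sum_mono2) (auto simp: C_def)
  also have "\<dots> \<le> (\<Sum>l\<in>{l0..v}. \<Sum>c\<in>C l. p ^ card (supp m c))"
    using p by (intro sum_UNION_le) (auto simp: C_def)
  also have "\<dots> \<le> (\<Sum>l\<in>{l0..v}. X)"
    unfolding C_def X_def using assms by (intro sum_mono small_weight_level) auto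
  also have "\<dots> = real (card {l0..v}) * X" by simp
  also have "\<dots> \<le> (real m + 1) * X"
    using l0 by (intro mult_right_mono) (auto simp: X_def)
  finally show ?thesis by (simp add: X_def)
qed

text \<open>The weights are cut at \<open>2 ^ (m - l0)\<close> with \<open>l0\<close> the ceiling of
  \<open>y\<close>: \<open>PB_le\<close> pays \<open>2 ^ l0\<close> for the heavy codewords, and
  \<open>small_weight_sum\<close> treats the rest with \<open>\<tau>\<close> from Hoeffding's
  inequality.\<close>

lemma PB_bound:
  fixes p B y :: real
  assumes p: "0 < p" "p < 1" and "0 \<le> B"
    and v: "real v \<le> real m / 2 + B * sqrt (real m)" "real v \<le> 2 / 3 * real m" "0 < m"
    and y: "9 \<le> y" "y + 1 \<le> real m" "4 * B * sqrt (real m) \<le> y - 4"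
    and c1: "16 * (real m + 1) * exp (- ((y - 4)\<^sup>2 / (8 * real m))) \<le> ln (1 / p) / 8"
    and c2: "(real m + 1) * (real m)\<^sup>2 \<le> ln (1 / p) / 8 * 2 powr (real m / 3)"
  shows "PB v m p \<le> 2 powr (y + 1) * exit_fun v m p + (real m + 1) * exp (- (2 powr (real m / 3) * ln (1 / p) / 4))"
proof -
  define l0 where "l0 = nat \<lceil>y\<rceil>"
  define \<tau> where "\<tau> = exp (- ((y - 4)\<^sup>2 / (8 * real m)))"
  have l0: "y \<le> real l0" "real l0 \<le> y + 1" using y by (auto simp: l0_def)
  have vm: "v < m" using v by linarith
  have l0m: "5 \<le> l0" "l0 \<le> m" using l0 y by linarith+
  have lnp: "ln (1 / p) > 0" using p by (simp add: ln_div)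
  have pow: "2 powr (real m / 3) \<le> 2 ^ (m - v)"
  proof -
    have "real m / 3 \<le> real (m - v)" using v vm by (simp add: of_nat_diff)
    then have "2 powr (real m / 3) \<le> 2 powr real (m - v)" by (intro powr_mono) auto
    then show ?thesis by (simp add: powr_realpow)
  qed
  have tail: "(\<Sum>i\<le>v - (l - 4). real ((m - (l - 4)) choose i)) \<le> 2 ^ (m - (l - 4)) * \<tau>"
    if l: "l0 \<le> l" "l \<le> v" for l
  proof -
    define k where "k = l - 4"
    define n where "n = m - k"
    define x where "x = real n / 2 - real (v - k)"
    have kv: "k \<le> v" "n > 0" "real n = real m - real k" "n \<le> m" using l vm l0m by (auto simp: k_def n_def)
    have ky: "y - 4 \<le> real k"
    proof -
      have "y \<le> real l" using l0 l by linarith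
      then show ?thesis using l l0m by (simp add: k_def of_nat_diff)
    qed
    have "x = (real m - real k) / 2 - (real v - real k)" using kv by (simp add: x_def of_nat_diff)
    moreover have "4 * (B * sqrt (real m)) \<le> y - 4" using y(3) by simp
    \<comment> \<open>Taking \<open>k\<close> derivatives lowers the degree by \<open>k\<close> but
      half the length only by \<open>k / 2\<close>; the excess \<open>B * sqrt m\<close> of
      \<open>v\<close> over \<open>m / 2\<close> costs at most half of that gain.\<close>
    ultimately have xk: "real k / 4 \<le> x" using v(1) ky by argo
    then have x0: "0 \<le> x" by linarith
    have "(\<Sum>i\<le>v - k. real (n choose i)) \<le> 2 ^ n * exp (- 2 * x\<^sup>2 / real n)"
      by (rule binomial_tail[OF kv(2) x0]) (simp add: x_def)
    also have "exp (- 2 * x\<^sup>2 / real n) \<le> \<tau>"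
    proof -
      have "(y - 4)\<^sup>2 / (8 * real m) \<le> (4 * x)\<^sup>2 / (8 * real n)"
        using ky xk y kv v(3) by (intro frac_le power_mono) auto
      also have "\<dots> = 2 * x\<^sup>2 / real n" by (simp add: power_mult_distrib)
      finally show ?thesis by (simp add: \<tau>_def)
    qed
    finally show ?thesis by (simp add: k_def n_def)
  qed
  have c2': "(real m + 1) * (real m)\<^sup>2 \<le> ln (1 / p) / 8 * 2 ^ (m - v)"
    using c2 mult_left_mono[OF pow, of "ln (1 / p) / 8"] lnp by linarith
  have "PB v m p \<le> 2 ^ m * exit_fun v m p / real (2 ^ (m - l0)) +
    (\<Sum>c\<in>{c \<in> RM v m. (\<exists>x. c x) \<and> card (supp m c) < 2 ^ (m - l0)}. p ^ card (supp m c))"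
    using p by (intro PB_le) auto
  also have "2 ^ m * exit_fun v m p / real (2 ^ (m - l0)) = 2 ^ l0 * exit_fun v m p"
  proof -
    have "(2::real) ^ m = 2 ^ l0 * 2 ^ (m - l0)" using l0m by (simp flip: power_add)
    then show ?thesis by simp
  qed
  also have "2 ^ l0 * exit_fun v m p \<le> 2 powr (y + 1) * exit_fun v m p"
  proof (rule mult_right_mono)
    have "2 powr real l0 \<le> 2 powr (y + 1)" using l0 by (intro powr_mono) auto
    then show "2 ^ l0 \<le> 2 powr (y + 1)" by (simp add: powr_realpow)
  qed (rule exit_fun_bounds[OF p])
  also have "(\<Sum>c\<in>{c \<in> RM v m. (\<exists>x. c x) \<and> card (supp m c) < 2 ^ (m - l0)}. p ^ card (supp m c))
      \<le> (real m + 1) * exp (- (2 ^ (m - v) * ln (1 / p) / 4))"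
    using small_weight_sum[OF p l0m vm tail _ c2'] c1 by (simp add: \<tau>_def)
  also have "\<dots> \<le> (real m + 1) * exp (- (2 powr (real m / 3) * ln (1 / p) / 4))"
    using mult_right_mono[OF pow, of "ln (1 / p)"] lnp by (intro mult_left_mono) auto
  finally show ?thesis by simp
qed

section \<open>Convergence of the block error probability\<close>

lemma PB_0: "PB v m 0 = 0"
proof -
  have "\<not> (\<exists>c\<in>RM v m. (\<exists>x. c x) \<and> supp m c \<subseteq> {})"
  proof (intro notI, elim bexE conjE exE)
    fix c x assume "c \<in> RM v m" "supp m c \<subseteq> {}" "c x"
    then show False using RM_outside[of c v m x] by blast
  qed
  moreover have "finite (cube m)" by simp
  ultimately show ?thesis unfolding PB_eq by (simp only: EP_0 of_bool_eq)
qed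

lemma PB_nonneg: "0 \<le> p \<Longrightarrow> p \<le> 1 \<Longrightarrow> 0 \<le> PB v m p"
  unfolding PB_eq by (intro EP_nonneg) auto

lemma nat_floor_bound:
  fixes x z :: real
  assumes "x \<le> z" "0 \<le> z"
  shows "real (nat (max \<lfloor>x\<rfloor> 0)) \<le> z"
proof (cases "\<lfloor>x\<rfloor> \<ge> 0")
  case True
  then show ?thesis using order.trans[OF of_int_floor_le[of x] assms(1)] by simp
qed (use assms in simp)

theorem theorem7:
  fixes r :: real and v :: "nat \<Rightarrow> nat"
  assumes "0 < r" and "r < 1"
    and "\<And>m. v m = nat (max \<lfloor>real m / 2 + sqrt (real m) / 2 * Qinv (1 - r)\<rfloor> 0)"
  shows "(\<lambda>m. rm_rate (v m) m) \<longlonglongrightarrow> r \<and> capacity_achieving v r"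
proof
  show rate: "(\<lambda>m. rm_rate (v m) m) \<longlonglongrightarrow> r"
    using rm_rate_limit[OF assms(3)] Qfun_Qinv[of "1 - r"] assms(1,2) by simp
  show "capacity_achieving v r"
    unfolding capacity_achieving_def
  proof (intro allI impI)
    fix p :: real assume p: "0 \<le> p \<and> p < 1 - r"
    show "(\<lambda>m. PB (v m) m p) \<longlonglongrightarrow> 0"
    \<comment> \<open>The Fourier estimates assume \<open>0 < p\<close>; without erasures decoding
      never fails.\<close>
    proof (cases "p = 0")
      case False
      then have p01: "0 < p" "p < 1" using p assms by auto
      define \<eta> where "\<eta> = 1 - r - p"
      have \<eta>: "\<eta> > 0" using p by (simp add: \<eta>_def)
      have "\<forall>\<^sub>F m in sequentially. rm_rate (v m) m < r + \<eta> / 4"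
        using rate \<eta> by (intro order_tendstoD) auto
      then have "\<forall>\<^sub>F m in sequentially. rm_rate (v m) m \<le> 1 - p - 3 / 4 * \<eta>"
        by (rule eventually_mono) (simp add: \<eta>_def field_simps)
      from exit_fun_decay[OF p01 \<eta> this] obtain b c where bc: "b > 0" "c > 0"
        "\<forall>\<^sub>F m in sequentially. exit_fun (v m) m p \<le> (b / sqrt (real m)) powr (c * sqrt (real m))"
        by blast
      define B where "B = \<bar>Qinv (1 - r)\<bar> / 2"
      have B: "B \<ge> 0" by (simp add: B_def)
      define \<kappa> where "\<kappa> = ln (1 / p)"
      have \<kappa>: "\<kappa> > 0" using p01 by (simp add: \<kappa>_def ln_div)
      \<comment> \<open>The exponent \<open>3 / 4\<close> lies strictly between \<open>1 / 2\<close>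
        and 1. Above \<open>1 / 2\<close>, the square of \<open>y\<close> divided by
        \<open>m\<close> outgrows \<open>ln m\<close>, so the tail beats the factor
        \<open>m + 1\<close>. Below 1, \<open>y\<close> is of smaller order than
        \<open>sqrt m * ln m\<close>, so \<open>2 powr y\<close> loses against the decay of the EXIT
        function.\<close>
      define y where "y m = sqrt (real m) * ln (real m) powr (3 / 4)" for m :: nat
      define g where "g m = 2 powr (y m + 1) * (b / sqrt (real m)) powr (c * sqrt (real m)) +
        (real m + 1) * exp (- (2 powr (real m / 3) * \<kappa> / 4))" for m :: nat
      have vB: "real (v m) \<le> real m / 2 + B * sqrt (real m)" for m
      proof -
        have "sqrt (real m) / 2 * Qinv (1 - r) \<le> sqrt (real m) / 2 * \<bar>Qinv (1 - r)\<bar>"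
          by (intro mult_left_mono) auto
        then have "real m / 2 + sqrt (real m) / 2 * Qinv (1 - r) \<le> real m / 2 + B * sqrt (real m)"
          by (simp add: B_def mult.commute)
        then show ?thesis unfolding assms(3) using B by (intro nat_floor_bound) auto
      qed
      have e1: "\<forall>\<^sub>F m::nat in sequentially. real m / 2 + B * sqrt (real m) \<le> 2 / 3 * real m"
        by real_asymp
      have e2: "\<forall>\<^sub>F m::nat in sequentially. 9 \<le> y m" unfolding y_def by real_asymp
      have e3: "\<forall>\<^sub>F m::nat in sequentially. y m + 1 \<le> real m" unfolding y_def by real_asymp
      have e4: "\<forall>\<^sub>F m::nat in sequentially. 4 * B * sqrt (real m) \<le> y m - 4"
        unfolding y_def by real_asymp
      have e5: "\<forall>\<^sub>F m::nat in sequentially.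
          16 * (real m + 1) * exp (- ((y m - 4)\<^sup>2 / (8 * real m))) \<le> \<kappa> / 8"
        unfolding y_def using \<kappa> by real_asymp
      have e6: "\<forall>\<^sub>F m::nat in sequentially. (real m + 1) * (real m)\<^sup>2 \<le> \<kappa> / 8 * 2 powr (real m / 3)"
        using \<kappa> by real_asymp
      have upper: "\<forall>\<^sub>F m in sequentially. PB (v m) m p \<le> g m"
        using e1 e2 e3 e4 e5 e6 bc(3) eventually_gt_at_top[of 0]
      proof eventually_elim
        case (elim m)
        have "PB (v m) m p \<le> 2 powr (y m + 1) * exit_fun (v m) m p +
            (real m + 1) * exp (- (2 powr (real m / 3) * ln (1 / p) / 4))"
          by (rule PB_bound[OF p01 B vB order.trans[OF vB elim(1)] elim(8,2,3,4)])
            (use elim(5,6) in \<open>simp_all add: \<kappa>_def\<close>)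
        also have "\<dots> \<le> g m"
          unfolding g_def \<kappa>_def using elim(7) by (intro add_right_mono mult_left_mono) auto
        finally show ?case .
      qed
      have g0: "g \<longlonglongrightarrow> 0"
      proof -
        have "(\<lambda>m. 2 powr (y m + 1) * (b / sqrt (real m)) powr (c * sqrt (real m))) \<longlonglongrightarrow> 0"
          unfolding y_def using bc(1,2) by real_asymp
        moreover have "(\<lambda>m. (real m + 1) * exp (- (2 powr (real m / 3) * \<kappa> / 4))) \<longlonglongrightarrow> 0"
          using \<kappa> by real_asymp
        ultimately show ?thesis unfolding g_def[abs_def] by (rule tendsto_add_zero)
      qed
      have lower: "\<forall>\<^sub>F m in sequentially. 0 \<le> PB (v m) m p"
        by (rule always_eventually) (use PB_nonneg p01 in simp)
      show ?thesis by (rule tendsto_sandwich[OF lower upper tendsto_const g0])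
    qed (simp add: PB_0)
  qed
qed

end
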